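(* Let $\tilde{\mathbb B}$ be the open unit ball centered at $0$ in $\mathbb C^n$, let $\mathsf A$ be a compact metric space and $\sigma:\mathsf A\to\mathsf A$ a homeomorphism. Let $(f_{\mathsf a})_{\mathsf a\in\mathsf A}$ be a $C^0$-family of holomorphic maps on $\tilde{\mathbb B}$ such that: (H1) for every $\mathsf a\in\mathsf A$, $f_{\mathsf a}$ is a contracting biholomorphism from $\tilde{\mathbb B}$ into $\tilde{\mathbb B}$ which fixes $0$; (H2) for every $\mathsf a\in\mathsf A$, $D_0f_{\mathsf a}=\mathrm{diag}(\lambda_{\mathsf a,1},\dots,\lambda_{\mathsf a,n})$ is diagonal; (H3) for any $1\le i\le n$ and any multiindex $k\in\mathbb N^n$ with $|k|\ne1$, we have $|\lambda_{\mathsf a,i}|\ne|\lambda_{\mathsf a}^{k}|$ for all $\mathsf a\in\mathsf A$, and the sign of the difference does not depend on $\mathsf a$. Then there exists a unique $C^0$-family $(h_{\mathsf a})_{\mathsf a\in\mathsf A}$ of biholomorphic maps from $\tilde{\mathbb B}$ into $\mathbb C^n$ such that for every $\mathsf a\in\mathsf A$ $$D_0h_{\mathsf a}=\mathrm{id},\qquad h_{\mathsf a}(0)=0,\qquad h_{\sigma(\mathsf a)}\circ f_{\mathsf a}(x)=D_0f_{\mathsf a}\circ h_{\mathsf a}(x)\quad\forall x\in\tilde{\mathbb B}.$$ Moreover, $(h_{\mathsf a})_{\mathsf a}$ depends holomorphically on $f$.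
   Context: A map is biholomorphic "from $\tilde{\mathbb B}$ into" a space if it is a biholomorphism onto its image. Contracting means $\|D_xf_{\mathsf a}\|<1$ for every $x\in\tilde{\mathbb B}$. For $k\in\mathbb N^n$, $|k|=k_1+\dots+k_n$ and $\lambda_{\mathsf a}^k=\prod_i\lambda_{\mathsf a,i}^{k_i}$. Let $\mathcal B$ be the complex Banach space (sup norm) of bounded holomorphic maps $\tilde{\mathbb B}\to\mathbb C^n$ vanishing at $0$ with diagonal differential at $0$. $C^0$-families of holomorphic maps are elements of the complex Banach space $C^0(\mathsf A,\mathcal B)$. A continuous map between an open subset of a complex Banach space and a complex Banach space is holomorphic if it is complex Fréchet differentiable at each point. "$(h_{\mathsf a})$ depends holomorphically on $f$" means that $f\mapsto (h_{\mathsf a})_{\mathsf a}$ is holomorphic as a map into $C^0(\mathsf A,\mathcal B)$, in the sense that for each $f$ satisfying (H1)–(H3) there are an open neighborhood $\mathcal O$ of $f$ in $C^0(\mathsf A,\mathcal B)$ and a holomorphic map $\mathcal O\to C^0(\mathsf A,\mathcal B)$ which sends each $g\in\mathcal O$ satisfying (H1)–(H3) to its linearizing family. *)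

theory Defs
  imports "HOL-Analysis.Analysis"
begin

section \<open>Complex normed vector spaces and holomorphic maps between them\<close>

class complex_normed_vector = real_normed_vector +
  fixes scaleC :: "complex \<Rightarrow> 'a \<Rightarrow> 'a" (infixr "*\<^sub>C" 75)
  assumes scaleC_add_right: "c *\<^sub>C (x + y) = c *\<^sub>C x + c *\<^sub>C y"
    and scaleC_add_left: "(c + d) *\<^sub>C x = c *\<^sub>C x + d *\<^sub>C x"
    and scaleC_scaleC: "c *\<^sub>C d *\<^sub>C x = (c * d) *\<^sub>C x"
    and scaleC_of_real: "complex_of_real r *\<^sub>C x = r *\<^sub>R x"
    and norm_scaleC: "norm (c *\<^sub>C x) = cmod c * norm x"

lemma bounded_linear_scaleC:
  "bounded_linear (\<lambda>x :: 'a :: complex_normed_vector. c *\<^sub>C x)"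
proof (rule bounded_linear_intro)
  fix x y :: 'a and r :: real
  show "c *\<^sub>C (x + y) = c *\<^sub>C x + c *\<^sub>C y" by (rule scaleC_add_right)
  show "c *\<^sub>C (r *\<^sub>R x) = r *\<^sub>R (c *\<^sub>C x)"
    by (metis scaleC_of_real scaleC_scaleC mult.commute)
  show "norm (c *\<^sub>C x) \<le> norm x * cmod c" by (simp add: norm_scaleC mult.commute)
qed

instantiation complex :: complex_normed_vector
begin

definition scaleC_complex :: "complex \<Rightarrow> complex \<Rightarrow> complex"
  where "scaleC_complex = (*)"

instance
  by standard (auto simp: scaleC_complex_def algebra_simps norm_mult scaleR_conv_of_real)

end

instantiation vec :: (complex_normed_vector, finite) complex_normed_vector
begin

definition scaleC_vec :: "complex \<Rightarrow> 'a ^ 'b \<Rightarrow> 'a ^ 'b"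
  where "scaleC_vec c x = (\<chi> i. c *\<^sub>C (x $ i))"

instance
proof
  fix c d :: complex and r :: real and x y :: "'a ^ 'b"
  show "c *\<^sub>C (x + y) = c *\<^sub>C x + c *\<^sub>C y"
    by (simp add: scaleC_vec_def vec_eq_iff scaleC_add_right)
  show "(c + d) *\<^sub>C x = c *\<^sub>C x + d *\<^sub>C x"
    by (simp add: scaleC_vec_def vec_eq_iff scaleC_add_left)
  show "c *\<^sub>C d *\<^sub>C x = (c * d) *\<^sub>C x"
    by (simp add: scaleC_vec_def vec_eq_iff scaleC_scaleC)
  show "complex_of_real r *\<^sub>C x = r *\<^sub>R x"
    by (simp add: scaleC_vec_def vec_eq_iff scaleC_of_real)
  show "norm (c *\<^sub>C x) = cmod c * norm x"
    by (simp add: scaleC_vec_def norm_vec_def norm_scaleC L2_set_right_distrib)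
qed

end

instantiation bcontfun :: (topological_space, complex_normed_vector) complex_normed_vector
begin

definition scaleC_bcontfun :: "complex \<Rightarrow> ('a \<Rightarrow>\<^sub>C 'b) \<Rightarrow> ('a \<Rightarrow>\<^sub>C 'b)"
  where "scaleC_bcontfun c f = Bcontfun (\<lambda>x. c *\<^sub>C apply_bcontfun f x)"

lemma apply_bcontfun_scaleC:
  "apply_bcontfun (c *\<^sub>C f) x = c *\<^sub>C apply_bcontfun f x" for f :: "'a \<Rightarrow>\<^sub>C 'b"
proof -
  have "bounded ((\<lambda>y. c *\<^sub>C y) ` range (apply_bcontfun f))"
    by (intro bounded_linear_image bounded_linear_scaleC) simp
  then have "(\<lambda>x. c *\<^sub>C apply_bcontfun f x) \<in> bcontfun"
    by (auto simp: bcontfun_def image_comp o_def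
        intro!: bounded_linear.continuous_on[OF bounded_linear_scaleC])
  then show ?thesis by (simp add: scaleC_bcontfun_def Bcontfun_inverse)
qed

instance
proof
  fix c d :: complex and r :: real and f g :: "'a \<Rightarrow>\<^sub>C 'b"
  show "c *\<^sub>C (f + g) = c *\<^sub>C f + c *\<^sub>C g"
    by (rule bcontfun_eqI) (simp add: apply_bcontfun_scaleC scaleC_add_right)
  show "(c + d) *\<^sub>C f = c *\<^sub>C f + d *\<^sub>C f"
    by (rule bcontfun_eqI) (simp add: apply_bcontfun_scaleC scaleC_add_left)
  show scs: "c *\<^sub>C d *\<^sub>C f = (c * d) *\<^sub>C f" for c d :: complex and f :: "'a \<Rightarrow>\<^sub>C 'b"
    by (rule bcontfun_eqI) (simp add: apply_bcontfun_scaleC scaleC_scaleC)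
  show scr: "complex_of_real r *\<^sub>C f = r *\<^sub>R f" for r and f :: "'a \<Rightarrow>\<^sub>C 'b"
    by (rule bcontfun_eqI) (simp add: apply_bcontfun_scaleC scaleC_of_real)
  have le: "norm (c *\<^sub>C f) \<le> cmod c * norm f" for c and f :: "'a \<Rightarrow>\<^sub>C 'b"
    by (rule norm_bound) (simp add: apply_bcontfun_scaleC norm_scaleC mult_left_mono norm_bounded)
  show "norm (c *\<^sub>C f) = cmod c * norm f"
  proof (cases "c = 0")
    case True
    then show ?thesis using scr[of 0 f] by simp
  next
    case False
    have "norm f \<le> cmod (inverse c) * norm (c *\<^sub>C f)"
      using le[of "inverse c" "c *\<^sub>C f"] scr[of 1 f] False by (simp add: scs)
    then have "cmod c * norm f \<le> cmod c * (cmod (inverse c) * norm (c *\<^sub>C f))"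
      by (rule mult_left_mono) simp
    also have "\<dots> = norm (c *\<^sub>C f)"
      using False by (simp add: norm_inverse)
    finally have "cmod c * norm f \<le> norm (c *\<^sub>C f)" .
    with le[of c f] show ?thesis by simp
  qed
qed

end

text \<open>Complex Frechet differentiability: \<open>has_derivative\<close> provides a bounded real-linear
  derivative, which is required to be complex-linear in addition.\<close>

definition holomorphic_map_on ::
    "('a::complex_normed_vector \<Rightarrow> 'b::complex_normed_vector) \<Rightarrow> 'a set \<Rightarrow> bool" where
  "holomorphic_map_on f U \<longleftrightarrow>
     open U \<and>
     (\<forall>x\<in>U. \<exists>D. (f has_derivative D) (at x) \<and> (\<forall>c v. D (c *\<^sub>C v) = c *\<^sub>C D v))"

text \<open>Biholomorphism from \<open>S\<close> onto its image, which is contained in \<open>T\<close>. Openness of the image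
  is part of \<open>holomorphic_map_on g (f ` S)\<close>.\<close>

definition biholomorphic_into ::
    "('a::complex_normed_vector \<Rightarrow> 'b::complex_normed_vector) \<Rightarrow> 'a set \<Rightarrow> 'b set \<Rightarrow> bool" where
  "biholomorphic_into f S T \<longleftrightarrow>
     f ` S \<subseteq> T \<and> holomorphic_map_on f S \<and>
     (\<exists>g. holomorphic_map_on g (f ` S) \<and> (\<forall>x\<in>S. g (f x) = x))"


section \<open>The space of bounded holomorphic maps on the unit ball\<close>

definition diag_map :: "complex ^ 'n \<Rightarrow> complex ^ 'n \<Rightarrow> complex ^ 'n" where
  "diag_map d v = (\<chi> i. d $ i * v $ i)"

text \<open>Maps on the unit ball are represented by total functions vanishing outside the ball, so that
  equality of representatives is equality on the ball.\<close>

definition bounded_hol_maps :: "(complex ^ 'n::finite \<Rightarrow> complex ^ 'n) set" where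
  "bounded_hol_maps =
     {f. holomorphic_map_on f (ball 0 1) \<and> bounded (f ` ball 0 1) \<and> f 0 = 0 \<and>
         (\<exists>d. (f has_derivative diag_map d) (at 0)) \<and> (\<forall>x. x \<notin> ball 0 1 \<longrightarrow> f x = 0)}"

lemma bounded_hol_maps_has_derivative:
  assumes "f \<in> bounded_hol_maps" "x \<in> ball 0 1"
  shows "\<exists>D. (f has_derivative D) (at x) \<and> (\<forall>c v. D (c *\<^sub>C v) = c *\<^sub>C D v)"
  using assms unfolding bounded_hol_maps_def holomorphic_map_on_def by blast

lemma bounded_hol_maps_zero:
  "(\<lambda>_ :: complex ^ 'n::finite. 0 :: complex ^ 'n) \<in> bounded_hol_maps"
proof -
  have "diag_map 0 = (\<lambda>_ :: complex ^ 'n. 0)"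
    by (auto simp: diag_map_def vec_eq_iff fun_eq_iff)
  then have "((\<lambda>_ :: complex ^ 'n. 0 :: complex ^ 'n) has_derivative diag_map 0) (at 0)"
    by simp
  moreover have "c *\<^sub>C (0 :: complex ^ 'n) = 0" for c
    by (simp add: scaleC_vec_def scaleC_complex_def vec_eq_iff)
  ultimately show ?thesis
    by (auto simp: bounded_hol_maps_def holomorphic_map_on_def image_constant_conv
        intro!: exI[of _ "\<lambda>_. 0"])
qed

lemma bounded_hol_maps_add:
  assumes "f \<in> bounded_hol_maps" "g \<in> bounded_hol_maps"
  shows "(\<lambda>x. f x + g x) \<in> bounded_hol_maps"
proof -
  have "holomorphic_map_on (\<lambda>x. f x + g x) (ball 0 1)"
    unfolding holomorphic_map_on_def
  proof (intro conjI ballI)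
    fix x :: "complex ^ 'a" assume x: "x \<in> ball 0 1"
    obtain D where D: "(f has_derivative D) (at x)" "\<forall>c v. D (c *\<^sub>C v) = c *\<^sub>C D v"
      using bounded_hol_maps_has_derivative[OF assms(1) x] by blast
    obtain E where E: "(g has_derivative E) (at x)" "\<forall>c v. E (c *\<^sub>C v) = c *\<^sub>C E v"
      using bounded_hol_maps_has_derivative[OF assms(2) x] by blast
    show "\<exists>D. ((\<lambda>x. f x + g x) has_derivative D) (at x) \<and> (\<forall>c v. D (c *\<^sub>C v) = c *\<^sub>C D v)"
      using D E by (intro exI[of _ "\<lambda>v. D v + E v"])
        (auto intro: has_derivative_add simp: scaleC_add_right)
  qed simp
  moreover obtain d e where "(f has_derivative diag_map d) (at 0)"
      "(g has_derivative diag_map e) (at 0)"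
    using assms by (auto simp: bounded_hol_maps_def)
  then have "((\<lambda>x. f x + g x) has_derivative (\<lambda>v. diag_map d v + diag_map e v)) (at 0)"
    by (rule has_derivative_add)
  moreover have "(\<lambda>v. diag_map d v + diag_map e v) = diag_map (d + e)"
    by (auto simp: diag_map_def vec_eq_iff fun_eq_iff algebra_simps)
  ultimately show ?thesis
    using assms by (auto simp: bounded_hol_maps_def intro!: bounded_plus_comp)
qed

lemma bounded_hol_maps_scaleC:
  assumes "f \<in> bounded_hol_maps"
  shows "(\<lambda>x. c *\<^sub>C f x) \<in> bounded_hol_maps"
proof -
  have "holomorphic_map_on (\<lambda>x. c *\<^sub>C f x) (ball 0 1)"
    unfolding holomorphic_map_on_def
  proof (intro conjI ballI)
    fix x :: "complex ^ 'a" assume x: "x \<in> ball 0 1"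
    obtain D where D: "(f has_derivative D) (at x)" "\<forall>c v. D (c *\<^sub>C v) = c *\<^sub>C D v"
      using bounded_hol_maps_has_derivative[OF assms x] by blast
    show "\<exists>D. ((\<lambda>x. c *\<^sub>C f x) has_derivative D) (at x) \<and> (\<forall>c v. D (c *\<^sub>C v) = c *\<^sub>C D v)"
      using D by (intro exI[of _ "\<lambda>v. c *\<^sub>C D v"])
        (auto intro: bounded_linear.has_derivative[OF bounded_linear_scaleC]
          simp: scaleC_scaleC mult.commute)
  qed simp
  moreover obtain d where "(f has_derivative diag_map d) (at 0)"
    using assms by (auto simp: bounded_hol_maps_def)
  then have "((\<lambda>x. c *\<^sub>C f x) has_derivative (\<lambda>v. c *\<^sub>C diag_map d v)) (at 0)"
    by (rule bounded_linear.has_derivative[OF bounded_linear_scaleC])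
  moreover have "(\<lambda>v. c *\<^sub>C diag_map d v) = diag_map (c *\<^sub>C d)"
    by (auto simp: diag_map_def vec_eq_iff fun_eq_iff scaleC_vec_def scaleC_complex_def)
  moreover have "bounded ((\<lambda>y. c *\<^sub>C y) ` (f ` ball 0 1))"
    by (rule bounded_linear_image[OF _ bounded_linear_scaleC])
      (use assms in \<open>simp add: bounded_hol_maps_def\<close>)
  moreover have "c *\<^sub>C (0 :: complex ^ 'a) = 0"
    by (simp add: scaleC_vec_def scaleC_complex_def vec_eq_iff)
  ultimately show ?thesis
    using assms by (auto simp: bounded_hol_maps_def image_comp o_def)
qed

lemma bounded_hol_maps_scaleR:
  "f \<in> bounded_hol_maps \<Longrightarrow> (\<lambda>x. r *\<^sub>R f x) \<in> bounded_hol_maps"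
  using bounded_hol_maps_scaleC[of f "complex_of_real r"] by (simp add: scaleC_of_real)

lemma bounded_hol_maps_uminus:
  "f \<in> bounded_hol_maps \<Longrightarrow> (\<lambda>x. - f x) \<in> bounded_hol_maps"
  using bounded_hol_maps_scaleR[of f "-1"] by simp

lemma bounded_hol_maps_diff:
  "f \<in> bounded_hol_maps \<Longrightarrow> g \<in> bounded_hol_maps \<Longrightarrow> (\<lambda>x. f x - g x) \<in> bounded_hol_maps"
  using bounded_hol_maps_add[of f "\<lambda>x. - g x"] bounded_hol_maps_uminus[of g] by simp

typedef (overloaded) 'n bhol = "bounded_hol_maps :: (complex ^ 'n::finite \<Rightarrow> complex ^ 'n) set"
  morphisms apply_bhol Bhol
  using bounded_hol_maps_zero by blast

setup_lifting type_definition_bhol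

lemma apply_bhol_outside: "x \<notin> ball 0 1 \<Longrightarrow> apply_bhol f x = 0"
  using apply_bhol[of f] by (simp add: bounded_hol_maps_def)

lemma bhol_eqI:
  assumes "\<And>x. x \<in> ball 0 1 \<Longrightarrow> apply_bhol f x = apply_bhol g x"
  shows "f = g"
proof -
  have "apply_bhol f x = apply_bhol g x" for x
    by (metis assms apply_bhol_outside)
  then have "apply_bhol f = apply_bhol g" by (rule ext)
  then show ?thesis by (simp only: apply_bhol_inject)
qed

instantiation bhol :: (finite) real_vector
begin

lift_definition zero_bhol :: "'a bhol" is "\<lambda>_. 0"
  by (rule bounded_hol_maps_zero)

lift_definition plus_bhol :: "'a bhol \<Rightarrow> 'a bhol \<Rightarrow> 'a bhol" is "\<lambda>f g x. f x + g x"
  by (rule bounded_hol_maps_add)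

lift_definition uminus_bhol :: "'a bhol \<Rightarrow> 'a bhol" is "\<lambda>f x. - f x"
  by (rule bounded_hol_maps_uminus)

lift_definition minus_bhol :: "'a bhol \<Rightarrow> 'a bhol \<Rightarrow> 'a bhol" is "\<lambda>f g x. f x - g x"
  by (rule bounded_hol_maps_diff)

lift_definition scaleR_bhol :: "real \<Rightarrow> 'a bhol \<Rightarrow> 'a bhol" is "\<lambda>r f x. r *\<^sub>R f x"
  by (rule bounded_hol_maps_scaleR)

instance
  by standard (transfer; simp add: fun_eq_iff algebra_simps)+

end

instantiation bhol :: (finite) real_normed_vector
begin

definition norm_bhol :: "'a bhol \<Rightarrow> real"
  where "norm_bhol f = (SUP x\<in>ball 0 1. norm (apply_bhol f x))"

definition sgn_bhol :: "'a bhol \<Rightarrow> 'a bhol"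
  where "sgn_bhol f = f /\<^sub>R norm f"

definition dist_bhol :: "'a bhol \<Rightarrow> 'a bhol \<Rightarrow> real"
  where "dist_bhol f g = norm (f - g)"

definition uniformity_bhol :: "('a bhol \<times> 'a bhol) filter"
  where "uniformity_bhol = (INF e\<in>{0 <..}. principal {(x, y). dist x y < e})"

definition open_bhol :: "'a bhol set \<Rightarrow> bool"
  where "open_bhol S = (\<forall>x\<in>S. \<forall>\<^sub>F (x', y) in uniformity. x' = x \<longrightarrow> y \<in> S)"

lemma norm_apply_bhol_le:
  fixes f :: "'a bhol"
  assumes "x \<in> ball 0 1"
  shows "norm (apply_bhol f x) \<le> norm f"
proof -
  have "bounded (apply_bhol f ` ball 0 1)"
    using apply_bhol[of f] by (simp add: bounded_hol_maps_def)
  then have "bdd_above ((\<lambda>x. norm (apply_bhol f x)) ` ball 0 1)"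
    by (intro bounded_imp_bdd_above) (simp add: bounded_norm_comp)
  then show ?thesis
    unfolding norm_bhol_def using assms by (rule cSUP_upper2) simp
qed

lemma norm_bhol_le:
  fixes f :: "'a bhol"
  assumes "\<And>x. x \<in> ball 0 1 \<Longrightarrow> norm (apply_bhol f x) \<le> b"
  shows "norm f \<le> b"
  unfolding norm_bhol_def using assms by (intro cSUP_least) auto

instance
proof
  fix r :: real and f g :: "'a bhol"
  have le: "norm (r *\<^sub>R f) \<le> \<bar>r\<bar> * norm f" for r and f :: "'a bhol"
    by (rule norm_bhol_le) (simp add: scaleR_bhol.rep_eq mult_left_mono norm_apply_bhol_le)
  show "norm (r *\<^sub>R f) = \<bar>r\<bar> * norm f"
  proof (cases "r = 0")
    case True
    have "norm (apply_bhol (0 :: 'a bhol) 0) \<le> norm (0 :: 'a bhol)"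
      by (rule norm_apply_bhol_le) simp
    moreover have "norm (0 :: 'a bhol) \<le> 0"
      by (rule norm_bhol_le) (simp add: zero_bhol.rep_eq)
    ultimately show ?thesis using True by (simp add: zero_bhol.rep_eq)
  next
    case False
    have "norm f \<le> \<bar>inverse r\<bar> * norm (r *\<^sub>R f)"
      using le[of "inverse r" "r *\<^sub>R f"] False by simp
    then have "\<bar>r\<bar> * norm f \<le> norm (r *\<^sub>R f)"
      using False by (simp add: field_simps)
    with le[of r f] show ?thesis by simp
  qed
  show "norm f = 0 \<longleftrightarrow> f = 0"
  proof
    assume "norm f = 0"
    then show "f = 0"
      using norm_apply_bhol_le[of _ f] by (intro bhol_eqI) (simp add: zero_bhol.rep_eq)
  next
    assume "f = 0"
    then show "norm f = 0"
      by (simp add: norm_bhol_def zero_bhol.rep_eq)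
  qed
  show "norm (f + g) \<le> norm f + norm g"
    by (rule norm_bhol_le)
      (simp add: plus_bhol.rep_eq norm_triangle_mono norm_apply_bhol_le)
qed (auto simp: sgn_bhol_def dist_bhol_def uniformity_bhol_def open_bhol_def)

end

instantiation bhol :: (finite) complex_normed_vector
begin

lift_definition scaleC_bhol :: "complex \<Rightarrow> 'a bhol \<Rightarrow> 'a bhol" is "\<lambda>c f x. c *\<^sub>C f x"
  by (rule bounded_hol_maps_scaleC)

instance
proof
  fix c d :: complex and r :: real and f g :: "'a bhol"
  show "c *\<^sub>C (f + g) = c *\<^sub>C f + c *\<^sub>C g"
    by (rule bhol_eqI) (simp add: scaleC_bhol.rep_eq plus_bhol.rep_eq scaleC_add_right)
  show "(c + d) *\<^sub>C f = c *\<^sub>C f + d *\<^sub>C f"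
    by (rule bhol_eqI) (simp add: scaleC_bhol.rep_eq plus_bhol.rep_eq scaleC_add_left)
  show scs: "c *\<^sub>C d *\<^sub>C f = (c * d) *\<^sub>C f" for c d and f :: "'a bhol"
    by (rule bhol_eqI) (simp add: scaleC_bhol.rep_eq scaleC_scaleC)
  show scr: "complex_of_real r *\<^sub>C f = r *\<^sub>R f" for r and f :: "'a bhol"
    by (rule bhol_eqI) (simp add: scaleC_bhol.rep_eq scaleR_bhol.rep_eq scaleC_of_real)
  have le: "norm (c *\<^sub>C f) \<le> cmod c * norm f" for c and f :: "'a bhol"
    by (rule norm_bhol_le)
      (simp add: scaleC_bhol.rep_eq norm_scaleC mult_left_mono norm_apply_bhol_le)
  show "norm (c *\<^sub>C f) = cmod c * norm f"
  proof (cases "c = 0")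
    case True
    then show ?thesis using scr[of 0 f] by simp
  next
    case False
    have "norm f \<le> cmod (inverse c) * norm (c *\<^sub>C f)"
      using le[of "inverse c" "c *\<^sub>C f"] scr[of 1 f] False by (simp add: scs)
    then have "cmod c * norm f \<le> cmod c * (cmod (inverse c) * norm (c *\<^sub>C f))"
      by (rule mult_left_mono) simp
    also have "\<dots> = norm (c *\<^sub>C f)"
      using False by (simp add: norm_inverse)
    finally have "cmod c * norm f \<le> norm (c *\<^sub>C f)" .
    with le[of c f] show ?thesis by simp
  qed
qed

end


section \<open>Families of holomorphic maps\<close>

text \<open>For compact \<open>'a\<close>, every continuous map from \<open>'a\<close> is bounded, so \<open>'a \<Rightarrow>\<^sub>C 'n bhol\<close>
  is the space of all continuous maps from \<open>'a\<close> to \<open>'n bhol\<close> with the sup norm.\<close>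

abbreviation member ::
    "('a::metric_space \<Rightarrow>\<^sub>C 'n::finite bhol) \<Rightarrow> 'a \<Rightarrow> complex ^ 'n \<Rightarrow> complex ^ 'n" where
  "member f a \<equiv> apply_bhol (apply_bcontfun f a)"

definition contracting :: "(complex ^ 'n::finite \<Rightarrow> complex ^ 'n) \<Rightarrow> bool" where
  "contracting f \<longleftrightarrow> (\<forall>x\<in>ball 0 1. onorm (frechet_derivative f (at x)) < 1)"

definition multipliers :: "(complex ^ 'n::finite \<Rightarrow> complex ^ 'n) \<Rightarrow> complex ^ 'n" where
  "multipliers f = (\<chi> i. frechet_derivative f (at 0) (axis i 1) $ i)"

definition H1 :: "('a::metric_space \<Rightarrow>\<^sub>C 'n::finite bhol) \<Rightarrow> bool" where
  "H1 f \<longleftrightarrow>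
     (\<forall>a. contracting (member f a) \<and>
          biholomorphic_into (member f a) (ball 0 1) (ball 0 1) \<and>
          member f a 0 = 0)"

definition H2 :: "('a::metric_space \<Rightarrow>\<^sub>C 'n::finite bhol) \<Rightarrow> bool" where
  "H2 f \<longleftrightarrow>
     (\<forall>a. frechet_derivative (member f a) (at 0) = diag_map (multipliers (member f a)))"

definition H3 :: "('a::metric_space \<Rightarrow>\<^sub>C 'n::finite bhol) \<Rightarrow> bool" where
  "H3 f \<longleftrightarrow>
     (\<forall>(i :: 'n) (k :: 'n \<Rightarrow> nat). (\<Sum>j\<in>UNIV. k j) \<noteq> 1 \<longrightarrow>
        (let l = (\<lambda>a. multipliers (member f a));
             \<delta> = (\<lambda>a. cmod (l a $ i) - cmod (\<Prod>j\<in>UNIV. l a $ j ^ k j))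
         in (\<forall>a. \<delta> a \<noteq> 0) \<and> (\<forall>a b. sgn (\<delta> a) = sgn (\<delta> b))))"

definition linearizing_family ::
    "('a::metric_space \<Rightarrow> 'a) \<Rightarrow> ('a \<Rightarrow>\<^sub>C 'n::finite bhol) \<Rightarrow> ('a \<Rightarrow>\<^sub>C 'n bhol) \<Rightarrow> bool" where
  "linearizing_family \<sigma> f h \<longleftrightarrow>
     (\<forall>a. biholomorphic_into (member h a) (ball 0 1) UNIV \<and>
          frechet_derivative (member h a) (at 0) = id \<and>
          member h a 0 = 0 \<and>
          (\<forall>x\<in>ball 0 1. member h (\<sigma> a) (member f a x)
                        = frechet_derivative (member f a) (at 0) (member h a x)))"

end

theory Submission
  imports Defs "HOL-Complex_Analysis.Complex_Analysis"
begin

text \<open>Write \<open>\<Lambda>\<^sub>a = D\<^sub>0f\<^sub>a\<close>. The conjugacy equation is linear in \<open>h\<close>: it says that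
  \<open>(M\<^sub>f h)\<^sub>a = \<Lambda>\<^sub>a h\<^sub>a - h\<^bsub>\<sigma>(a)\<^esub> \<circ> f\<^sub>a\<close> vanishes, so with \<open>h = id + u\<close> one has to solve
  \<open>M\<^sub>f u = -M\<^sub>f id\<close> in the space \<open>E\<^sub>2\<close> of families vanishing to order 2 at the origin.
  Since \<open>f\<^sub>a\<close> maps the ball into a ball of radius \<open>\<rho> < 1\<close> uniformly in \<open>a\<close>, the Schwarz lemma makes
  \<open>u \<mapsto> u\<^bsub>\<sigma>(a)\<^esub> \<circ> f\<^sub>a\<close> small on the space \<open>E\<^sub>N\<close> of families vanishing to a large order \<open>N\<close>, where \<open>M\<^sub>f\<close> is
  therefore invertible. Passing from \<open>E\<^bsub>d+1\<^esub>\<close> to \<open>E\<^sub>d\<close> amounts to inverting \<open>M\<^sub>f\<close> on leading homogeneous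
  parts; on each monomial this is a scalar cocycle equation over \<open>\<sigma>\<close>, which the nonresonance condition makes
  uniformly contracting over \<open>\<sigma>\<close> or over its inverse. Invertibility on \<open>E\<^sub>2\<close> is stable under
  perturbations of \<open>f\<close>, and \<open>f \<mapsto> M\<^sub>f u\<close> is holomorphic with quadratic Taylor remainders by Cauchy's
  estimates, which gives the holomorphic dependence.\<close>

section \<open>Schwarz lemmas on discs\<close>

text \<open>Solving the equation coefficient by coefficient would demand convergence estimates in
  all degrees at once. Here only finitely many degrees are treated that way: the multipliers are
  nonzero because \<open>f_a\<close> is biholomorphic, compactness bounds them below by some c > 0,
  and once \<rho>^N \<le> c/2 the composition term is dominated by \<Lambda> on E_N. The bound on
  the inverse may therefore deteriorate in each degree without harm. The descent stops at E_2 for a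
  reason: in degree one the equation becomes \<lambda>_i(a) (s(a) - s(\<sigma> a)) = v(a), whose
  left side is zero for constant s. The condition D_0 h = id fixes exactly this part, and M_f id
  lies in E_2 because \<Lambda>_a is the differential of \<open>f_a\<close>. Biholomorphy of h is
  not a linear condition and stays outside the operator equation; it is recovered afterwards from
  the dynamics, since iterates of f carry every point close to 0, where h is close to the
  identity.\<close>

lemma cauchy_deriv_bound:
  fixes \<phi> :: "complex \<Rightarrow> complex"
  assumes "\<phi> holomorphic_on ball 0 R" "0 < R" and M: "\<And>t. t \<in> ball 0 R \<Longrightarrow> cmod (\<phi> t) \<le> M"
  shows "cmod (deriv \<phi> 0) \<le> M / R"
proof -
  \<comment> \<open>Cauchy's inequality needs continuity on a closed disc, whereas \<phi> is
    controlled on an open one. The bound is obtained for every s < R and passes to the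
    limit.\<close>
  have "cmod (deriv \<phi> 0) * s \<le> M" if s: "0 < s" "s < R" for s
  proof -
    have sub: "cball 0 s \<subseteq> ball (0::complex) R"
      using s by auto
    have "cmod ((deriv ^^ 1) \<phi> 0) \<le> fact 1 * M / s ^ 1"
    proof (rule Cauchy_inequality[OF _ _ s(1)])
      show "continuous_on (cball 0 s) \<phi>"
        using assms(1) sub by (meson continuous_on_subset holomorphic_on_imp_continuous_on)
      show "\<phi> holomorphic_on ball 0 s"
        using assms(1) sub ball_subset_cball holomorphic_on_subset by blast
      show "norm (\<phi> x) \<le> M" if "norm (0 - x) = s" for x
        using that s by (intro M) auto
    qed
    then show ?thesis using s by (simp add: field_simps)
  qed
  then have "cmod (deriv \<phi> 0) * R \<le> M"
  proof -
    have "((\<lambda>s. cmod (deriv \<phi> 0) * s) \<longlongrightarrow> cmod (deriv \<phi> 0) * R) (at_left R)"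
      by (intro tendsto_intros)
    moreover have "\<forall>\<^sub>F s in at_left R. cmod (deriv \<phi> 0) * s \<le> M"
      using eventually_at_left_real[OF assms(2)] by eventually_elim
        (use \<open>\<And>s. 0 < s \<Longrightarrow> s < R \<Longrightarrow> _\<close> in auto)
    ultimately show ?thesis
      by (rule tendsto_upperbound) simp
  qed
  then show ?thesis using assms(2) by (simp add: field_simps)
qed

text \<open>Rescaling reduces this to the Schwarz lemma on the unit disc, which asks for values of
  modulus strictly below 1. Dividing by M + e secures strictness, also when M = 0; then e is
  arbitrary.\<close>

lemma schwarz_bound:
  fixes \<phi> :: "complex \<Rightarrow> complex"
  assumes hol: "\<phi> holomorphic_on ball 0 R" and R: "0 < R"
    and M: "\<And>t. t \<in> ball 0 R \<Longrightarrow> cmod (\<phi> t) \<le> M"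
    and 0: "\<phi> 0 = 0" and t: "t \<in> ball 0 R"
  shows "cmod (\<phi> t) \<le> M * (cmod t / R)"
proof (rule field_le_epsilon)
  fix e :: real assume e: "0 < e"
  have M0: "0 \<le> M" using M[of 0] R 0 by simp
  define \<psi> where "\<psi> z = \<phi> (of_real R * z) / of_real (M + e)" for z
  have sub: "of_real R * z \<in> ball 0 R" if "z \<in> ball 0 1" for z :: complex
    using that R by (simp add: norm_mult)
  have "\<psi> holomorphic_on ball 0 1"
    unfolding \<psi>_def
    by (intro holomorphic_intros holomorphic_on_compose_gen[OF _ hol, unfolded o_def])
      (use sub M0 e in \<open>auto simp flip: of_real_add\<close>)
  moreover have "\<psi> 0 = 0" by (simp add: \<psi>_def 0)
  moreover have "cmod (\<psi> z) < 1" if "cmod z < 1" for z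
    using M[OF sub[of z]] that M0 e by (simp add: \<psi>_def norm_divide flip: of_real_add)
  moreover have t1: "cmod (t / of_real R) < 1" using t R by (simp add: norm_divide)
  ultimately have "cmod (\<psi> (t / of_real R)) \<le> cmod (t / of_real R)"
    by (rule Schwarz_Lemma(1))
  then have "cmod (\<phi> t) \<le> (M + e) * (cmod t / R)"
    using M0 e R by (simp add: \<psi>_def norm_divide field_simps flip: of_real_add)
  also have "\<dots> \<le> M * (cmod t / R) + e"
    using e R t by (simp add: field_simps)
  finally show "cmod (\<phi> t) \<le> M * (cmod t / R) + e" .
qed

text \<open>The quotient by t has a removable singularity, and the Schwarz bound controls it by M /
  R on the same disc. Since no radius is lost, zeros can be divided out one after another.\<close>

lemma divide_out_zero:
  fixes \<phi> :: "complex \<Rightarrow> complex"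
  assumes hol: "\<phi> holomorphic_on ball 0 R" and R: "0 < R"
    and M: "\<And>t. t \<in> ball 0 R \<Longrightarrow> cmod (\<phi> t) \<le> M"
    and 0: "\<phi> 0 = 0"
  obtains \<psi> where "\<psi> holomorphic_on ball 0 R" "\<And>t. t \<in> ball 0 R \<Longrightarrow> cmod (\<psi> t) \<le> M / R"
    "\<And>t. \<phi> t = t * \<psi> t" "\<psi> 0 = deriv \<phi> 0"
proof
  let ?\<psi> = "\<lambda>z. if z = 0 then deriv \<phi> 0 else (\<phi> z - \<phi> 0) / (z - 0)"
  show "?\<psi> holomorphic_on ball 0 R"
    by (rule pole_lemma[OF hol]) (use R in simp)
  show "\<phi> t = t * ?\<psi> t" for t by (simp add: 0)
  show "cmod (?\<psi> t) \<le> M / R" if "t \<in> ball 0 R" for t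
    using cauchy_deriv_bound[OF hol R M] schwarz_bound[OF hol R M 0 that] R
    by (auto simp: 0 norm_divide field_simps)
qed simp

lemma schwarz_order2:
  fixes \<phi> :: "complex \<Rightarrow> complex"
  assumes hol: "\<phi> holomorphic_on ball 0 R" and R: "0 < R"
    and M: "\<And>t. t \<in> ball 0 R \<Longrightarrow> cmod (\<phi> t) \<le> M"
    and 0: "\<phi> 0 = 0" "deriv \<phi> 0 = 0" and t: "t \<in> ball 0 R"
  shows "cmod (\<phi> t) \<le> M * (cmod t / R)\<^sup>2"
proof -
  obtain \<psi> where \<psi>: "\<psi> holomorphic_on ball 0 R" "\<And>t. t \<in> ball 0 R \<Longrightarrow> cmod (\<psi> t) \<le> M / R"
    "\<And>t. \<phi> t = t * \<psi> t" "\<psi> 0 = deriv \<phi> 0"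
    using divide_out_zero[OF hol R M 0(1)] by blast
  have "cmod (\<psi> t) \<le> M / R * (cmod t / R)"
    by (rule schwarz_bound[OF \<psi>(1) R \<psi>(2) _ t]) (simp_all add: \<psi>(4) 0)
  then have "cmod t * cmod (\<psi> t) \<le> cmod t * (M / R * (cmod t / R))"
    by (intro mult_left_mono) auto
  then show ?thesis by (simp add: \<psi>(3)[of t] norm_mult power2_eq_square mult_ac)
qed

text \<open>Each induction step divides out one zero. The growth hypothesis leaves out t = 0 because
  dividing it by t says nothing there; the zero at the origin is recovered by continuity. C and e do
  not enter the conclusion.\<close>

lemma schwarz_order:
  fixes \<phi> :: "complex \<Rightarrow> complex"
  assumes "\<phi> holomorphic_on ball 0 R" and R: "0 < R"
    and "\<And>t. t \<in> ball 0 R \<Longrightarrow> cmod (\<phi> t) \<le> M"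
    and "0 < e" "\<And>t. t \<noteq> 0 \<Longrightarrow> cmod t < e \<Longrightarrow> cmod (\<phi> t) \<le> C * cmod t ^ d"
    and t: "t \<in> ball 0 R"
  shows "cmod (\<phi> t) \<le> M * (cmod t / R) ^ d"
  using assms(1,3,5)
proof (induction d arbitrary: \<phi> M)
  case 0
  then show ?case using t by simp
next
  case (Suc d)
  have "(\<phi> \<longlongrightarrow> 0) (at 0)"
  proof (rule Lim_null_comparison)
    show "\<forall>\<^sub>F t in at 0. norm (\<phi> t) \<le> C * cmod t ^ Suc d"
      using eventually_at_ball'[OF \<open>0 < e\<close>, of 0 UNIV] by eventually_elim
        (use Suc.prems(3) in auto)
    show "((\<lambda>t. C * cmod t ^ Suc d) \<longlongrightarrow> 0) (at 0)"
      by (auto intro!: tendsto_eq_intros)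
  qed
  moreover have "(\<phi> \<longlongrightarrow> \<phi> 0) (at 0)"
    using Suc.prems(1) R by (meson centre_in_ball continuous_on_eq_continuous_at
        holomorphic_on_imp_continuous_on isContD open_ball)
  ultimately have 0: "\<phi> 0 = 0"
    using tendsto_unique trivial_limit_at by blast
  obtain \<psi> where \<psi>: "\<psi> holomorphic_on ball 0 R" "\<And>t. t \<in> ball 0 R \<Longrightarrow> cmod (\<psi> t) \<le> M / R"
    "\<And>t. \<phi> t = t * \<psi> t" "\<psi> 0 = deriv \<phi> 0"
    using divide_out_zero[OF Suc.prems(1) R Suc.prems(2) 0] by blast
  have "cmod (\<psi> t) \<le> M / R * (cmod t / R) ^ d"
  proof (rule Suc.IH[OF \<psi>(1,2)])
    fix s :: complex assume s: "s \<noteq> 0" "cmod s < e"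
    have "cmod s * cmod (\<psi> s) \<le> cmod s * (C * cmod s ^ d)"
      using Suc.prems(3)[OF s] by (simp add: \<psi>(3)[of s] norm_mult mult_ac)
    then show "cmod (\<psi> s) \<le> C * cmod s ^ d" using s by simp
  qed
  then have "cmod t * cmod (\<psi> t) \<le> cmod t * (M / R * (cmod t / R) ^ d)"
    by (intro mult_left_mono) auto
  then show ?case by (simp add: \<psi>(3)[of t] norm_mult mult_ac)
qed

section \<open>Slices of holomorphic maps\<close>

lemma vec_scaleC_nth [simp]: "(c *\<^sub>C x) $ i = c * x $ i" for x :: "complex ^ 'n"
  by (simp add: scaleC_vec_def scaleC_complex_def)

lemma bounded_linear_scaleC_left:
  "bounded_linear (\<lambda>t. t *\<^sub>C (v :: 'a :: complex_normed_vector))"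
proof (rule bounded_linear_intro)
  fix x y :: complex and r :: real
  show "(x + y) *\<^sub>C v = x *\<^sub>C v + y *\<^sub>C v" by (rule scaleC_add_left)
  show "(r *\<^sub>R x) *\<^sub>C v = r *\<^sub>R (x *\<^sub>C v)"
    by (metis scaleC_of_real scaleC_scaleC scaleR_conv_of_real)
  show "norm (x *\<^sub>C v) \<le> norm x * norm v" by (simp add: norm_scaleC)
qed

lemma scaleC_diff_right: "c *\<^sub>C (x - y) = c *\<^sub>C x - c *\<^sub>C (y :: 'a :: complex_normed_vector)"
  and scaleC_minus_right: "c *\<^sub>C (- x) = - (c *\<^sub>C (x :: 'a :: complex_normed_vector))"
  and scaleC_scaleR: "c *\<^sub>C (r *\<^sub>R x) = r *\<^sub>R (c *\<^sub>C (x :: 'a :: complex_normed_vector))"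
  and scaleC_sum_right: "c *\<^sub>C (\<Sum>i\<in>I. g i) = (\<Sum>i\<in>I. c *\<^sub>C (g i :: 'a :: complex_normed_vector))"
  using bounded_linear.linear[OF bounded_linear_scaleC[of c]]
  by (rule linear_diff, rule linear_neg, rule linear_cmul, rule linear_sum)

lemma scaleC_zero_left [simp]: "0 *\<^sub>C v = (0 :: 'a :: complex_normed_vector)"
  using norm_scaleC[of 0 v] by simp

lemma scaleC_zero_right [simp]: "c *\<^sub>C 0 = (0 :: 'a :: complex_normed_vector)"
  using norm_scaleC[of c "0 :: 'a"] by simp

lemma scaleC_one [simp]: "1 *\<^sub>C v = (v :: 'a :: complex_normed_vector)"
  using scaleC_of_real[of 1 v] by simp

text \<open>The Hermitian inner product, conjugate-linear in the first argument. Each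
  \<open>cip w\<close> is a complex-linear functional, unlike the real inner product of the vector
  type, so it turns vector-valued maps into holomorphic functions.\<close>

definition cip :: "complex ^ 'n \<Rightarrow> complex ^ 'n \<Rightarrow> complex" where
  "cip w y = (\<Sum>i\<in>UNIV. cnj (w $ i) * y $ i)"

lemma cip_scaleC: "cip w (c *\<^sub>C y) = c * cip w y"
  by (simp add: cip_def sum_distrib_left mult_ac)

lemma norm_cip_le: "cmod (cip w y) \<le> norm w * norm y"
proof -
  have "cmod (cip w y) \<le> (\<Sum>i\<in>UNIV. cmod (w $ i) * cmod (y $ i))"
    unfolding cip_def by (rule order_trans[OF norm_sum]) (simp add: norm_mult)
  also have "\<dots> \<le> norm w * norm y"
    unfolding norm_vec_def using L2_set_mult_ineq[of "\<lambda>i. cmod (w $ i)" "\<lambda>i. cmod (y $ i)" UNIV]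
    by simp
  finally show ?thesis .
qed

lemma bounded_linear_cip: "bounded_linear (cip w)"
proof (rule bounded_linear_intro)
  fix x y :: "complex ^ 'a" and r :: real
  show "cip w (x + y) = cip w x + cip w y"
    by (simp add: cip_def sum.distrib algebra_simps)
  show "cip w (r *\<^sub>R x) = r *\<^sub>R cip w x"
    by (simp add: cip_def scaleR_right.sum)
  show "norm (cip w x) \<le> norm x * norm w"
    using norm_cip_le[of w x] by (simp add: mult.commute)
qed

lemma cip_le:
  assumes "norm w \<le> 1" "norm y \<le> b"
  shows "cmod (cip w y) \<le> b"
  using norm_cip_le[of w y] mult_right_mono[OF assms(1), of "norm y"] assms(2) by simp

lemmas cip_diff = linear_diff[OF bounded_linear.linear[OF bounded_linear_cip]]

lemma cip_self: "cip y y = of_real ((norm y)\<^sup>2)"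
proof -
  have "(norm y)\<^sup>2 = (\<Sum>i\<in>UNIV. (cmod (y $ i))\<^sup>2)"
    unfolding norm_vec_def L2_set_def by (simp add: sum_nonneg)
  moreover have "cnj (y $ i) * y $ i = of_real ((cmod (y $ i))\<^sup>2)" for i
    by (metis complex_norm_square mult.commute)
  ultimately show ?thesis by (simp add: cip_def)
qed

text \<open>Duality: the unit vector in direction y attains the norm. Estimates for vector-valued
  maps thus follow from estimates for scalar functions that are uniform in w.\<close>

lemma norm_le_cip:
  assumes "\<And>w. norm w \<le> 1 \<Longrightarrow> cmod (cip w y) \<le> b"
  shows "norm y \<le> b"
proof (cases "y = 0")
  case True
  then show ?thesis using assms[of 0] by (simp add: cip_def)
next
  case False
  have "cip (y /\<^sub>R norm y) y = cip y y / norm y"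
    by (simp add: cip_def sum_divide_distrib divide_inverse scaleR_conv_of_real[where 'a=complex]
        sum_distrib_left mult_ac)
  also have "\<dots> = of_real (norm y)"
    using False by (simp add: cip_self power2_eq_square)
  finally show ?thesis
    using assms[of "y /\<^sub>R norm y"] False by simp
qed

abbreviation fd :: "('a::real_normed_vector \<Rightarrow> 'b::real_normed_vector) \<Rightarrow> 'a \<Rightarrow> 'a \<Rightarrow> 'b" where
  "fd u x \<equiv> frechet_derivative u (at x)"

lemma hol_fd:
  assumes "holomorphic_map_on u S" "x \<in> S"
  shows "(u has_derivative fd u x) (at x)"
    and "fd u x (c *\<^sub>C v) = c *\<^sub>C fd u x v"
proof -
  obtain D where D: "(u has_derivative D) (at x)" "\<forall>c v. D (c *\<^sub>C v) = c *\<^sub>C D v"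
    using assms by (auto simp: holomorphic_map_on_def)
  with frechet_derivative_at[OF D(1)]
  show "(u has_derivative fd u x) (at x)"
    "fd u x (c *\<^sub>C v) = c *\<^sub>C fd u x v"
    by simp_all
qed

lemma holI:
  assumes "open S" "\<And>x. x \<in> S \<Longrightarrow> (u has_derivative D x) (at x)"
    "\<And>x c v. x \<in> S \<Longrightarrow> D x (c *\<^sub>C v) = c *\<^sub>C D x v"
  shows "holomorphic_map_on u S"
  using assms unfolding holomorphic_map_on_def by blast

lemma hol_subset:
  "holomorphic_map_on u S \<Longrightarrow> T \<subseteq> S \<Longrightarrow> open T \<Longrightarrow> holomorphic_map_on u T"
  by (auto simp: holomorphic_map_on_def)

lemma hol_continuous:
  "holomorphic_map_on u S \<Longrightarrow> continuous_on S u"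
  by (meson continuous_at_imp_continuous_on has_derivative_continuous hol_fd(1))

text \<open>Complex linearity of the differential gives D (s v) = s D v, so the real derivative of
  the slice is multiplication by a complex number.\<close>

lemma slice_has_field_derivative:
  fixes u :: "complex ^ 'm::finite \<Rightarrow> complex ^ 'n::finite"
  assumes "holomorphic_map_on u S" "x + t *\<^sub>C v \<in> S"
  shows "((\<lambda>t. cip w (u (x + t *\<^sub>C v))) has_field_derivative
           cip w (fd u (x + t *\<^sub>C v) v)) (at t)"
proof -
  let ?D = "fd u (x + t *\<^sub>C v)"
  note D = hol_fd[OF assms]
  have "((\<lambda>t. x + t *\<^sub>C v) has_derivative (\<lambda>s. s *\<^sub>C v)) (at t)"
    using has_derivative_add[OF has_derivative_const
        bounded_linear_imp_has_derivative[OF bounded_linear_scaleC_left]] by simp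
  from has_derivative_compose[OF this D(1)]
  have "((\<lambda>t. u (x + t *\<^sub>C v)) has_derivative (\<lambda>s. ?D (s *\<^sub>C v))) (at t)" .
  then have "((\<lambda>t. cip w (u (x + t *\<^sub>C v))) has_derivative (\<lambda>s. cip w (?D (s *\<^sub>C v)))) (at t)"
    by (rule bounded_linear.has_derivative[OF bounded_linear_cip])
  then show ?thesis
    by (simp add: has_field_derivative_def D(2) cip_scaleC mult.commute[of _ "cip w (?D v)"])
qed

lemma slice_holomorphic:
  fixes u :: "complex ^ 'm::finite \<Rightarrow> complex ^ 'n::finite"
  assumes "holomorphic_map_on u (ball x r)" "norm v * R \<le> r" "v \<noteq> 0"
  shows "(\<lambda>t. cip w (u (x + t *\<^sub>C v))) holomorphic_on ball 0 R"
    and "t \<in> ball 0 R \<Longrightarrow> x + t *\<^sub>C v \<in> ball x r"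
proof -
  have *: "x + t *\<^sub>C v \<in> ball x r" if "t \<in> ball 0 R" for t
  proof -
    have "cmod t * norm v < R * norm v"
      using that assms(3) by (intro mult_strict_right_mono) auto
    then show ?thesis using assms(2) by (simp add: dist_norm norm_scaleC mult.commute)
  qed
  then show "t \<in> ball 0 R \<Longrightarrow> x + t *\<^sub>C v \<in> ball x r" .
  show "(\<lambda>t. cip w (u (x + t *\<^sub>C v))) holomorphic_on ball 0 R"
    unfolding holomorphic_on_open[OF open_ball]
    by (intro ballI exI) (rule slice_has_field_derivative[OF assms(1) *])
qed

section \<open>Cauchy, Taylor and Schwarz estimates in several variables\<close>

lemma cauchy_estimate:
  fixes u :: "complex ^ 'm::finite \<Rightarrow> complex ^ 'n::finite"
  assumes hol: "holomorphic_map_on u (ball x r)" and r: "0 < r"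
    and M: "\<And>y. y \<in> ball x r \<Longrightarrow> norm (u y) \<le> M"
  shows "norm (fd u x v) \<le> M / r * norm v"
proof (cases "v = 0")
  case True
  interpret bounded_linear "fd u x"
    using hol_fd(1)[OF hol, of x] r by (auto dest: has_derivative_bounded_linear)
  show ?thesis using True by (simp add: zero)
next
  case False
  show ?thesis
  proof (rule norm_le_cip)
    fix w :: "complex ^ 'n" assume w: "norm w \<le> 1"
    let ?\<phi> = "\<lambda>t. cip w (u (x + t *\<^sub>C v))"
    \<comment> \<open>For t in the disc of radius r / norm v the point x + t v stays in the ball;
      Cauchy's inequality on this disc produces the factor norm v / r.\<close>
    have R: "norm v * (r / norm v) \<le> r" using False by simp
    note sl = slice_holomorphic[OF hol R False]
    have "cmod (deriv ?\<phi> 0) \<le> M / (r / norm v)"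
    proof (rule cauchy_deriv_bound[OF sl(1)])
      fix t :: complex assume "t \<in> ball 0 (r / norm v)"
      then show "cmod (?\<phi> t) \<le> M" by (intro cip_le[OF w] M sl(2))
    qed (use r False in simp)
    moreover have "deriv ?\<phi> 0 = cip w (fd u x v)"
      using slice_has_field_derivative[OF hol, of x 0 v w] r by (intro DERIV_imp_deriv) simp
    ultimately show "cmod (cip w (fd u x v)) \<le> M / r * norm v"
      by (simp add: field_simps)
  qed
qed

text \<open>On the slice through x and x + v the value, the constant term and the linear term are
  each bounded by M, whence the factor 3. The second-order Schwarz bound is evaluated at t =
  1.\<close>

lemma taylor_order2:
  fixes u :: "complex ^ 'm::finite \<Rightarrow> complex ^ 'n::finite"
  assumes hol: "holomorphic_map_on u (ball x r)"
    and M: "\<And>y. y \<in> ball x r \<Longrightarrow> norm (u y) \<le> M" and v: "norm v < r"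
  shows "norm (u (x + v) - u x - fd u x v) \<le> 3 * M * (norm v / r)\<^sup>2"
proof (cases "v = 0")
  case True
  interpret bounded_linear "fd u x"
    using hol_fd(1)[OF hol, of x] v norm_ge_zero[of v]
    by (auto dest: has_derivative_bounded_linear simp del: norm_ge_zero)
  show ?thesis using True by (simp add: zero)
next
  case False
  have r: "0 < r" using v norm_ge_zero[of v] by linarith
  have x: "x \<in> ball x r" using r by simp
  let ?D = "fd u x"
  show ?thesis
  proof (rule norm_le_cip)
    fix w :: "complex ^ 'n" assume w: "norm w \<le> 1"
    note wle = cip_le[OF w]
    define R where "R = r / norm v"
    have R0: "0 < R" using r False by (simp add: R_def)
    have R: "norm v * R \<le> r" using False by (simp add: R_def)
    note sl = slice_holomorphic[OF hol R False]
    define \<phi> where "\<phi> t = cip w (u (x + t *\<^sub>C v)) - cip w (u x) - t * cip w (?D v)" for t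
    have "cmod (\<phi> 1) \<le> (3 * M) * (cmod 1 / R)\<^sup>2"
    proof (rule schwarz_order2[OF _ R0])
      show "\<phi> holomorphic_on ball 0 R"
        unfolding \<phi>_def by (intro holomorphic_intros sl)
      show "\<phi> 0 = 0" by (simp add: \<phi>_def)
      have "(\<phi> has_field_derivative (cip w (?D v) - 0 - (1 * cip w (?D v)))) (at 0)"
        unfolding \<phi>_def
        by (intro DERIV_diff DERIV_const DERIV_cmult_right DERIV_ident)
          (use slice_has_field_derivative[OF hol, of x 0 v w] r in simp)
      then show "deriv \<phi> 0 = 0" by (simp add: DERIV_imp_deriv)
      show "1 \<in> ball (0::complex) R" using v False by (simp add: R_def)
      fix t :: complex assume t: "t \<in> ball 0 R"
      have 1: "cmod (cip w (u (x + t *\<^sub>C v))) \<le> M"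
        by (intro wle M sl(2)[OF t])
      have 2: "cmod (cip w (u x)) \<le> M" by (intro wle M x)
      have "cmod (t * cip w (?D v)) \<le> R * (M / r * norm v)"
        unfolding norm_mult using t R0 by (intro mult_mono wle cauchy_estimate[OF hol r M]) auto
      also have "\<dots> = M" using r False by (simp add: R_def)
      finally show "cmod (\<phi> t) \<le> 3 * M"
        using 1 2 unfolding \<phi>_def
        by (smt (verit) norm_triangle_ineq4)
    qed
    then show "cmod (cip w (u (x + v) - u x - ?D v)) \<le> 3 * M * (norm v / r)\<^sup>2"
      by (simp add: \<phi>_def R_def cip_diff)
  qed
qed

text \<open>The local data C and e disappear and only the global bound M remains. This gives both
  the closedness of the spaces of maps vanishing to a given order and the small factor
  \<rho>^N.\<close>

lemma schwarz_vec_order: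
  fixes u :: "complex ^ 'm::finite \<Rightarrow> complex ^ 'n::finite"
  assumes hol: "holomorphic_map_on u (ball 0 r)"
    and M: "\<And>y. y \<in> ball 0 r \<Longrightarrow> norm (u y) \<le> M"
    and e: "0 < e" and C: "\<And>y. y \<in> ball 0 e \<Longrightarrow> norm (u y) \<le> C * norm y ^ d"
    and x: "x \<in> ball 0 r"
  shows "norm (u x) \<le> M * (norm x / r) ^ d"
proof (cases "x = 0")
  case True
  then show ?thesis
    using C[of 0] M[OF x] e by (cases d) auto
next
  case False
  have r: "0 < r" using x by (smt (verit) mem_ball_0 norm_ge_zero)
  show ?thesis
  proof (rule norm_le_cip)
    fix w :: "complex ^ 'n" assume w: "norm w \<le> 1"
    note wle = cip_le[OF w]
    define R where "R = r / norm x"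
    have R0: "0 < R" using r False by (simp add: R_def)
    have R: "norm x * R \<le> r" using False by (simp add: R_def)
    note sl = slice_holomorphic[OF hol R False]
    have "cmod (cip w (u (0 + 1 *\<^sub>C x))) \<le> M * (cmod 1 / R) ^ d"
    proof (rule schwarz_order[OF sl(1) R0])
      show "0 < e / norm x" using e False by simp
      show "cmod (cip w (u (0 + t *\<^sub>C x))) \<le> M" if "t \<in> ball 0 R" for t
        by (intro wle M sl(2) that)
      show "1 \<in> ball (0::complex) R" using x False by (simp add: R_def)
      fix t :: complex assume "t \<noteq> 0" and t: "cmod t < e / norm x"
      have "norm (u (t *\<^sub>C x)) \<le> C * norm (t *\<^sub>C x) ^ d"
        using t False by (intro C) (simp add: norm_scaleC field_simps)
      then show "cmod (cip w (u (0 + t *\<^sub>C x))) \<le> (C * norm x ^ d) * cmod t ^ d"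
        by (intro wle) (simp add: norm_scaleC power_mult_distrib mult_ac)
    qed
    then show "cmod (cip w (u x)) \<le> M * (norm x / r) ^ d" by (simp add: R_def)
  qed
qed

text \<open>Around every point of the smaller ball there is room for a ball of radius r - s, so
  Cauchy's estimate bounds the differential by M / (r - s).\<close>

lemma lipschitz_on_smaller_ball:
  fixes u :: "complex ^ 'm::finite \<Rightarrow> complex ^ 'n::finite"
  assumes hol: "holomorphic_map_on u (ball 0 r)"
    and M: "\<And>y. y \<in> ball 0 r \<Longrightarrow> norm (u y) \<le> M" and s: "s < r"
    and xy: "x \<in> ball 0 s" "y \<in> ball 0 s"
  shows "norm (u x - u y) \<le> M / (r - s) * norm (x - y)"
proof (rule differentiable_bound[OF convex_ball _ _ xy])
  fix z :: "complex ^ 'm" assume z: "z \<in> ball 0 s"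
  have sub: "ball z (r - s) \<subseteq> ball 0 r"
  proof
    fix y assume "y \<in> ball z (r - s)"
    then show "y \<in> ball 0 r"
      using norm_triangle_ineq[of z "y - z"] z by (simp add: dist_norm norm_minus_commute)
  qed
  show "(u has_derivative fd u z) (at z within ball 0 s)"
    using hol_fd(1)[OF hol, of z] z s by (auto intro: has_derivative_at_withinI)
  have hol': "holomorphic_map_on u (ball z (r - s))"
    by (rule hol_subset[OF hol sub open_ball])
  show "onorm (fd u z) \<le> M / (r - s)"
  proof (rule onorm_le)
    show "norm (fd u z v) \<le> M / (r - s) * norm v" for v
      using sub s by (intro cauchy_estimate[OF hol'] M) auto
  qed
qed
lemma schwarz_vec1:
  fixes u :: "complex ^ 'm::finite \<Rightarrow> complex ^ 'n::finite"
  assumes hol: "holomorphic_map_on u (ball 0 r)"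
    and M: "\<And>y. y \<in> ball 0 r \<Longrightarrow> norm (u y) \<le> M" and 0: "u 0 = 0" and x: "x \<in> ball 0 r"
  shows "norm (u x) \<le> M * (norm x / r)"
proof -
  have r: "0 < r" using x by (smt (verit) mem_ball_0 norm_ge_zero)
  \<comment> \<open>Any Lipschitz bound near 0 serves as evidence of a first-order zero; its
    constant is discarded by \<open>schwarz_vec_order\<close>.\<close>
  have C: "norm (u y) \<le> M / (r - r / 2) * norm y ^ 1" if "y \<in> ball 0 (r / 2)" for y
    using lipschitz_on_smaller_ball[OF hol M _ that, of 0] r 0 by simp
  have "norm (u x) \<le> M * (norm x / r) ^ 1"
    by (rule schwarz_vec_order[OF hol M half_gt_zero[OF r] C x])
  then show ?thesis by simp
qed

section \<open>Operations on holomorphic maps\<close>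

lemma fd_eqI:
  "(u has_derivative D) (at x) \<Longrightarrow> fd u x = D"
  by (metis frechet_derivative_at)

lemma hol_diff:
  assumes "holomorphic_map_on u S" "holomorphic_map_on v S"
  shows "holomorphic_map_on (\<lambda>x. u x - v x) S"
    and "x \<in> S \<Longrightarrow> fd (\<lambda>x. u x - v x) x h =
      fd u x h - fd v x h"
proof -
  note D = hol_fd[OF assms(1)] hol_fd[OF assms(2)]
  show "holomorphic_map_on (\<lambda>x. u x - v x) S"
    using assms(1) D
    by (intro holI[where D = "\<lambda>x h. fd u x h -
        fd v x h"])
      (auto simp: holomorphic_map_on_def scaleC_diff_right intro!: has_derivative_diff)
  show "x \<in> S \<Longrightarrow> fd (\<lambda>x. u x - v x) x h =
      fd u x h - fd v x h"
    using fd_eqI[OF has_derivative_diff[OF D(1,3)]] by simp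
qed

lemma hol_add:
  assumes "holomorphic_map_on u S" "holomorphic_map_on v S"
  shows "holomorphic_map_on (\<lambda>x. u x + v x) S"
    and "x \<in> S \<Longrightarrow> fd (\<lambda>x. u x + v x) x h =
      fd u x h + fd v x h"
proof -
  note D = hol_fd[OF assms(1)] hol_fd[OF assms(2)]
  show "holomorphic_map_on (\<lambda>x. u x + v x) S"
    using assms(1) D
    by (intro holI[where D = "\<lambda>x h. fd u x h +
        fd v x h"])
      (auto simp: holomorphic_map_on_def scaleC_add_right intro!: has_derivative_add)
  show "x \<in> S \<Longrightarrow> fd (\<lambda>x. u x + v x) x h =
      fd u x h + fd v x h"
    using fd_eqI[OF has_derivative_add[OF D(1,3)]] by simp
qed

lemma hol_scaleC:
  assumes "holomorphic_map_on u S"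
  shows "holomorphic_map_on (\<lambda>x. c *\<^sub>C u x) S"
    and "x \<in> S \<Longrightarrow> fd (\<lambda>x. c *\<^sub>C u x) x h =
      c *\<^sub>C fd u x h"
proof -
  note D = hol_fd[OF assms(1)]
  show "holomorphic_map_on (\<lambda>x. c *\<^sub>C u x) S"
    using assms(1) D
    by (intro holI[where D = "\<lambda>x h. c *\<^sub>C fd u x h"])
      (auto simp: holomorphic_map_on_def scaleC_scaleC mult.commute
        intro!: bounded_linear.has_derivative[OF bounded_linear_scaleC])
  show "x \<in> S \<Longrightarrow> fd (\<lambda>x. c *\<^sub>C u x) x h =
      c *\<^sub>C fd u x h"
    using fd_eqI[OF bounded_linear.has_derivative[OF bounded_linear_scaleC D(1)]]
    by simp
qed

lemma hol_compose:
  assumes "holomorphic_map_on u T" "holomorphic_map_on f S" "\<And>x. x \<in> S \<Longrightarrow> f x \<in> T"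
  shows "holomorphic_map_on (\<lambda>x. u (f x)) S"
    and "x \<in> S \<Longrightarrow> fd (\<lambda>x. u (f x)) x h =
      fd u (f x) (fd f x h)"
proof -
  note D = hol_fd[OF assms(1) assms(3)] hol_fd[OF assms(2)]
  note C = has_derivative_compose[OF D(3) D(1)]
  show "holomorphic_map_on (\<lambda>x. u (f x)) S"
    using assms(2) D C
    by (intro holI[where D = "\<lambda>x h. fd u (f x)
        (fd f x h)"])
      (auto simp: holomorphic_map_on_def)
  show "x \<in> S \<Longrightarrow> fd (\<lambda>x. u (f x)) x h =
      fd u (f x) (fd f x h)"
    using fd_eqI[OF C] by simp
qed

lemma hol_const: "open S \<Longrightarrow> holomorphic_map_on (\<lambda>_. c) S"
  by (rule holI[where D = "\<lambda>_ _. 0"]) auto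

lemma hol_linear:
  assumes "bounded_linear L" "\<And>c v. L (c *\<^sub>C v) = c *\<^sub>C L v" "open S"
  shows "holomorphic_map_on L S"
  using assms by (auto intro: holI[where D = "\<lambda>_. L"]
      bounded_linear_imp_has_derivative)

lemma hol_cong:
  assumes "holomorphic_map_on u S" "\<And>x. x \<in> S \<Longrightarrow> v x = u x"
  shows "holomorphic_map_on v S"
    and "x \<in> S \<Longrightarrow> fd v x = fd u x"
proof -
  have D: "(v has_derivative fd u x) (at x)" if "x \<in> S" for x
    using hol_fd(1)[OF assms(1) that] _ that
    by (rule has_derivative_transform_within_open)
      (use assms in \<open>auto simp: holomorphic_map_on_def\<close>)
  show "holomorphic_map_on v S"
    by (rule holI[OF _ D])
      (use assms(1) hol_fd(2)[OF assms(1)] in \<open>auto simp: holomorphic_map_on_def\<close>)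
  show "x \<in> S \<Longrightarrow> fd v x = fd u x"
    by (rule fd_eqI[OF D])
qed

lemma hol_locally:
  assumes "\<And>x. x \<in> S \<Longrightarrow> \<exists>r>0. holomorphic_map_on u (ball x r)" "open S"
  shows "holomorphic_map_on u S"
  using assms unfolding holomorphic_map_on_def by (metis centre_in_ball)

lemma ball_subset_larger_ball:
  fixes x :: "'a :: real_normed_vector"
  assumes "x \<in> ball z s" "s + e \<le> r"
  shows "ball x e \<subseteq> ball z r"
proof
  fix y assume "y \<in> ball x e"
  with assms show "y \<in> ball z r"
    using dist_triangle[of z y x] by (simp add: dist_commute)
qed

text \<open>Weierstrass' theorem. Cauchy's estimate applied to differences makes the differentials
  uniformly Cauchy on smaller balls, so the real theorem on limits of derivatives applies; complex
  linearity survives pointwise limits. Convergence of the differentials is recorded as well, for the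
  condition on the differential at 0.\<close>

lemma holomorphic_uniform_limit:
  fixes u :: "nat \<Rightarrow> complex ^ 'm::finite \<Rightarrow> complex ^ 'n::finite"
  assumes S: "open S" and hol: "\<And>k. holomorphic_map_on (u k) S"
    and lim: "uniform_limit S u l sequentially"
  shows "holomorphic_map_on l S"
    and "x \<in> S \<Longrightarrow> (\<lambda>k. fd (u k) x v) \<longlonglongrightarrow> fd l x v"
proof -
  have main: "\<exists>D. (l has_derivative D) (at x) \<and>
      (\<forall>v. (\<lambda>k. fd (u k) x v) \<longlonglongrightarrow> D v)" if x: "x \<in> S" for x
  proof -
    obtain r0 where r0: "r0 > 0" "ball x r0 \<subseteq> S"
      using S x openE by blast
    define r where "r = r0 / 2"
    have r: "0 < r" "r + r \<le> r0" using r0 by (auto simp: r_def)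
    define T where "T = ball x r"
    define F where "F k y = fd (u k) y" for k y
    have TS: "T \<subseteq> S" using r0 r by (auto simp: T_def)
    have Cauchy: "\<exists>N. \<forall>k\<ge>N. \<forall>m\<ge>N. \<forall>y\<in>T. \<forall>v. norm (F k y v - F m y v) \<le> e * norm v"
      if e: "0 < e" for e
    proof -
      \<comment> \<open>Two members within e r / 2 of the limit differ by at most e r, and Cauchy's
        estimate on balls of radius r divides this by r.\<close>
      have "0 < e * r / 2" using e r by simp
      from uniform_limitD[OF lim this]
      obtain N where N: "\<And>k y. k \<ge> N \<Longrightarrow> y \<in> S \<Longrightarrow> dist (u k y) (l y) < e * r / 2"
        unfolding eventually_sequentially by blast
      have "norm (F k y v - F m y v) \<le> e * norm v" if km: "k \<ge> N" "m \<ge> N" and y: "y \<in> T" for k m y v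
      proof -
        have sub: "ball y r \<subseteq> S"
          using ball_subset_larger_ball[OF y[unfolded T_def] r(2)] r0 by blast
        have hol': "holomorphic_map_on (u k) (ball y r)" for k
          by (rule hol_subset[OF hol sub open_ball])
        have "norm (fd (\<lambda>x. u k x - u m x) y v) \<le> (e * r) / r * norm v"
        proof (rule cauchy_estimate[OF hol_diff(1)[OF hol' hol'] r(1)])
          fix z assume "z \<in> ball y r"
          then have "z \<in> S" using sub by blast
          from N[OF km(1) this] N[OF km(2) this]
          show "norm (u k z - u m z) \<le> e * r"
            using dist_triangle2[of "u k z" "u m z" "l z"] by (simp add: dist_norm)
        qed
        moreover have "fd (\<lambda>x. u k x - u m x) y v = F k y v - F m y v"
          unfolding F_def by (rule hol_diff(2)[OF hol' hol']) (use r in simp)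
        ultimately show ?thesis using r by simp
      qed
      then show ?thesis by blast
    qed
    have "\<exists>L. (\<lambda>k. F k y v) \<longlonglongrightarrow> L" if y: "y \<in> T" for y v
    proof -
      have "Cauchy (\<lambda>k. F k y v)"
      proof (rule metric_CauchyI)
        fix e :: real assume e: "0 < e"
        have "0 < norm v + 1" by (smt (verit) norm_ge_zero)
        then have "0 < e / (norm v + 1)" using e by simp
        from Cauchy[OF this] obtain N where
          N: "\<forall>k\<ge>N. \<forall>m\<ge>N. norm (F k y v - F m y v) \<le> e / (norm v + 1) * norm v"
          using y by blast
        have "e / (norm v + 1) * norm v < e"
          using e \<open>0 < norm v + 1\<close> by (simp add: field_simps)
        then have "dist (F m y v) (F n y v) < e" if "m \<ge> N" "n \<ge> N" for m n
          unfolding dist_norm using N that by (blast intro: order_le_less_trans)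
        then show "\<exists>N. \<forall>m\<ge>N. \<forall>n\<ge>N. dist (F m y v) (F n y v) < e" by blast
      qed
      then show ?thesis by (simp add: Cauchy_convergent_iff convergent_def)
    qed
    then obtain g' where g': "\<And>y v. y \<in> T \<Longrightarrow> (\<lambda>k. F k y v) \<longlonglongrightarrow> g' y v"
      by metis
    have "\<exists>g. \<forall>y\<in>T. (\<lambda>n. u n y) \<longlonglongrightarrow> g y \<and> (g has_derivative g' y) (at y within T)"
    proof (rule has_derivative_sequence)
      show "convex T" by (simp add: T_def)
      show "(u n has_derivative F n y) (at y within T)" if "y \<in> T" for n y
        using hol_fd(1)[OF hol] that TS
        by (auto simp: F_def intro: has_derivative_at_withinI)
      show "x \<in> T" using r by (simp add: T_def)
      show "(\<lambda>n. u n x) \<longlonglongrightarrow> l x"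
        using tendsto_uniform_limitI[OF lim x] .
      fix e :: real assume "0 < e"
      from Cauchy[OF this] obtain N
        where N: "\<And>k m y v. k \<ge> N \<Longrightarrow> m \<ge> N \<Longrightarrow> y \<in> T \<Longrightarrow> norm (F k y v - F m y v) \<le> e * norm v"
        by blast
      have "norm (F k y v - g' y v) \<le> e * norm v" if "k \<ge> N" "y \<in> T" for k y v
      proof (rule tendsto_upperbound)
        show "(\<lambda>m. norm (F k y v - F m y v)) \<longlonglongrightarrow> norm (F k y v - g' y v)"
          by (intro tendsto_intros g' that)
        show "\<forall>\<^sub>F m in sequentially. norm (F k y v - F m y v) \<le> e * norm v"
          unfolding eventually_sequentially using N that by blast
      qed simp
      then show "\<forall>\<^sub>F n in sequentially. \<forall>x\<in>T. \<forall>h. norm (F n x h - g' x h) \<le> e * norm h"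
        by (auto simp: eventually_sequentially)
    qed
    then obtain g where g: "\<And>y. y \<in> T \<Longrightarrow> (\<lambda>n. u n y) \<longlonglongrightarrow> g y"
      "\<And>y. y \<in> T \<Longrightarrow> (g has_derivative g' y) (at y within T)" by blast
    have xT: "x \<in> T" "open T" using r by (auto simp: T_def)
    have "g y = l y" if "y \<in> T" for y
      using g(1)[OF that] tendsto_uniform_limitI[OF lim] TS that LIMSEQ_unique by blast
    moreover have "(g has_derivative g' x) (at x)"
      using g(2)[OF xT(1)] unfolding at_within_open[OF xT] .
    ultimately have "(l has_derivative g' x) (at x)"
      using has_derivative_transform_within_open[OF _ xT(2,1)] by blast
    then show ?thesis using g'[OF xT(1)] by (auto simp: F_def)
  qed
  then obtain D where D: "\<And>x. x \<in> S \<Longrightarrow> (l has_derivative D x) (at x)"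
    "\<And>x v. x \<in> S \<Longrightarrow> (\<lambda>k. fd (u k) x v) \<longlonglongrightarrow> D x v"
    by metis
  show "holomorphic_map_on l S"
  proof (rule holI[OF S D(1)])
    fix x c v assume x: "x \<in> S"
    have "(\<lambda>k. c *\<^sub>C fd (u k) x v) \<longlonglongrightarrow> c *\<^sub>C D x v"
      by (rule bounded_linear.tendsto[OF bounded_linear_scaleC D(2)[OF x]])
    then show "D x (c *\<^sub>C v) = c *\<^sub>C D x v"
      using D(2)[OF x, of "c *\<^sub>C v"] hol_fd(2)[OF hol x] LIMSEQ_unique by simp
  qed
  show "x \<in> S \<Longrightarrow> (\<lambda>k. fd (u k) x v) \<longlonglongrightarrow> fd l x v"
    using D fd_eqI[OF D(1)] by simp
qed

section \<open>Completeness of the space of bounded holomorphic maps\<close>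

lemma axis_expansion: "v = (\<Sum>j\<in>UNIV. (v $ j) *\<^sub>C axis j 1)" for v :: "complex ^ 'n::finite"
  by (simp add: vec_eq_iff axis_def if_distrib cong: if_cong)

lemma frechet_derivative_expansion:
  fixes u :: "complex ^ 'm::finite \<Rightarrow> complex ^ 'n::finite"
  assumes "holomorphic_map_on u S" "x \<in> S"
  shows "fd u x v = (\<Sum>j\<in>UNIV. (v $ j) *\<^sub>C fd u x (axis j 1))"
proof -
  note D = hol_fd[OF assms]
  have "linear (fd u x)"
    using D(1) has_derivative_linear by blast
  then show ?thesis
    by (subst axis_expansion) (simp add: linear_sum D(2))
qed

lemma diag_map_axis: "diag_map d (axis j 1) = (d $ j) *\<^sub>C axis j 1"
  by (simp add: diag_map_def vec_eq_iff axis_def)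

text \<open>Off-diagonal entries being zero is a closed condition, in contrast to the existential
  form used in the definition of the space; this is what passes to limits.\<close>

lemma has_derivative_diag_iff:
  assumes "holomorphic_map_on u S" "x \<in> S"
  shows "(\<exists>d. (u has_derivative diag_map d) (at x)) \<longleftrightarrow>
    (\<forall>i j. i \<noteq> j \<longrightarrow> fd u x (axis j 1) $ i = 0)"
proof
  assume "\<exists>d. (u has_derivative diag_map d) (at x)"
  then obtain d where "fd u x = diag_map d"
    using fd_eqI by blast
  then show "\<forall>i j. i \<noteq> j \<longrightarrow> fd u x (axis j 1) $ i = 0"
    by (simp add: diag_map_axis) (simp add: axis_def)
next
  assume R: "\<forall>i j. i \<noteq> j \<longrightarrow> fd u x (axis j 1) $ i = 0"
  let ?d = "\<chi> i. fd u x (axis i 1) $ i"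
  have "fd u x v = diag_map ?d v" for v
  proof -
    have "fd u x v $ i = diag_map ?d v $ i" for i
    proof -
      have "fd u x v $ i
          = (\<Sum>j\<in>UNIV. v $ j * fd u x (axis j 1) $ i)"
        by (subst frechet_derivative_expansion[OF assms]) simp
      also have "\<dots> = (\<Sum>j\<in>UNIV. if j = i then v $ i * fd u x (axis i 1) $ i else 0)"
        by (rule sum.cong) (use R in auto)
      finally show ?thesis by (simp add: diag_map_def)
    qed
    then show ?thesis by (simp add: vec_eq_iff)
  qed
  then have "fd u x = diag_map ?d" by blast
  then show "\<exists>d. (u has_derivative diag_map d) (at x)"
    using hol_fd(1)[OF assms] by metis
qed

lemma bhol_holomorphic: "holomorphic_map_on (apply_bhol u) (ball 0 1)"
  and bhol_zero [simp]: "apply_bhol u 0 = 0"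
  and bhol_diag: "\<exists>d. (apply_bhol u has_derivative diag_map d) (at 0)"
  using apply_bhol[of u] by (auto simp: bounded_hol_maps_def)

lemma bounded_hol_mapsI:
  assumes "holomorphic_map_on u (ball 0 1)" "\<And>x. x \<in> ball 0 1 \<Longrightarrow> norm (u x) \<le> B" "u 0 = 0"
    "\<And>i j. i \<noteq> j \<Longrightarrow> fd u 0 (axis j 1) $ i = 0"
    "\<And>x. x \<notin> ball 0 1 \<Longrightarrow> u x = 0"
  shows "u \<in> bounded_hol_maps"
proof -
  have "bounded (u ` ball 0 1)" using assms(2) unfolding bounded_iff by blast
  then show ?thesis
    unfolding bounded_hol_maps_def mem_Collect_eq
    using assms has_derivative_diag_iff[OF assms(1), of 0] by simp
qed

lemma bhol_limit:
  fixes X :: "nat \<Rightarrow> 'n::finite bhol"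
  assumes "uniform_limit UNIV (\<lambda>k. apply_bhol (X k)) l sequentially"
  shows "l \<in> bounded_hol_maps"
proof -
  have lim: "uniform_limit (ball 0 1) (\<lambda>k. apply_bhol (X k)) l sequentially"
    by (rule uniform_limit_on_subset[OF assms]) simp
  note H = holomorphic_uniform_limit[OF open_ball bhol_holomorphic lim]
  have pw: "(\<lambda>k. apply_bhol (X k) x) \<longlonglongrightarrow> l x" for x
    by (rule tendsto_uniform_limitI[OF assms]) simp
  obtain N where N: "\<And>x. dist (apply_bhol (X N) x) (l x) < 1"
    using uniform_limitD[OF assms, of 1] unfolding eventually_sequentially by auto
  show ?thesis
  proof (rule bounded_hol_mapsI[OF H(1)])
    fix x :: "complex ^ 'n" assume x: "x \<in> ball 0 1"
    show "norm (l x) \<le> norm (X N) + 1"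
      using N[of x] norm_apply_bhol_le[OF x, of "X N"] norm_triangle_sub[of "l x" "apply_bhol (X N) x"]
      by (simp add: dist_norm norm_minus_commute)
  next
    show "l 0 = 0" using pw[of 0] by (simp add: LIMSEQ_const_iff)
  next
    fix i j :: 'n assume ij: "i \<noteq> j"
    have "(\<lambda>k. fd (apply_bhol (X k)) 0 (axis j 1) $ i)
        \<longlonglongrightarrow> fd l 0 (axis j 1) $ i"
      by (intro tendsto_vec_nth H(2)) simp
    moreover have "fd (apply_bhol (X k)) 0 (axis j 1) $ i = 0" for k
      using has_derivative_diag_iff[OF bhol_holomorphic, of 0 "X k"] bhol_diag[of "X k"] ij by simp
    ultimately show "fd l 0 (axis j 1) $ i = 0"
      by (simp add: LIMSEQ_const_iff)
  next
    show "l x = 0" if "x \<notin> ball 0 1" for x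
      using pw[of x] apply_bhol_outside[OF that] by (simp add: LIMSEQ_const_iff)
  qed
qed

lemma norm_apply_bhol_le': "norm (apply_bhol u x) \<le> norm u"
  by (cases "x \<in> ball 0 1") (simp_all add: norm_apply_bhol_le apply_bhol_outside del: mem_ball)

text \<open>Completeness carries over to continuous families. It is used for the fixed point
  argument of \<open>solvable_perturb\<close> and for the limits of difference quotients that define
  derivatives of the transfer operator.\<close>

instance bhol :: (finite) complete_space
proof
  fix X :: "nat \<Rightarrow> 'a bhol" assume X: "Cauchy X"
  have dle: "dist (apply_bhol f x) (apply_bhol g x) \<le> dist f g" for f g :: "'a bhol" and x
    using norm_apply_bhol_le'[of "f - g" x] by (simp add: dist_norm minus_bhol.rep_eq)
  have "Cauchy (\<lambda>k. apply_bhol (X k) x)" for x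
    by (rule metric_CauchyI) (meson X dle metric_CauchyD order_le_less_trans)
  then have pw: "(\<lambda>k. apply_bhol (X k) x) \<longlonglongrightarrow> lim (\<lambda>k. apply_bhol (X k) x)" for x
    by (simp only: Cauchy_convergent_iff convergent_LIMSEQ_iff)
  define l where "l x = lim (\<lambda>k. apply_bhol (X k) x)" for x
  have close: "\<exists>N. \<forall>n\<ge>N. \<forall>x. dist (apply_bhol (X n) x) (l x) \<le> e" if e: "0 < e" for e
  proof -
    obtain N where N: "\<And>m n. m \<ge> N \<Longrightarrow> n \<ge> N \<Longrightarrow> dist (X m) (X n) < e"
      using metric_CauchyD[OF X e] by blast
    have "dist (apply_bhol (X n) x) (l x) \<le> e" if "n \<ge> N" for n x
    proof (rule tendsto_upperbound)
      show "(\<lambda>m. dist (apply_bhol (X n) x) (apply_bhol (X m) x)) \<longlonglongrightarrow> dist (apply_bhol (X n) x) (l x)"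
        unfolding l_def by (intro tendsto_intros pw)
      show "\<forall>\<^sub>F m in sequentially. dist (apply_bhol (X n) x) (apply_bhol (X m) x) \<le> e"
        using N that dle unfolding eventually_sequentially
        by (meson less_eq_real_def order_trans)
    qed simp
    then show ?thesis by blast
  qed
  have "uniform_limit UNIV (\<lambda>k. apply_bhol (X k)) l sequentially"
  proof (rule uniform_limitI)
    fix e :: real assume "0 < e"
    with close[of "e / 2"] obtain N where N: "\<forall>n\<ge>N. \<forall>x. dist (apply_bhol (X n) x) (l x) \<le> e / 2" by auto
    have "dist (apply_bhol (X n) x) (l x) < e" if "n \<ge> N" for n x
      using N that \<open>0 < e\<close> by (smt (verit) field_sum_of_halves)
    then show "\<forall>\<^sub>F n in sequentially. \<forall>x\<in>UNIV. dist (apply_bhol (X n) x) (l x) < e"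
      unfolding eventually_sequentially by blast
  qed
  then have ap: "apply_bhol (Bhol l) = l"
    by (simp add: Bhol_inverse bhol_limit)
  have "X \<longlonglongrightarrow> Bhol l"
  proof (rule metric_LIMSEQ_I)
    fix e :: real assume "0 < e"
    with close[of "e / 2"] obtain N where N: "\<forall>n\<ge>N. \<forall>x. dist (apply_bhol (X n) x) (l x) \<le> e / 2" by auto
    have "dist (X n) (Bhol l) < e" if "n \<ge> N" for n
    proof -
      have "norm (X n - Bhol l) \<le> e / 2"
        using N that by (intro norm_bhol_le) (simp add: minus_bhol.rep_eq ap dist_norm)
      then show ?thesis using \<open>0 < e\<close> by (simp add: dist_norm)
    qed
    then show "\<exists>N. \<forall>n\<ge>N. dist (X n) (Bhol l) < e" by blast
  qed
  then show "convergent X" by (auto simp: convergent_def)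
qed

section \<open>Partial derivatives\<close>

definition pd :: "'m::finite \<Rightarrow> (complex ^ 'm \<Rightarrow> complex ^ 'n::finite) \<Rightarrow> complex ^ 'm \<Rightarrow> complex ^ 'n" where
  "pd j u x = fd u x (axis j 1)"

text \<open>The difference quotients are holomorphic, and the second-order Taylor bound makes them
  converge locally uniformly to the partial derivative, so Weierstrass' theorem applies. This
  replaces a Cauchy integral formula in several variables.\<close>

lemma pd_holomorphic:
  fixes u :: "complex ^ 'm::finite \<Rightarrow> complex ^ 'n::finite"
  assumes hol: "holomorphic_map_on u S"
  shows "holomorphic_map_on (pd j u) S"
proof (rule hol_locally)
  show S: "open S" using hol by (simp add: holomorphic_map_on_def)
  fix x assume "x \<in> S"
  then obtain r0 where r0: "r0 > 0" "cball x r0 \<subseteq> S"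
    using S open_contains_cball by blast
  have "compact (u ` cball x r0)"
    by (intro compact_continuous_image compact_cball continuous_on_subset[OF _ r0(2)]
        hol_continuous[OF hol])
  then have "bounded (u ` cball x r0)" by (rule compact_imp_bounded)
  then obtain M where M: "\<And>y. y \<in> cball x r0 \<Longrightarrow> norm (u y) \<le> M"
    unfolding bounded_iff by blast
  define r where "r = r0 / 2"
  have r: "0 < r" "r + r \<le> r0" using r0 by (auto simp: r_def)
  \<comment> \<open>The shift by 2 keeps the first step already strictly below r, so translated
    points remain in the ball of radius 2 r.\<close>
  define t where "t k = complex_of_real (r / (real k + 2))" for k
  define q where "q k y = inverse (t k) *\<^sub>C (u (y + t k *\<^sub>C axis j 1) - u y)" for k y
  have t: "t k \<noteq> 0" "cmod (t k) = r / (real k + 2)" "cmod (t k) < r" for k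
  proof -
    have "0 < r / (real k + 2)" using r by simp
    then show "t k \<noteq> 0" "cmod (t k) = r / (real k + 2)"
      unfolding t_def norm_of_real by (simp_all only: of_real_eq_0_iff abs_of_pos less_irrefl)
    moreover have "r / (real k + 2) < r / 1" using r by (intro divide_strict_left_mono) auto
    ultimately show "cmod (t k) < r" by simp
  qed
  have sub: "ball y r \<subseteq> cball x r0" if "y \<in> ball x r" for y
    using ball_subset_larger_ball[OF that r(2)] by auto
  have holy: "holomorphic_map_on u (ball y r)" if "y \<in> ball x r" for y
    using hol_subset[OF hol _ open_ball] sub[OF that] r0 by blast
  have holb: "holomorphic_map_on u (ball x r0)"
    using hol_subset[OF hol _ open_ball] r0 by force
  have qhol: "holomorphic_map_on (q k) (ball x r)" for k
    unfolding q_def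
  proof (rule hol_scaleC(1), rule hol_diff(1),
      rule hol_compose(1)[OF holb])
    show "holomorphic_map_on (\<lambda>y. y + t k *\<^sub>C axis j 1) (ball x r)"
      by (intro hol_add(1) hol_const hol_linear) auto
    show "holomorphic_map_on u (ball x r)"
      using holy[of x] r by simp
    fix y assume "y \<in> ball x r"
    moreover have "y + t k *\<^sub>C axis j 1 \<in> ball y r" using t(3)[of k] by (simp add: dist_norm norm_scaleC)
    ultimately show "y + t k *\<^sub>C axis j 1 \<in> ball x r0"
      using ball_subset_larger_ball[OF _ r(2)] by blast
  qed
  have qlim: "uniform_limit (ball x r) q (pd j u) sequentially"
  proof (rule uniform_limitI)
    fix e :: real assume e: "0 < e"
    have "(\<lambda>k. 1 / (real k + 2)) \<longlonglongrightarrow> 0"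
      using LIMSEQ_Suc[OF LIMSEQ_inverse_real_of_nat] by (simp add: inverse_eq_divide add.commute)
    then have "(\<lambda>k. 3 * M / r * (1 / (real k + 2))) \<longlonglongrightarrow> 3 * M / r * 0"
      by (intro tendsto_intros)
    then have "\<forall>\<^sub>F k in sequentially. 3 * M / r * (1 / (real k + 2)) < e"
      using e by (intro order_tendstoD) auto
    then show "\<forall>\<^sub>F k in sequentially. \<forall>y\<in>ball x r. dist (q k y) (pd j u y) < e"
    proof eventually_elim
      case (elim k)
      show ?case
      proof
        fix y assume y: "y \<in> ball x r"
        let ?v = "t k *\<^sub>C (axis j 1 :: complex ^ 'm)"
        have "fd u y ?v = t k *\<^sub>C pd j u y"
          using hol_fd(2)[OF holy[OF y], of y] r by (simp add: pd_def)
        then have "q k y - pd j u y = inverse (t k) *\<^sub>C (u (y + ?v) - u y - fd u y ?v)"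
          using t(1)[of k] by (simp add: q_def vec_eq_iff algebra_simps)
        then have "norm (q k y - pd j u y)
            = norm (u (y + ?v) - u y - fd u y ?v) / cmod (t k)"
          by (simp add: norm_scaleC norm_inverse divide_inverse mult.commute)
        also have "\<dots> \<le> 3 * M * (norm ?v / r)\<^sup>2 / cmod (t k)"
        proof (intro divide_right_mono taylor_order2[OF holy[OF y]])
          show "norm (u z) \<le> M" if "z \<in> ball y r" for z
            using M sub[OF y] that by blast
          show "norm ?v < r" using t(3)[of k] by (simp add: norm_scaleC)
        qed simp
        also have "\<dots> = 3 * M / r * (1 / (real k + 2))"
        proof -
          define K where "K = real k + 2"
          have "K > 0" by (simp add: K_def)
          then show ?thesis
            using r unfolding norm_scaleC t(2) K_def[symmetric]
            by (simp add: power2_eq_square field_simps)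
        qed
        also have "\<dots> < e" by (rule elim)
        finally show "dist (q k y) (pd j u y) < e" by (simp add: dist_norm)
      qed
    qed
  qed
  have "holomorphic_map_on (pd j u) (ball x r)"
    by (rule holomorphic_uniform_limit(1)[OF open_ball qhol qlim])
  then show "\<exists>r>0. holomorphic_map_on (pd j u) (ball x r)" using r by blast
qed

section \<open>Leading homogeneous parts\<close>

text \<open>Order of vanishing is encoded as a growth bound on the germ at 0. It therefore applies
  directly to Taylor remainders and to differences of compositions, before any of their coefficients
  are known.\<close>

definition vanishes :: "nat \<Rightarrow> (complex ^ 'm::finite \<Rightarrow> complex ^ 'n::finite) \<Rightarrow> bool" where
  "vanishes d u \<longleftrightarrow> (\<exists>C e. 0 < e \<and> (\<forall>x\<in>ball 0 e. norm (u x) \<le> C * norm x ^ d))"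

lemma vanishesE:
  assumes "vanishes d u" "0 < r"
  obtains C e where "0 < e" "e \<le> r" "e \<le> 1" "0 \<le> C" "\<And>x. norm x < e \<Longrightarrow> norm (u x) \<le> C * norm x ^ d"
proof -
  obtain C e where Ce: "0 < e" "\<forall>x\<in>ball 0 e. norm (u x) \<le> C * norm x ^ d"
    using assms(1) unfolding vanishes_def by blast
  show ?thesis
  proof (rule that[of "min e (min r 1)" "max C 0"])
    fix x :: "complex ^ 'a" assume "norm x < min e (min r 1)"
    then have "norm (u x) \<le> C * norm x ^ d" using Ce by simp
    also have "\<dots> \<le> max C 0 * norm x ^ d" by (intro mult_right_mono) auto
    finally show "norm (u x) \<le> max C 0 * norm x ^ d" .
  qed (use Ce assms(2) in auto)
qed

lemma vanishesI:
  assumes "0 < e" "\<And>x. norm x < e \<Longrightarrow> norm (u x) \<le> C * norm x ^ d"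
  shows "vanishes d u"
  using assms unfolding vanishes_def by (intro exI[of _ C] exI[of _ e]) auto

lemma vanishes_add:
  assumes "vanishes d u" "vanishes d v"
  shows "vanishes d (\<lambda>x. u x + v x)"
proof -
  obtain C e where 1: "0 < e" "\<And>x. norm x < e \<Longrightarrow> norm (u x) \<le> C * norm x ^ d"
    using vanishesE[OF assms(1) zero_less_one] by blast
  obtain C' e' where 2: "0 < e'" "\<And>x. norm x < e' \<Longrightarrow> norm (v x) \<le> C' * norm x ^ d"
    using vanishesE[OF assms(2) zero_less_one] by blast
  show ?thesis
    by (rule vanishesI[of "min e e'" _ "C + C'"])
      (use 1 2 in \<open>auto simp: distrib_right intro: order_trans[OF norm_triangle_ineq add_mono]\<close>)
qed

lemma vanishes_uminus: "vanishes d u \<Longrightarrow> vanishes d (\<lambda>x. - u x)"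
  by (simp add: vanishes_def)

lemma vanishes_diff: "vanishes d u \<Longrightarrow> vanishes d v \<Longrightarrow> vanishes d (\<lambda>x. u x - v x)"
  using vanishes_add[of d u "\<lambda>x. - v x"] vanishes_uminus[of d v] by simp

lemma vanishes_cong:
  assumes "vanishes d u" "0 < r" "\<And>x. norm x < r \<Longrightarrow> v x = u x"
  shows "vanishes d v"
proof -
  obtain C e where "0 < e" "e \<le> r" "\<And>x. norm x < e \<Longrightarrow> norm (u x) \<le> C * norm x ^ d"
    using vanishesE[OF assms(1,2)] by metis
  then show ?thesis by (intro vanishesI[of e _ C]) (auto simp: assms(3))
qed

lemma vanishes_Suc_imp:
  assumes "vanishes (Suc d) u" shows "vanishes d u"
proof -
  obtain C e where 1: "0 < e" "e \<le> 1" "0 \<le> C" "\<And>x. norm x < e \<Longrightarrow> norm (u x) \<le> C * norm x ^ Suc d"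
    using vanishesE[OF assms zero_less_one] by blast
  show ?thesis
  proof (rule vanishesI[OF 1(1)])
    fix x :: "complex ^ 'a" assume x: "norm x < e"
    have "C * norm x ^ Suc d \<le> C * norm x ^ d"
      using 1 x by (intro mult_left_mono power_decreasing) auto
    with 1(4)[OF x] show "norm (u x) \<le> C * norm x ^ d" by linarith
  qed
qed

lemma vanishes_Suc_zero: "vanishes (Suc d) u \<Longrightarrow> u 0 = 0"
  using vanishesE[of "Suc d" u 1] by (metis mult_zero_right norm_le_zero_iff norm_zero power_Suc
      mult_zero_left zero_less_one)

lemma vanishes_0:
  assumes "holomorphic_map_on u (ball 0 r)" "0 < r"
  shows "vanishes 0 u"
proof -
  have "isCont u 0"
    using hol_fd(1)[OF assms(1), of 0] assms(2) has_derivative_continuous by force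
  then have "\<exists>e>0. \<forall>x. norm x < e \<longrightarrow> norm (u x - u 0) < 1"
    unfolding continuous_at_eps_delta dist_norm by (metis diff_zero zero_less_one)
  then obtain e where e: "e > 0" "\<And>x. norm x < e \<Longrightarrow> norm (u x - u 0) < 1"
    by blast
  show ?thesis
  proof (rule vanishesI[OF e(1), of _ "1 + norm (u 0)"])
    show "norm (u x) \<le> (1 + norm (u 0)) * norm x ^ 0" if "norm x < e" for x
      using e(2)[OF that] norm_triangle_sub[of "u x" "u 0"] by simp
  qed
qed

text \<open>On the ball of radius norm x about x the map is at most C (2 norm x)^(d+1); Cauchy's
  estimate divides by norm x and so loses exactly one order. The radius degenerates at x = 0, where
  continuity of the partial derivative gives the bound.\<close>

lemma vanishes_pd:
  assumes van: "vanishes (Suc d) u" and hol: "holomorphic_map_on u (ball 0 r)" and r: "0 < r"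
  shows "vanishes d (pd j u)"
proof -
  obtain C e where C: "0 < e" "e \<le> r" "0 \<le> C" "\<And>x. norm x < e \<Longrightarrow> norm (u x) \<le> C * norm x ^ Suc d"
    using vanishesE[OF van r] by blast
  let ?C = "C * 2 ^ Suc d"
  have ne: "norm (pd j u x) \<le> ?C * norm x ^ d" if x: "norm x < e / 2" "x \<noteq> 0" for x
  proof -
    have sub: "norm y < 2 * norm x" if "y \<in> ball x (norm x)" for y
      using that norm_triangle_sub[of y x] by (simp add: dist_norm norm_minus_commute)
    have "norm (pd j u x) \<le> (C * (2 * norm x) ^ Suc d) / norm x * norm (axis j 1 :: complex ^ 'a)"
      unfolding pd_def
    proof (rule cauchy_estimate)
      show "holomorphic_map_on u (ball x (norm x))"
        using sub x C by (intro hol_subset[OF hol]) force+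
      fix y assume "y \<in> ball x (norm x)"
      note y = sub[OF this]
      then have "norm (u y) \<le> C * norm y ^ Suc d" using x by (intro C) simp
      also have "\<dots> \<le> C * (2 * norm x) ^ Suc d"
        using y C by (intro mult_left_mono power_mono) auto
      finally show "norm (u y) \<le> C * (2 * norm x) ^ Suc d" .
    qed (use x in simp)
    also have "\<dots> = ?C * norm x ^ d" using x by (simp add: power_mult_distrib)
    finally show ?thesis .
  qed
  have "norm (pd j u 0) \<le> ?C * norm (0 :: complex ^ 'a) ^ d"
  proof (rule tendsto_le[of "at 0"])
    have "isCont (pd j u) 0"
      using hol_fd(1)[OF pd_holomorphic[OF hol], of 0] r has_derivative_continuous
      by force
    then show "((\<lambda>x. norm (pd j u x)) \<longlongrightarrow> norm (pd j u 0)) (at 0)"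
      by (intro tendsto_norm) (simp add: isCont_def)
    show "((\<lambda>x. ?C * norm x ^ d) \<longlongrightarrow> ?C * norm (0 :: complex ^ 'a) ^ d) (at (0 :: complex ^ 'a))"
      by (intro tendsto_intros)
    have "\<forall>\<^sub>F x in at 0. x \<in> ball 0 (e / 2) \<and> x \<noteq> (0 :: complex ^ 'a)"
      using C unfolding eventually_at by (intro exI[of _ "e / 2"]) auto
    then show "\<forall>\<^sub>F x in at 0. norm (pd j u x) \<le> ?C * norm x ^ d"
      by eventually_elim (use ne in auto)
  qed simp
  then show ?thesis
    using ne C by (intro vanishesI[of "e / 2" _ ?C]) force+
qed

lemma schwarz_vanishes:
  assumes "holomorphic_map_on u (ball 0 1)" "\<And>y. y \<in> ball 0 1 \<Longrightarrow> norm (u y) \<le> M"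
    "vanishes d u" "x \<in> ball 0 1"
  shows "norm (u x) \<le> M * norm x ^ d"
proof -
  obtain C e where "0 < e" "\<And>x. norm x < e \<Longrightarrow> norm (u x) \<le> C * norm x ^ d"
    using vanishesE[OF assms(3) zero_less_one] by blast
  then have "norm (u x) \<le> M * (norm x / 1) ^ d"
    by (intro schwarz_vec_order[OF assms(1,2) _ _ assms(4)]) auto
  then show ?thesis by simp
qed

text \<open>Taylor coefficients are indexed by words instead of multi-indices, so that a multi-index
  occurs once for each of its orderings.\<close>

fun word_deriv :: "'m::finite list \<Rightarrow> (complex ^ 'm \<Rightarrow> complex ^ 'n::finite) \<Rightarrow> complex ^ 'n" where
  "word_deriv [] u = u 0"
| "word_deriv (j # w) u = word_deriv w (pd j u)"

definition word_power :: "complex ^ 'm::finite \<Rightarrow> 'm list \<Rightarrow> complex" where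
  "word_power x w = (\<Prod>j\<leftarrow>w. x $ j)"

lemma word_power_simps [simp]:
  "word_power x [] = 1" "word_power x (j # w) = x $ j * word_power x w"
  by (simp_all add: word_power_def)

definition words :: "nat \<Rightarrow> 'm::finite list set" where
  "words d = {w. length w = d}"

lemma finite_words: "finite (words d :: 'm::finite list set)"
  using finite_lists_length_eq[of "UNIV :: 'm set" d] by (simp add: words_def)

lemma words_0: "words 0 = {[]}"
  by (auto simp: words_def)

lemma words_Suc: "words (Suc d) = (\<lambda>(j, w). j # w) ` (UNIV \<times> words d)"
  by (auto simp: words_def length_Suc_conv image_iff)

lemma sum_words_Suc: "(\<Sum>w\<in>words (Suc d). g w) = (\<Sum>j\<in>UNIV. \<Sum>w\<in>words d. g (j # w))"
proof -
  have "inj_on (\<lambda>(j, w). j # w) (UNIV \<times> words d)"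
    by (auto simp: inj_on_def)
  then show ?thesis
    unfolding words_Suc sum.reindex[OF \<open>inj_on _ _\<close>] sum.cartesian_product
    by (simp add: case_prod_unfold)
qed

lemma word_deriv_cong:
  assumes "holomorphic_map_on u (ball 0 r)" "0 < r" "\<And>x. x \<in> ball 0 r \<Longrightarrow> v x = u x"
  shows "word_deriv w v = word_deriv w u"
  using assms
proof (induction w arbitrary: u v)
  case (Cons j w)
  have "pd j v x = pd j u x" if "x \<in> ball 0 r" for x
    using hol_cong(2)[OF Cons.prems(1,3) that] by (simp add: pd_def)
  from Cons.IH[OF pd_holomorphic[OF Cons.prems(1)] Cons.prems(2) this] show ?case by simp
qed simp

lemma word_deriv_diff:
  assumes "holomorphic_map_on u (ball 0 r)" "holomorphic_map_on v (ball 0 r)" "0 < r"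
  shows "word_deriv w (\<lambda>x. u x - v x) = word_deriv w u - word_deriv w v"
  using assms
proof (induction w arbitrary: u v)
  case (Cons j w)
  have "word_deriv w (pd j (\<lambda>x. u x - v x)) = word_deriv w (\<lambda>x. pd j u x - pd j v x)"
    using Cons.prems
    by (intro word_deriv_cong hol_diff(1) pd_holomorphic)
      (auto simp: pd_def hol_diff(2))
  then show ?case
    using Cons.IH[OF pd_holomorphic[OF Cons.prems(1)] pd_holomorphic[OF Cons.prems(2)] Cons.prems(3)]
    by simp
qed simp

lemma word_deriv_linear:
  assumes "holomorphic_map_on u (ball 0 r)" "0 < r" "bounded_linear L" "\<And>c v. L (c *\<^sub>C v) = c *\<^sub>C L v"
  shows "word_deriv w (\<lambda>x. L (u x)) = L (word_deriv w u)"
  using assms(1,2)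
proof (induction w arbitrary: u)
  case (Cons j w)
  have L: "holomorphic_map_on L UNIV"
    by (intro hol_linear assms(3,4)) simp
  have "fd L y = L" for y
    by (intro fd_eqI bounded_linear_imp_has_derivative assms(3))
  then have "pd j (\<lambda>x. L (u x)) x = L (pd j u x)" if "x \<in> ball 0 r" for x
    unfolding pd_def using hol_compose(2)[OF L Cons.prems(1) _ that] by simp
  then have "word_deriv w (pd j (\<lambda>x. L (u x))) = word_deriv w (\<lambda>x. L (pd j u x))"
    using Cons.prems
    by (intro word_deriv_cong[OF hol_compose(1)[OF L]] pd_holomorphic) auto
  then show ?case
    using Cons.IH[OF pd_holomorphic[OF Cons.prems(1)] Cons.prems(2)] by simp
qed simp

lemma word_deriv_vanishes:
  assumes "holomorphic_map_on u (ball 0 r)" "0 < r" "vanishes d u" "length w < d"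
  shows "word_deriv w u = 0"
  using assms
proof (induction w arbitrary: u d)
  case Nil
  then show ?case using vanishes_Suc_zero[of "d - 1" u] by simp
next
  case (Cons j w)
  then obtain d' where d: "d = Suc d'" by (cases d) auto
  show ?case
    using Cons.IH[OF pd_holomorphic[OF Cons.prems(1)] Cons.prems(2) vanishes_pd[of d' u r j]]
      Cons.prems d by simp
qed

text \<open>Every derivative halves the radius and costs a factor 2 / r. The point is the order of
  quantifiers: K depends on w and r only, so coefficients are bounded linear functionals of the map
  and vary continuously along a family.\<close>

lemma word_deriv_bound:
  assumes "0 < r"
  shows "\<exists>K\<ge>0. \<forall>(u :: complex ^ 'm::finite \<Rightarrow> complex ^ 'n::finite) M.
    holomorphic_map_on u (ball 0 r) \<and> (\<forall>x\<in>ball 0 r. norm (u x) \<le> M) \<longrightarrow> norm (word_deriv w u) \<le> K * M"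
  using assms
proof (induction w arbitrary: r)
  case Nil
  then show ?case by (intro exI[of _ 1]) auto
next
  case (Cons j w)
  obtain K where K: "K \<ge> 0" "\<And>(u :: complex ^ 'm \<Rightarrow> complex ^ 'n) M.
    holomorphic_map_on u (ball 0 (r / 2)) \<Longrightarrow> (\<forall>x\<in>ball 0 (r / 2). norm (u x) \<le> M) \<Longrightarrow>
      norm (word_deriv w u) \<le> K * M"
    using Cons.IH[of "r / 2"] Cons.prems by auto
  show ?case
  proof (intro exI[of _ "K * (2 / r)"] conjI allI impI)
    show "0 \<le> K * (2 / r)" using K Cons.prems by simp
    fix u :: "complex ^ 'm \<Rightarrow> complex ^ 'n" and M
    assume u: "holomorphic_map_on u (ball 0 r) \<and> (\<forall>x\<in>ball 0 r. norm (u x) \<le> M)"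
    have "norm (word_deriv w (pd j u)) \<le> K * (M / (r / 2))"
    proof (intro K ballI)
      show "holomorphic_map_on (pd j u) (ball 0 (r / 2))"
        using u Cons.prems by (intro hol_subset[OF pd_holomorphic]) auto
      fix x :: "complex ^ 'm" assume "x \<in> ball 0 (r / 2)"
      then have sub: "ball x (r / 2) \<subseteq> ball 0 r"
        by (rule ball_subset_larger_ball) simp
      have "norm (pd j u x) \<le> M / (r / 2) * norm (axis j 1 :: complex ^ 'm)"
        unfolding pd_def
        using u sub Cons.prems by (intro cauchy_estimate hol_subset[OF _ sub]) auto
      then show "norm (pd j u x) \<le> M / (r / 2)" by simp
    qed
    then show "norm (word_deriv (j # w) u) \<le> K * (2 / r) * M"
      by (simp add: mult_ac)
  qed
qed

text \<open>The d-th differential at 0 evaluated on (x, ..., x). A multi-index occurs with its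
  multinomial multiplicity, so division by d! gives the usual homogeneous part of degree d.\<close>

definition taylor_part :: "nat \<Rightarrow> (complex ^ 'm::finite \<Rightarrow> complex ^ 'n::finite) \<Rightarrow> complex ^ 'm \<Rightarrow> complex ^ 'n" where
  "taylor_part d u x = (\<Sum>w\<in>words d. word_power x w *\<^sub>C word_deriv w u)"

lemma taylor_part_0: "taylor_part 0 u x = u 0"
  by (simp add: taylor_part_def words_0)

lemma taylor_part_Suc: "taylor_part (Suc d) u x = (\<Sum>j\<in>UNIV. (x $ j) *\<^sub>C taylor_part d (pd j u) x)"
  by (simp add: taylor_part_def sum_words_Suc scaleC_sum_right scaleC_scaleC)

lemma word_power_scaleR: "word_power (t *\<^sub>R x) w = of_real t ^ length w * word_power x w"
  by (induction w) (simp_all add: scaleR_conv_of_real[where 'a = complex] mult_ac)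

lemma taylor_part_scaleR: "taylor_part d u (t *\<^sub>R x) = t ^ d *\<^sub>R taylor_part d u x"
proof -
  have "word_power (t *\<^sub>R x) w *\<^sub>C word_deriv w u = t ^ d *\<^sub>R (word_power x w *\<^sub>C word_deriv w u)"
    if "w \<in> words d" for w
    using that scaleC_of_real[of "t ^ d" "word_power x w *\<^sub>C word_deriv w u"]
    by (simp add: word_power_scaleR words_def scaleC_scaleC)
  then show ?thesis
    by (simp add: taylor_part_def scaleR_right.sum)
qed

lemma ray_has_derivative:
  assumes "holomorphic_map_on u S" "t *\<^sub>R x \<in> S"
  shows "((\<lambda>t. u (t *\<^sub>R x)) has_derivative (\<lambda>s. s *\<^sub>R fd u (t *\<^sub>R x) x)) (at t)"
proof -
  note D = hol_fd(1)[OF assms]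
  have "((\<lambda>t. t *\<^sub>R x) has_derivative (\<lambda>s. s *\<^sub>R x)) (at t)"
    by (auto intro!: derivative_eq_intros)
  from has_derivative_compose[OF this D] show ?thesis
    by (simp add: linear_cmul[OF has_derivative_linear[OF D]])
qed

text \<open>The mean value inequality for t \<mapsto> u (t x) - t^d q on the unit interval. The term
  with 0^d is the value at t = 0: it is q when d = 0 and vanishes otherwise.\<close>

lemma radial_mvt:
  fixes u :: "complex ^ 'm::finite \<Rightarrow> complex ^ 'n::finite"
  assumes hol: "holomorphic_map_on u (ball 0 r)" and x: "norm x < r"
    and b: "\<And>t. 0 < t \<Longrightarrow> t < 1 \<Longrightarrow>
      norm (fd u (t *\<^sub>R x) x - (real d * t ^ (d - 1)) *\<^sub>R q) \<le> b"
  shows "norm ((u x - q) - (u 0 - 0 ^ d *\<^sub>R q)) \<le> b"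
proof -
  have dom: "t *\<^sub>R x \<in> ball 0 r" if "0 \<le> t" "t \<le> 1" for t
    using x that mult_left_le_one_le[of "norm x" t] by simp
  define g where "g t = u (t *\<^sub>R x) - t ^ d *\<^sub>R q" for t
  define g' where "g' t s = s *\<^sub>R (fd u (t *\<^sub>R x) x - (real d * t ^ (d - 1)) *\<^sub>R q)" for t s :: real
  have der: "(g has_derivative g' t) (at t)" if t: "0 \<le> t" "t \<le> 1" for t
  proof -
    note ray_has_derivative[OF hol dom[OF t]]
    moreover have "((\<lambda>t. t ^ d *\<^sub>R q) has_derivative (\<lambda>s. (s * (real d * t ^ (d - 1))) *\<^sub>R q)) (at t)"
      by (auto intro!: derivative_eq_intros simp: mult_ac)
    ultimately have "(g has_derivative (\<lambda>s. s *\<^sub>R fd u (t *\<^sub>R x) x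
        - (s * (real d * t ^ (d - 1))) *\<^sub>R q)) (at t)"
      unfolding g_def using has_derivative_diff by fastforce
    then show ?thesis
      by (simp add: g'_def[abs_def] scaleR_diff_right)
  qed
  have "\<exists>t\<in>{0<..<1}. norm (g 1 - g 0) \<le> norm (g' t (1 - 0))"
  proof (rule mvt_general)
    show "continuous_on {0..1} g"
      by (intro continuous_at_imp_continuous_on ballI has_derivative_continuous[OF der]) auto
  qed (use der in auto)
  then obtain t where "t \<in> {0<..<1}" "norm (g 1 - g 0) \<le> norm (g' t 1)" by auto
  with b[of t] show ?thesis by (simp add: g_def g'_def)
qed

text \<open>The last hypothesis is Euler's relation: the radial derivative of the k-homogeneous q
  agrees with the one prescribed by the fields T. Errors of order d in the partial derivatives are
  multiplied by the components of x, which gains one order.\<close>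

lemma vanishes_radial_integral:
  fixes u :: "complex ^ 'm::finite \<Rightarrow> complex ^ 'n::finite"
  assumes hol: "holomorphic_map_on u (ball 0 r)" and r: "0 < r"
    and van: "\<And>j. vanishes d (\<lambda>x. pd j u x - T j x)"
    and q: "\<And>t x. (real k * t ^ (k - 1)) *\<^sub>R q x = (\<Sum>j\<in>UNIV. (x $ j) *\<^sub>C T j (t *\<^sub>R x))"
  shows "vanishes (Suc d) (\<lambda>x. (u x - q x) - (u 0 - 0 ^ k *\<^sub>R q x))"
proof -
  have "\<exists>C e. 0 < e \<and> e \<le> r \<and> 0 \<le> C \<and>
      (\<forall>x. norm x < e \<longrightarrow> norm (pd j u x - T j x) \<le> C * norm x ^ d)" for j
    using vanishesE[OF van r] by metis
  then obtain C e where C: "\<And>j. 0 < e j" "\<And>j. e j \<le> r" "\<And>j. 0 \<le> C j"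
    "\<And>j x. norm x < e j \<Longrightarrow> norm (pd j u x - T j x) \<le> C j * norm x ^ d" by metis
  define e0 where "e0 = Min (range e)"
  have e0: "0 < e0" "\<And>j. e0 \<le> e j" using C(1) by (auto simp: e0_def)
  show ?thesis
  proof (rule vanishesI[OF e0(1)])
    fix x :: "complex ^ 'm" assume x: "norm x < e0"
    have xr: "norm x < r" using x e0(2) C(2) by (meson order_less_le_trans)
    show "norm ((u x - q x) - (u 0 - 0 ^ k *\<^sub>R q x)) \<le> (\<Sum>j\<in>UNIV. C j) * norm x ^ Suc d"
    proof (rule radial_mvt[OF hol xr])
      fix t :: real assume t: "0 < t" "t < 1"
      have tx: "norm (t *\<^sub>R x) \<le> norm x" using t by (simp add: mult_left_le_one_le)
      have "fd u (t *\<^sub>R x) x - (real k * t ^ (k - 1)) *\<^sub>R q x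
          = (\<Sum>j\<in>UNIV. (x $ j) *\<^sub>C (pd j u (t *\<^sub>R x) - T j (t *\<^sub>R x)))"
        unfolding pd_def q scaleC_diff_right sum_subtractf
        using tx xr by (subst frechet_derivative_expansion[OF hol]) auto
      also have "norm \<dots> \<le> (\<Sum>j\<in>UNIV. norm x * (C j * norm x ^ d))"
      proof (rule order_trans[OF norm_sum], intro sum_mono)
        fix j
        have "norm (pd j u (t *\<^sub>R x) - T j (t *\<^sub>R x)) \<le> C j * norm (t *\<^sub>R x) ^ d"
          using tx x e0(2)[of j] by (intro C(4)) linarith
        also have "\<dots> \<le> C j * norm x ^ d"
          using tx C(3) by (intro mult_left_mono power_mono) auto
        finally show "norm ((x $ j) *\<^sub>C (pd j u (t *\<^sub>R x) - T j (t *\<^sub>R x))) \<le> norm x * (C j * norm x ^ d)"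
          unfolding norm_scaleC by (intro mult_mono Finite_Cartesian_Product.norm_nth_le) auto
      qed
      also have "\<dots> = (\<Sum>j\<in>UNIV. C j) * norm x ^ Suc d"
        by (simp add: sum_distrib_left sum_distrib_right mult_ac)
      finally show "norm (fd u (t *\<^sub>R x) x - (real k * t ^ (k - 1)) *\<^sub>R q x)
          \<le> (\<Sum>j\<in>UNIV. C j) * norm x ^ Suc d" .
    qed
  qed
qed

text \<open>Integrating the expansions of the partial derivatives along rays (Euler's identity).\<close>

lemma vanishes_taylor_remainder:
  fixes u :: "complex ^ 'm::finite \<Rightarrow> complex ^ 'n::finite"
  assumes "holomorphic_map_on u (ball 0 r)" "0 < r" "vanishes d u"
  shows "vanishes (Suc d) (\<lambda>x. u x - (1 / fact d) *\<^sub>R taylor_part d u x)"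
  using assms
proof (induction d arbitrary: u)
  case 0
  have "vanishes 0 (\<lambda>x. pd j u x - 0)" for j
    using vanishes_0[OF pd_holomorphic[OF 0(1)] 0(2)] by simp
  \<comment> \<open>With T = 0, q = 0 and k = 0 the conclusion says that u x - u 0 vanishes to first
    order.\<close>
  from vanishes_radial_integral[OF 0(1,2) this, of 0 "\<lambda>_. 0"]
  show ?case by (simp add: taylor_part_0)
next
  case (Suc d)
  let ?T = "\<lambda>j x. (1 / fact d) *\<^sub>R taylor_part d (pd j u) x"
  let ?q = "\<lambda>x. (1 / fact (Suc d)) *\<^sub>R taylor_part (Suc d) u x"
  have "vanishes (Suc d) (\<lambda>x. pd j u x - ?T j x)" for j
    by (rule Suc.IH[OF pd_holomorphic[OF Suc.prems(1)] Suc.prems(2) vanishes_pd[OF Suc.prems(3,1,2)]])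
  moreover have "(real (Suc d) * t ^ (Suc d - 1)) *\<^sub>R ?q x = (\<Sum>j\<in>UNIV. (x $ j) *\<^sub>C ?T j (t *\<^sub>R x))" for t x
  proof -
    have "(real (Suc d) * t ^ (Suc d - 1)) *\<^sub>R ?q x = t ^ d *\<^sub>R (1 / fact d) *\<^sub>R taylor_part (Suc d) u x"
      by (simp add: fact_Suc del: of_nat_Suc)
    then show ?thesis
      by (simp add: taylor_part_Suc taylor_part_scaleR scaleR_right.sum scaleC_scaleR mult.commute)
  qed
  ultimately have "vanishes (Suc (Suc d)) (\<lambda>x. (u x - ?q x) - (u 0 - 0 ^ Suc d *\<^sub>R ?q x))"
    by (rule vanishes_radial_integral[OF Suc.prems(1,2)])
  then show ?case using vanishes_Suc_zero[OF Suc.prems(3)] by simp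
qed

section \<open>Diagonal linear maps and composition with them\<close>

lemma bounded_linear_diag_map: "bounded_linear (diag_map (l :: complex ^ 'n::finite))"
proof -
  have "linear (diag_map l)"
    by (intro linearI) (simp_all add: diag_map_def vec_eq_iff algebra_simps)
  then show ?thesis by (simp add: linear_conv_bounded_linear)
qed

lemma diag_map_zero_right [simp]: "diag_map l 0 = 0"
  by (rule linear_0[OF bounded_linear.linear[OF bounded_linear_diag_map]])

lemma diag_map_scaleC: "diag_map l (c *\<^sub>C v) = c *\<^sub>C diag_map l v"
  by (simp add: diag_map_def vec_eq_iff)

lemma diag_map_holomorphic: "open S \<Longrightarrow> holomorphic_map_on (diag_map l) S"
  by (intro hol_linear bounded_linear_diag_map diag_map_scaleC)

lemma frechet_derivative_diag_map: "fd (diag_map l) x = diag_map l"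
  by (intro fd_eqI bounded_linear_imp_has_derivative bounded_linear_diag_map)

text \<open>By the chain rule each derivative in direction j brings out a factor l_j. This is where
  the products of multipliers in (H3) come from.\<close>

lemma word_deriv_diag:
  assumes "holomorphic_map_on u (ball 0 r)" "0 < r" "\<And>x. norm (diag_map l x) \<le> norm x"
  shows "word_deriv w (\<lambda>x. u (diag_map l x)) = word_power l w *\<^sub>C word_deriv w u"
  using assms(1,2)
proof (induction w arbitrary: u)
  case Nil
  then show ?case by simp
next
  case (Cons j w)
  have dom: "diag_map l x \<in> ball 0 r" if "x \<in> ball 0 r" for x
    using that assms(3)[of x] by simp
  have holc: "holomorphic_map_on (\<lambda>x. v (diag_map l x)) (ball 0 r)"
    if "holomorphic_map_on v (ball 0 r)" for v
    by (rule hol_compose(1)[OF that diag_map_holomorphic dom]) auto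
  note p = pd_holomorphic[OF Cons.prems(1)]
  have "pd j (\<lambda>x. u (diag_map l x)) x = (l $ j) *\<^sub>C pd j u (diag_map l x)" if "x \<in> ball 0 r" for x
  proof -
    have "pd j (\<lambda>x. u (diag_map l x)) x
        = fd u (diag_map l x) ((l $ j) *\<^sub>C axis j 1)"
      unfolding pd_def
      using hol_compose(2)[OF Cons.prems(1) diag_map_holomorphic[OF open_ball] dom that]
      by (simp add: frechet_derivative_diag_map diag_map_axis)
    then show ?thesis
      using hol_fd(2)[OF Cons.prems(1) dom[OF that]] by (simp add: pd_def)
  qed
  then have "word_deriv w (pd j (\<lambda>x. u (diag_map l x)))
      = word_deriv w (\<lambda>x. (l $ j) *\<^sub>C pd j u (diag_map l x))"
    using Cons.prems
    by (intro word_deriv_cong[of _ r] hol_scaleC(1) holc p) auto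
  also have "\<dots> = (l $ j) *\<^sub>C word_deriv w (\<lambda>x. pd j u (diag_map l x))"
    by (rule word_deriv_linear[OF holc[OF p] Cons.prems(2) bounded_linear_scaleC])
      (simp add: scaleC_scaleC mult.commute)
  also have "\<dots> = (l $ j) *\<^sub>C word_power l w *\<^sub>C word_deriv w (pd j u)"
    by (simp add: Cons.IH[OF p Cons.prems(2)])
  finally show ?case by (simp add: scaleC_scaleC)
qed

lemma second_order_contact:
  fixes f :: "complex ^ 'n::finite \<Rightarrow> complex ^ 'n"
  assumes hol: "holomorphic_map_on f (ball 0 1)" and M: "\<And>y. y \<in> ball 0 1 \<Longrightarrow> norm (f y) \<le> M"
    and 0: "f 0 = 0" "fd f 0 = D" and x: "x \<in> ball 0 1"
  shows "norm (f x - D x) \<le> 3 * M * (norm x)\<^sup>2"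
  using taylor_order2[OF hol M, of x] 0 x by simp

text \<open>To leading order f may be replaced by its linear part. The two points differ by a
  quantity of order 2, and near x the map u has Lipschitz constant of order norm x^(d-1) by Cauchy's
  estimate, so the difference has order d + 1.\<close>

lemma vanishes_conjugate:
  fixes u :: "complex ^ 'n::finite \<Rightarrow> complex ^ 'm::finite"
  assumes hol: "holomorphic_map_on u (ball 0 1)" and van: "vanishes d u"
    and f: "holomorphic_map_on f (ball 0 1)" "\<And>x. x \<in> ball 0 1 \<Longrightarrow> norm (f x) \<le> 1" "f 0 = 0"
    and fl: "fd f 0 = diag_map l" and l: "\<And>x. norm (diag_map l x) \<le> norm x"
  shows "vanishes (Suc d) (\<lambda>x. u (f x) - u (diag_map l x))"
proof -
  obtain C e where C: "0 < e" "e \<le> 1" "0 \<le> C" "\<And>x. norm x < e \<Longrightarrow> norm (u x) \<le> C * norm x ^ d"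
    using vanishesE[OF van zero_less_one] by blast
  have fx: "norm (f x) \<le> norm x" if "x \<in> ball 0 1" for x
    using schwarz_vec1[OF f that] by simp
  show ?thesis
  \<comment> \<open>The growth bound on u is used on the ball of radius 4 norm x. Both image points
    lie in the ball of radius 2 norm x by the Schwarz lemma and the bound on the diagonal
    map.\<close>
  proof (rule vanishesI[of "e / 4"])
    show "0 < e / 4" using C by simp
    fix x :: "complex ^ 'n" assume x: "norm x < e / 4"
    have x1: "x \<in> ball 0 1" using x C by simp
    show "norm (u (f x) - u (diag_map l x)) \<le> (3 * C * 4 ^ d) * norm x ^ Suc d"
    proof (cases "x = 0")
      case True
      then show ?thesis
        by (simp add: f(3))
    next
      case False
      have "norm (u (f x) - u (diag_map l x))
          \<le> (C * (4 * norm x) ^ d) / (4 * norm x - 2 * norm x) * norm (f x - diag_map l x)"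
      proof (rule lipschitz_on_smaller_ball[of _ "4 * norm x"])
        show "holomorphic_map_on u (ball 0 (4 * norm x))"
          using x C by (intro hol_subset[OF hol]) auto
        show "norm (u y) \<le> C * (4 * norm x) ^ d" if "y \<in> ball 0 (4 * norm x)" for y
        proof -
          have "norm (u y) \<le> C * norm y ^ d" using that x by (intro C) simp
          also have "\<dots> \<le> C * (4 * norm x) ^ d"
            using that C by (intro mult_left_mono power_mono) auto
          finally show ?thesis .
        qed
        show "f x \<in> ball 0 (2 * norm x)" "diag_map l x \<in> ball 0 (2 * norm x)"
          using fx[OF x1] l[of x] False by (auto intro: order_le_less_trans)
      qed (use False in simp)
      also have "\<dots> \<le> (C * (4 * norm x) ^ d) / (4 * norm x - 2 * norm x) * (3 * 1 * (norm x)\<^sup>2)"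
        using C by (intro mult_left_mono second_order_contact[OF f fl x1]) auto
      also have "\<dots> = (3 / 2 * C * 4 ^ d) * norm x ^ Suc d"
        using False by (simp add: power_mult_distrib power2_eq_square field_simps)
      also have "\<dots> \<le> (3 * C * 4 ^ d) * norm x ^ Suc d"
        using C by (intro mult_right_mono) auto
      finally show ?thesis .
    qed
  qed
qed

section \<open>Homogeneous polynomial maps\<close>

lemma bounded_bilinear_scaleC:
  "bounded_bilinear (\<lambda>c (v :: 'a :: complex_normed_vector). c *\<^sub>C v)"
proof
  show "(r *\<^sub>R a) *\<^sub>C b = r *\<^sub>R a *\<^sub>C b" for r a and b :: 'a
    by (rule linear_cmul[OF bounded_linear.linear[OF bounded_linear_scaleC_left]])
  show "a *\<^sub>C (r *\<^sub>R b) = r *\<^sub>R a *\<^sub>C b" for r a and b :: 'a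
    by (rule scaleC_scaleR)
  show "\<exists>K. \<forall>a (b :: 'a). norm (a *\<^sub>C b) \<le> norm a * norm b * K"
    by (intro exI[of _ 1]) (simp add: norm_scaleC)
qed (simp_all add: scaleC_add_left scaleC_add_right)

lemma word_power_holomorphic:
  fixes s :: "complex ^ 'n::finite"
  shows "holomorphic_map_on (\<lambda>x :: complex ^ 'm::finite. word_power x w *\<^sub>C s) UNIV"
proof (induction w)
  case Nil
  then show ?case by (simp add: hol_const)
next
  case (Cons j w)
  let ?g = "\<lambda>x. word_power x w *\<^sub>C s"
  note D = hol_fd[OF Cons.IH UNIV_I]
  have "holomorphic_map_on (\<lambda>x. (x $ j) *\<^sub>C ?g x) UNIV"
  proof (rule holI)
    fix x :: "complex ^ 'm"
    have "((\<lambda>x. x $ j) has_derivative (\<lambda>v. v $ j)) (at x)"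
      by (intro bounded_linear_imp_has_derivative bounded_linear_vec_nth)
    from bounded_bilinear.FDERIV[OF bounded_bilinear_scaleC this D(1)]
    show "((\<lambda>x. (x $ j) *\<^sub>C ?g x) has_derivative
        (\<lambda>v. (x $ j) *\<^sub>C fd ?g x v + (v $ j) *\<^sub>C ?g x)) (at x)" .
    show "(x $ j) *\<^sub>C fd ?g x (c *\<^sub>C v) + ((c *\<^sub>C v) $ j) *\<^sub>C ?g x =
      c *\<^sub>C ((x $ j) *\<^sub>C fd ?g x v + (v $ j) *\<^sub>C ?g x)" for c v
      by (simp add: D(2) scaleC_add_right scaleC_scaleC mult_ac)
  qed simp
  then show ?case by (simp add: scaleC_scaleC)
qed

definition word_poly :: "nat \<Rightarrow> ('m::finite list \<Rightarrow> complex ^ 'n::finite) \<Rightarrow> complex ^ 'm \<Rightarrow> complex ^ 'n" where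
  "word_poly d s x = (\<Sum>w\<in>words d. word_power x w *\<^sub>C s w)"

lemma hol_sum:
  assumes "finite I" "\<And>i. i \<in> I \<Longrightarrow> holomorphic_map_on (g i) S" "open S"
  shows "holomorphic_map_on (\<lambda>x. \<Sum>i\<in>I. g i x) S"
  using assms(1,2)
  by (induction I) (auto simp: hol_const[OF assms(3)] intro: hol_add(1))

lemma word_poly_holomorphic: "open S \<Longrightarrow> holomorphic_map_on (word_poly d s) S"
  unfolding word_poly_def[abs_def]
  by (rule hol_subset[where S = UNIV])
    (auto intro!: hol_sum word_power_holomorphic finite_words)

lemma norm_word_power_le: "cmod (word_power x w) \<le> norm x ^ length w"
  by (induction w) (auto simp: norm_mult intro!: mult_mono Finite_Cartesian_Product.norm_nth_le)

lemma norm_word_poly_le: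
  fixes x :: "complex ^ 'm::finite" and s :: "'m list \<Rightarrow> complex ^ 'n::finite"
  shows "norm (word_poly d s x) \<le> (\<Sum>w\<in>words d. norm (s w)) * norm x ^ d"
proof -
  have "norm (word_poly d s x) \<le> (\<Sum>w\<in>words d. norm x ^ d * norm (s w))"
    unfolding word_poly_def
  proof (rule order_trans[OF norm_sum], intro sum_mono)
    fix w :: "'m list" assume "w \<in> words d"
    then show "norm (word_power x w *\<^sub>C s w) \<le> norm x ^ d * norm (s w)"
      using norm_word_power_le[of x w] unfolding norm_scaleC
      by (intro mult_right_mono) (auto simp: words_def)
  qed
  also have "\<dots> = (\<Sum>w\<in>words d. norm (s w)) * norm x ^ d"
    by (simp add: sum_distrib_left sum_distrib_right mult.commute)
  finally show ?thesis .
qed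

lemma word_power_diag: "word_power (diag_map l x) w = word_power l w * word_power x w"
  by (induction w) (simp_all add: diag_map_def mult_ac)

lemma word_poly_diag: "word_poly d s (diag_map l x) = word_poly d (\<lambda>w. word_power l w *\<^sub>C s w) x"
  by (simp add: word_poly_def word_power_diag scaleC_scaleC mult.commute)

lemma vanishes_word_poly: "vanishes d (word_poly d s)"
  by (rule vanishesI[OF zero_less_one norm_word_poly_le])

section \<open>The transfer operator of a family\<close>

abbreviation lam :: "'n::finite bhol \<Rightarrow> complex ^ 'n" where
  "lam u \<equiv> multipliers (apply_bhol u)"

abbreviation mult :: "('a::metric_space \<Rightarrow>\<^sub>C 'n::finite bhol) \<Rightarrow> 'a \<Rightarrow> complex ^ 'n" where
  "mult f a \<equiv> lam (apply_bcontfun f a)"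

lemma bhol_frechet_derivative_0: "fd (apply_bhol u) 0 = diag_map (lam u)"
proof -
  obtain d where d: "(apply_bhol u has_derivative diag_map d) (at 0)" using bhol_diag by blast
  have "lam u = d"
    by (simp add: multipliers_def fd_eqI[OF d] diag_map_axis vec_eq_iff)
  then show ?thesis using fd_eqI[OF d] by simp
qed

lemma frechet_derivative_lam:
  "fd (apply_bhol u) 0 = diag_map d \<Longrightarrow> lam u = d"
  by (simp add: multipliers_def diag_map_axis vec_eq_iff)

text \<open>Cauchy's estimate at the origin on the unit ball gives the constant 1. Through
  \<open>norm_lam_le\<close> a dimension factor would enter, and the linear part of a map into a
  smaller ball would not be seen to be contracting.\<close>

lemma norm_diag_lam_le: "norm (diag_map (lam u) x) \<le> norm u * norm x"
  using cauchy_estimate[OF bhol_holomorphic _ norm_apply_bhol_le, of u x]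
  by (simp add: bhol_frechet_derivative_0)

lemma norm_diag_map_le: "norm (diag_map l x) \<le> norm l * norm x"
proof -
  have "norm (diag_map l x) \<le> norm (norm l *\<^sub>R x)"
  proof (rule norm_le_componentwise_cart)
    fix i
    show "norm (diag_map l x $ i) \<le> norm ((norm l *\<^sub>R x) $ i)"
      by (simp add: diag_map_def norm_mult mult_right_mono Finite_Cartesian_Product.norm_nth_le)
  qed
  then show ?thesis by simp
qed

lemma diag_map_diff_left: "diag_map (l - m) x = diag_map l x - diag_map m x"
  by (simp add: diag_map_def vec_eq_iff algebra_simps)

lemma diag_map_diff_right: "diag_map l (x - y) = diag_map l x - diag_map l y"
  by (simp add: diag_map_def vec_eq_iff algebra_simps)

lemma diag_map_add_right: "diag_map l (x + y) = diag_map l x + diag_map l y"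
  by (simp add: diag_map_def vec_eq_iff algebra_simps)

lemma lam_diff: "lam (u - v) = lam u - lam v"
proof (rule frechet_derivative_lam, rule ext)
  fix x
  have "apply_bhol (u - v) = (\<lambda>x. apply_bhol u x - apply_bhol v x)"
    by (simp add: minus_bhol.rep_eq)
  then show "fd (apply_bhol (u - v)) 0 x = diag_map (lam u - lam v) x"
    using hol_diff(2)[OF bhol_holomorphic bhol_holomorphic, of 0 u v x]
    by (simp add: bhol_frechet_derivative_0 diag_map_diff_left)
qed

lemma lam_scaleC: "lam (c *\<^sub>C u) = c *\<^sub>C lam u"
proof (rule frechet_derivative_lam, rule ext)
  fix x
  have "apply_bhol (c *\<^sub>C u) = (\<lambda>x. c *\<^sub>C apply_bhol u x)"
    by (simp add: scaleC_bhol.rep_eq)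
  then show "fd (apply_bhol (c *\<^sub>C u)) 0 x = diag_map (c *\<^sub>C lam u) x"
    using hol_scaleC(2)[OF bhol_holomorphic, of 0 c u x]
    by (simp add: bhol_frechet_derivative_0) (simp add: diag_map_def vec_eq_iff mult_ac)
qed

lemma lam_nth_eq: "lam u $ i = diag_map (lam u) (axis i 1) $ i"
  by (simp add: diag_map_axis)

lemma cmod_lam_le: "cmod (lam u $ i) \<le> norm u"
  unfolding lam_nth_eq
  using norm_diag_lam_le[of u "axis i 1"]
    Finite_Cartesian_Product.norm_nth_le[of "diag_map (lam u) (axis i 1)" i] by simp

lemma norm_lam_le: "norm (lam u) \<le> real CARD('n) * norm u" for u :: "'n::finite bhol"
proof -
  have "norm (lam u) \<le> (\<Sum>i\<in>UNIV. cmod (lam u $ i))"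
    unfolding norm_vec_def by (rule L2_set_le_sum) simp
  also have "\<dots> \<le> (\<Sum>i\<in>(UNIV :: 'n set). norm u)"
    by (intro sum_mono cmod_lam_le)
  finally show ?thesis by simp
qed

lemma continuous_on_lam: "continuous_on S (lam :: 'n::finite bhol \<Rightarrow> _)"
proof -
  have "(real CARD('n))-lipschitz_on S (lam :: 'n bhol \<Rightarrow> _)"
    by (rule lipschitz_onI) (simp_all add: dist_norm norm_lam_le flip: lam_diff)
  then show ?thesis by (rule lipschitz_on_continuous_on)
qed

lemma frechet_derivative_vanishing:
  assumes "holomorphic_map_on u (ball 0 r)" "0 < r" "vanishes 2 u"
  shows "fd u 0 v = 0"
proof -
  have "pd j u 0 = 0" for j
    using vanishes_Suc_zero[of 0 "pd j u"] vanishes_pd[of 1 u r j] assms by (simp add: numeral_2_eq_2)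
  then show ?thesis
    using frechet_derivative_expansion[OF assms(1), of 0 v] assms(2) by (simp add: pd_def)
qed

lemma lam_vanishing: "vanishes 2 (apply_bhol u) \<Longrightarrow> lam u = 0"
  by (rule frechet_derivative_lam)
    (auto simp: frechet_derivative_vanishing[OF bhol_holomorphic] diag_map_def vec_eq_iff)

lemma diag_map_0 [simp]: "diag_map 0 x = 0"
  by (simp add: diag_map_def vec_eq_iff)

lemma vanishes_bhol: "lam u = 0 \<Longrightarrow> vanishes 2 (apply_bhol u)"
proof (rule vanishesI[OF zero_less_one])
  fix x :: "complex ^ 'a" assume "lam u = 0" "norm x < 1"
  then show "norm (apply_bhol u x) \<le> 3 * norm u * norm x ^ 2"
    using second_order_contact[OF bhol_holomorphic norm_apply_bhol_le _ bhol_frechet_derivative_0, of u x]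
    by simp
qed

lemma vanishes_bhol_iff:
  "vanishes d (apply_bhol u) \<longleftrightarrow> (\<forall>x\<in>ball 0 1. norm (apply_bhol u x) \<le> norm u * norm x ^ d)"
  using schwarz_vanishes[OF bhol_holomorphic norm_apply_bhol_le, of d u]
  by (auto intro: vanishesI[OF zero_less_one, where C = "norm u"])

section \<open>Composition and diagonal multiplication as operations on bounded holomorphic
  maps\<close>

definition maps_within :: "real \<Rightarrow> 'n::finite bhol \<Rightarrow> bool" where
  "maps_within \<rho> f \<longleftrightarrow> (\<forall>x\<in>ball 0 1. norm (apply_bhol f x) \<le> \<rho>)"

lemma maps_within_le:
  assumes "maps_within \<rho> f" "x \<in> ball 0 1"
  shows "norm (apply_bhol f x) \<le> \<rho> * norm x"
  using schwarz_vec1[OF bhol_holomorphic _ bhol_zero assms(2), of f \<rho>] assms(1)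
  by (simp add: maps_within_def)

lemma maps_within_ball: "maps_within \<rho> f \<Longrightarrow> \<rho> < 1 \<Longrightarrow> x \<in> ball 0 1 \<Longrightarrow> apply_bhol f x \<in> ball 0 1"
  unfolding maps_within_def by (auto intro: order_le_less_trans)

lemma maps_within_nonneg: "maps_within \<rho> f \<Longrightarrow> 0 \<le> \<rho>"
  unfolding maps_within_def by (metis bhol_zero centre_in_ball norm_zero zero_less_one)

lemma maps_within_norm_le: "maps_within \<rho> f \<Longrightarrow> norm f \<le> \<rho>"
  by (rule norm_bhol_le) (auto simp: maps_within_def)

text \<open>A total function; \<open>apply_bcomp\<close> identifies its value with the composite
  when f maps into a ball of radius below 1. The differential of the composite at 0 is then a
  product of diagonal maps, hence diagonal.\<close>

definition bcomp :: "'n::finite bhol \<Rightarrow> 'n bhol \<Rightarrow> 'n bhol" where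
  "bcomp u f = Bhol (\<lambda>x. apply_bhol u (apply_bhol f x))"

lemma apply_bcomp:
  assumes "maps_within \<rho> f" "\<rho> < 1"
  shows "apply_bhol (bcomp u f) = (\<lambda>x. apply_bhol u (apply_bhol f x))"
proof -
  note C = hol_compose[OF bhol_holomorphic bhol_holomorphic maps_within_ball[OF assms]]
  have "(\<lambda>x. apply_bhol u (apply_bhol f x)) \<in> bounded_hol_maps"
  proof (rule bounded_hol_mapsI[OF C(1)])
    show "norm (apply_bhol u (apply_bhol f x)) \<le> norm u" for x
      by (rule norm_apply_bhol_le')
    show "fd (\<lambda>x. apply_bhol u (apply_bhol f x)) 0 (axis j 1) $ i = 0"
      if "i \<noteq> j" for i j
      using C(2)[of 0 u "axis j 1"] that
      by (simp add: bhol_frechet_derivative_0) (simp add: diag_map_def axis_def)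
  qed (auto simp: apply_bhol_outside)
  then show ?thesis by (simp add: bcomp_def Bhol_inverse)
qed

lift_definition dmul :: "complex ^ 'n::finite \<Rightarrow> 'n bhol \<Rightarrow> 'n bhol" is
  "\<lambda>l u x. diag_map l (u x)"
proof -
  fix l :: "complex ^ 'n" and u :: "complex ^ 'n \<Rightarrow> complex ^ 'n"
  assume u: "u \<in> bounded_hol_maps"
  define v where "v = Bhol u"
  have v: "u = apply_bhol v" using u by (simp add: v_def Bhol_inverse)
  note C = hol_compose[OF diag_map_holomorphic[OF open_UNIV] bhol_holomorphic UNIV_I]
  show "(\<lambda>x. diag_map l (u x)) \<in> bounded_hol_maps"
    unfolding v
  proof (rule bounded_hol_mapsI[OF C(1)])
    show "norm (diag_map l (apply_bhol v x)) \<le> norm l * norm v" for x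
      by (rule order_trans[OF norm_diag_map_le mult_left_mono]) (simp_all add: norm_apply_bhol_le')
    show "fd (\<lambda>x. diag_map l (apply_bhol v x)) 0 (axis j 1) $ i = 0"
      if "i \<noteq> j" for i j
      using C(2)[of 0 l v "axis j 1"] that
      by (simp add: bhol_frechet_derivative_0 frechet_derivative_diag_map)
        (simp add: diag_map_def axis_def)
  qed (auto simp: apply_bhol_outside diag_map_def vec_eq_iff simp del: mem_ball)
qed

lemma norm_dmul_le: "norm (dmul l u) \<le> norm l * norm u"
  by (rule norm_bhol_le)
    (auto simp: dmul.rep_eq intro!: order_trans[OF norm_diag_map_le] mult_left_mono norm_apply_bhol_le')

lemma norm_dmul_lam_le: "norm (dmul (lam f) u) \<le> norm f * norm u"
  by (rule norm_bhol_le)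
    (auto simp: dmul.rep_eq intro!: order_trans[OF norm_diag_lam_le] mult_left_mono norm_apply_bhol_le')

lemma dmul_diff_split: "dmul l u - dmul m v = dmul l (u - v) + dmul (l - m) v"
  by (rule bhol_eqI)
    (simp add: dmul.rep_eq minus_bhol.rep_eq plus_bhol.rep_eq diag_map_diff_left diag_map_diff_right)

lemma norm_dmul_lam_diff:
  "norm (dmul (lam f) u - dmul (lam g) v) \<le> norm f * norm (u - v) + norm (f - g) * norm v"
  unfolding dmul_diff_split lam_diff[symmetric]
  by (intro order_trans[OF norm_triangle_ineq] add_mono norm_dmul_lam_le)

text \<open>Composition is Lipschitz in both arguments. In the inner one this fails up to the
  boundary of the ball, and the uniform bound \<rho> < 1 on the images is what allows Cauchy's
  estimate for v.\<close>

lemma norm_bcomp_diff: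
  assumes f: "maps_within \<rho> f" and g: "maps_within \<rho> g" and \<rho>: "\<rho> < 1"
  shows "norm (bcomp u f - bcomp v g) \<le> norm (u - v) + 2 / (1 - \<rho>) * norm v * norm (f - g)"
proof (rule norm_bhol_le)
  fix x :: "complex ^ 'a" assume x: "x \<in> ball 0 1"
  \<comment> \<open>The midpoint of \<rho> and 1: the images lie in the open ball of radius r, and a
    distance (1 - \<rho>) / 2 to the unit sphere remains for the Lipschitz estimate.\<close>
  define r where "r = (1 + \<rho>) / 2"
  have r: "r < 1" "\<rho> < r" "1 - r = (1 - \<rho>) / 2" using \<rho> by (auto simp: r_def field_simps)
  have "apply_bhol f x \<in> ball 0 r" "apply_bhol g x \<in> ball 0 r"
    using f g x r(2) unfolding maps_within_def by (auto intro: order_le_less_trans)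
  then have "norm (apply_bhol v (apply_bhol f x) - apply_bhol v (apply_bhol g x))
      \<le> norm v / (1 - r) * norm (apply_bhol f x - apply_bhol g x)"
    using r(1) by (intro lipschitz_on_smaller_ball[OF bhol_holomorphic norm_apply_bhol_le])
  also have "\<dots> \<le> norm v / (1 - r) * norm (f - g)"
    using norm_apply_bhol_le'[of "f - g" x] r by (intro mult_left_mono) (auto simp: minus_bhol.rep_eq)
  also have "\<dots> = 2 / (1 - \<rho>) * norm v * norm (f - g)"
    by (simp add: r)
  finally have 1: "norm (apply_bhol v (apply_bhol f x) - apply_bhol v (apply_bhol g x))
      \<le> 2 / (1 - \<rho>) * norm v * norm (f - g)" .
  have 2: "norm (apply_bhol u (apply_bhol f x) - apply_bhol v (apply_bhol f x)) \<le> norm (u - v)"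
    using norm_apply_bhol_le'[of "u - v" "apply_bhol f x"] by (simp add: minus_bhol.rep_eq)
  have "apply_bhol (bcomp u f - bcomp v g) x
      = (apply_bhol u (apply_bhol f x) - apply_bhol v (apply_bhol f x))
      + (apply_bhol v (apply_bhol f x) - apply_bhol v (apply_bhol g x))"
    by (simp add: minus_bhol.rep_eq apply_bcomp[OF f \<rho>] apply_bcomp[OF g \<rho>])
  then show "norm (apply_bhol (bcomp u f - bcomp v g) x)
      \<le> norm (u - v) + 2 / (1 - \<rho>) * norm v * norm (f - g)"
    using norm_triangle_mono[OF 2 1] by simp
qed

lemma continuous_on_boundI:
  fixes F :: "'a::metric_space \<Rightarrow> 'b::real_normed_vector"
  assumes "\<And>a b. norm (F b - F a) \<le> G a b" "\<And>a. (G a \<longlongrightarrow> 0) (at a)"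
  shows "continuous_on UNIV F"
proof (intro continuous_at_imp_continuous_on ballI)
  fix a
  have "((\<lambda>b. F b - F a) \<longlongrightarrow> 0) (at a)"
    by (rule Lim_null_comparison[OF _ assms(2)]) (simp add: assms(1))
  then show "isCont F a" by (simp add: isCont_def LIM_zero_iff)
qed

lemma bcontfun_tendsto: "(apply_bcontfun u \<longlongrightarrow> apply_bcontfun u a) (at a)"
  for u :: "'a::metric_space \<Rightarrow>\<^sub>C 'b::metric_space"
  using continuous_on_apply_bcontfun[of UNIV u]
  unfolding continuous_on_eq_continuous_at[OF open_UNIV] by (blast dest: isContD)

text \<open>The base of the skew product (a, x) \<mapsto> (\<sigma> a, f_a x). The inverse \<tau> is
  a parameter so that cocycle equations can be solved backwards as well.\<close>

locale skew_base =
  fixes \<sigma> \<tau> :: "'a::metric_space \<Rightarrow> 'a"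
  assumes compact_base: "compact (UNIV :: 'a set)" and homeo: "homeomorphism UNIV UNIV \<sigma> \<tau>"
begin

lemma continuous_sigma: "continuous_on S \<sigma>" and continuous_tau: "continuous_on S \<tau>"
  using homeo by (auto simp: homeomorphism_def intro: continuous_on_subset)

lemma tau_sigma [simp]: "\<tau> (\<sigma> a) = a" and sigma_tau [simp]: "\<sigma> (\<tau> a) = a"
  using homeo by (auto simp: homeomorphism_def)

lemma apply_Bcontfun:
  fixes F :: "'a \<Rightarrow> 'b::metric_space"
  assumes "continuous_on UNIV F"
  shows "apply_bcontfun (Bcontfun F) = F"
  using assms compact_imp_bounded[OF compact_continuous_image[OF assms compact_base]]
  by (simp add: Bcontfun_inverse bcontfun_def)

lemma continuous_sigma_bcontfun: "continuous_on S (\<lambda>a. apply_bcontfun u (\<sigma> a))"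
  for u :: "'a \<Rightarrow>\<^sub>C 'b::metric_space"
  by (rule continuous_on_compose2[OF continuous_on_apply_bcontfun[of UNIV] continuous_sigma]) simp

lemma sigma_tendsto: "((\<lambda>a. apply_bcontfun u (\<sigma> a)) \<longlongrightarrow> apply_bcontfun u (\<sigma> a)) (at a)"
  for u :: "'a \<Rightarrow>\<^sub>C 'b::metric_space"
  using continuous_sigma_bcontfun[of UNIV u]
  unfolding continuous_on_eq_continuous_at[OF open_UNIV] by (blast dest: isContD)

section \<open>The transfer operator on continuous families\<close>

definition unif_within :: "real \<Rightarrow> ('a \<Rightarrow>\<^sub>C 'n::finite bhol) \<Rightarrow> bool" where
  "unif_within \<rho> g \<longleftrightarrow> \<rho> < 1 \<and> (\<forall>a. maps_within \<rho> (apply_bcontfun g a))"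

lemma withinD: "unif_within \<rho> g \<Longrightarrow> maps_within \<rho> (apply_bcontfun g a)" "unif_within \<rho> g \<Longrightarrow> \<rho> < 1"
  "unif_within \<rho> g \<Longrightarrow> 0 \<le> \<rho>"
  by (auto simp: unif_within_def intro: maps_within_nonneg)

definition transfer :: "('a \<Rightarrow>\<^sub>C 'n::finite bhol) \<Rightarrow> ('a \<Rightarrow>\<^sub>C 'n bhol) \<Rightarrow> ('a \<Rightarrow>\<^sub>C 'n bhol)" where
  "transfer g u = Bcontfun (\<lambda>a. dmul (mult g a) (apply_bcontfun u a)
     - bcomp (apply_bcontfun u (\<sigma> a)) (apply_bcontfun g a))"

lemma apply_transfer:
  assumes "unif_within \<rho> g"
  shows "apply_bcontfun (transfer g u) = (\<lambda>a. dmul (mult g a) (apply_bcontfun u a)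
     - bcomp (apply_bcontfun u (\<sigma> a)) (apply_bcontfun g a))"
  unfolding transfer_def
proof (rule apply_Bcontfun, rule continuous_on_boundI)
  note w = withinD[OF assms]
  let ?g = "apply_bcontfun g" and ?u = "apply_bcontfun u"
  let ?G = "\<lambda>a b. (norm (?g b) * norm (?u b - ?u a) + norm (?g b - ?g a) * norm (?u a))
    + (norm (?u (\<sigma> b) - ?u (\<sigma> a)) + 2 / (1 - \<rho>) * norm (?u (\<sigma> a)) * norm (?g b - ?g a))"
  fix a b
  have "(dmul (lam (?g b)) (?u b) - bcomp (?u (\<sigma> b)) (?g b))
        - (dmul (lam (?g a)) (?u a) - bcomp (?u (\<sigma> a)) (?g a))
      = (dmul (lam (?g b)) (?u b) - dmul (lam (?g a)) (?u a))
        - (bcomp (?u (\<sigma> b)) (?g b) - bcomp (?u (\<sigma> a)) (?g a))" by simp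
  also have "norm \<dots> \<le> ?G a b"
    by (intro order_trans[OF norm_triangle_ineq4] add_mono norm_dmul_lam_diff norm_bcomp_diff w)
  finally show "norm ((dmul (lam (?g b)) (?u b) - bcomp (?u (\<sigma> b)) (?g b))
        - (dmul (lam (?g a)) (?u a) - bcomp (?u (\<sigma> a)) (?g a))) \<le> ?G a b" .
  have 0: "((\<lambda>b. ?g b - ?g a) \<longlongrightarrow> 0) (at a)" "((\<lambda>b. ?u b - ?u a) \<longlongrightarrow> 0) (at a)"
    "((\<lambda>b. ?u (\<sigma> b) - ?u (\<sigma> a)) \<longlongrightarrow> 0) (at a)"
    by (auto intro!: LIM_zero bcontfun_tendsto sigma_tendsto)
  have "(?G a \<longlongrightarrow> (norm (?g a) * norm (0 :: 'b bhol) + norm (0 :: 'b bhol) * norm (?u a))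
      + (norm (0 :: 'b bhol) + 2 / (1 - \<rho>) * norm (?u (\<sigma> a)) * norm (0 :: 'b bhol))) (at a)"
    by (intro tendsto_add tendsto_mult tendsto_norm tendsto_const 0 bcontfun_tendsto)
  then show "(?G a \<longlongrightarrow> 0) (at a)" by simp
qed

lemma member_transfer:
  assumes "unif_within \<rho> g"
  shows "member (transfer g u) a x = diag_map (mult g a) (member u a x)
    - member u (\<sigma> a) (member g a x)"
  by (simp add: apply_transfer[OF assms] minus_bhol.rep_eq dmul.rep_eq
      apply_bcomp[OF withinD(1,2)[OF assms]])

lemma family_eqI:
  fixes u v :: "'a \<Rightarrow>\<^sub>C 'n::finite bhol"
  shows "(\<And>a x. x \<in> ball 0 1 \<Longrightarrow> member u a x = member v a x) \<Longrightarrow> u = v"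
  by (intro bcontfun_eqI bhol_eqI)

lemma member_diff: "member (u - v) a x = member u a x - member v a x"
  and member_add: "member (u + v) a x = member u a x + member v a x"
  and member_scaleC: "member (c *\<^sub>C u) a x = c *\<^sub>C member u a x"
  and member_scaleR: "member (r *\<^sub>R u) a x = r *\<^sub>R member u a x"
  and member_0: "member 0 a x = 0"
  for u v :: "'a \<Rightarrow>\<^sub>C 'n::finite bhol"
  by (simp_all add: minus_bhol.rep_eq plus_bhol.rep_eq apply_bcontfun_scaleC scaleC_bhol.rep_eq
      scaleR_bhol.rep_eq zero_bhol.rep_eq)

lemma norm_member_le: "norm (member u a x) \<le> norm u"
  for u :: "'a \<Rightarrow>\<^sub>C 'n::finite bhol"
  by (rule order_trans[OF norm_apply_bhol_le' norm_bounded])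

lemma norm_family_le:
  fixes u :: "'a \<Rightarrow>\<^sub>C 'n::finite bhol"
  assumes "\<And>a x. x \<in> ball 0 1 \<Longrightarrow> norm (member u a x) \<le> b"
  shows "norm u \<le> b"
  by (intro norm_bound norm_bhol_le assms)

lemma transfer_diff: "unif_within \<rho> g \<Longrightarrow> transfer g (u - v) = transfer g u - transfer g v"
  by (rule family_eqI) (simp only: member_transfer member_diff diag_map_diff_right, simp)

lemma transfer_scaleC: "unif_within \<rho> g \<Longrightarrow> transfer g (c *\<^sub>C u) = c *\<^sub>C transfer g u"
  by (rule family_eqI) (simp only: member_transfer member_scaleC diag_map_scaleC
      scaleC_diff_right)

lemma norm_transfer_le:
  assumes "unif_within \<rho> g"
  shows "norm (transfer g u) \<le> 2 * norm u"
proof (rule norm_family_le)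
  fix a and x :: "complex ^ 'b" assume "x \<in> ball 0 1"
  have "norm (diag_map (mult g a) (member u a x)) \<le> norm (apply_bcontfun g a) * norm (member u a x)"
    by (rule norm_diag_lam_le)
  also have "\<dots> \<le> 1 * norm u"
    using maps_within_norm_le[OF withinD(1)[OF assms], of a] withinD(2)[OF assms]
    by (intro mult_mono norm_member_le) auto
  finally show "norm (member (transfer g u) a x) \<le> 2 * norm u"
    unfolding member_transfer[OF assms]
    using norm_member_le[of u "\<sigma> a" "member g a x"]
    by (intro order_trans[OF norm_triangle_ineq4]) simp
qed

text \<open>Dependence on the family is Lipschitz in operator norm. This carries invertibility to
  neighbouring families and gives the Lipschitz estimate for the solution.\<close>

lemma norm_transfer_diff_le:
  assumes f: "unif_within \<rho> f" and g: "unif_within \<rho> g"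
  shows "norm (transfer g u - transfer f u) \<le> (1 + 2 / (1 - \<rho>)) * norm (g - f) * norm u"
proof (rule norm_bound)
  fix a
  let ?g = "apply_bcontfun g a" and ?f = "apply_bcontfun f a"
    and ?u = "apply_bcontfun u a" and ?v = "apply_bcontfun u (\<sigma> a)"
  have \<rho>: "\<rho> < 1" by (rule withinD(2)[OF f])
  have fg: "norm (?g - ?f) \<le> norm (g - f)" using norm_bounded[of "g - f" a] by simp
  have eq: "apply_bcontfun (transfer g u - transfer f u) a
      = (dmul (lam ?g) ?u - dmul (lam ?f) ?u) - (bcomp ?v ?g - bcomp ?v ?f)"
    by (simp add: apply_transfer[OF f] apply_transfer[OF g])
  have "norm (dmul (lam ?g) ?u - dmul (lam ?f) ?u) \<le> norm (?g - ?f) * norm ?u"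
    using norm_dmul_lam_diff[of ?g ?u ?f ?u] by simp
  also have "\<dots> \<le> norm (g - f) * norm u"
    by (intro mult_mono fg norm_bounded) auto
  finally have 1: "norm (dmul (lam ?g) ?u - dmul (lam ?f) ?u) \<le> norm (g - f) * norm u" .
  have "norm (bcomp ?v ?g - bcomp ?v ?f) \<le> 2 / (1 - \<rho>) * (norm ?v * norm (?g - ?f))"
    using norm_bcomp_diff[OF withinD(1)[OF g, of a] withinD(1)[OF f, of a] \<rho>, of ?v ?v]
    by (simp add: mult.assoc)
  also have "\<dots> \<le> 2 / (1 - \<rho>) * (norm u * norm (g - f))"
    using \<rho> by (intro mult_left_mono mult_mono fg norm_bounded) auto
  finally have 2: "norm (bcomp ?v ?g - bcomp ?v ?f) \<le> 2 / (1 - \<rho>) * (norm u * norm (g - f))" .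
  have "norm (apply_bcontfun (transfer g u - transfer f u) a)
      \<le> norm (g - f) * norm u + 2 / (1 - \<rho>) * (norm u * norm (g - f))"
    unfolding eq by (rule order_trans[OF norm_triangle_ineq4 add_mono[OF 1 2]])
  also have "\<dots> = (1 + 2 / (1 - \<rho>)) * norm (g - f) * norm u"
  proof -
    have "x * y + c * (y * x) = (1 + c) * x * y" for c x y :: real
      by (simp add: algebra_simps)
    then show ?thesis .
  qed
  finally show "norm (apply_bcontfun (transfer g u - transfer f u) a)
      \<le> (1 + 2 / (1 - \<rho>)) * norm (g - f) * norm u" .
qed

section \<open>The closed subspaces of families vanishing to a given order\<close>

definition flat :: "nat \<Rightarrow> ('a \<Rightarrow>\<^sub>C 'n::finite bhol) set" where
  "flat d = {u. \<forall>a. vanishes d (member u a)}"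

text \<open>The Schwarz lemma turns the condition on germs into a bound on the whole ball, uniform
  in a and with the norm as constant; in this form it visibly passes to limits.\<close>

lemma flat_iff:
  "u \<in> flat d \<longleftrightarrow> (\<forall>a. \<forall>x\<in>ball 0 1. norm (member u a x) \<le> norm u * norm x ^ d)"
  for u :: "'a \<Rightarrow>\<^sub>C 'n::finite bhol"
proof
  assume u: "u \<in> flat d"
  show "\<forall>a. \<forall>x\<in>ball 0 1. norm (member u a x) \<le> norm u * norm x ^ d"
  proof (intro allI ballI)
    fix a and x :: "complex ^ 'n" assume x: "x \<in> ball 0 1"
    have "norm (member u a x) \<le> norm (apply_bcontfun u a) * norm x ^ d"
      using u x by (simp add: flat_def vanishes_bhol_iff)
    also have "\<dots> \<le> norm u * norm x ^ d"
      by (intro mult_right_mono norm_bounded) simp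
    finally show "norm (member u a x) \<le> norm u * norm x ^ d" .
  qed
next
  assume "\<forall>a. \<forall>x\<in>ball 0 1. norm (member u a x) \<le> norm u * norm x ^ d"
  then show "u \<in> flat d"
    unfolding flat_def by (auto intro: vanishesI[OF zero_less_one, where C = "norm u"])
qed

lemma member_tendsto:
  fixes X :: "nat \<Rightarrow> 'a \<Rightarrow>\<^sub>C 'n::finite bhol"
  assumes "X \<longlonglongrightarrow> u"
  shows "(\<lambda>k. member (X k) a x) \<longlonglongrightarrow> member u a x"
proof -
  have "(\<lambda>k. norm (X k - u)) \<longlonglongrightarrow> 0"
    using assms by (simp add: LIM_zero_iff tendsto_norm_zero_iff)
  moreover have "norm (member (X k) a x - member u a x) \<le> norm (X k - u)" for k
    unfolding member_diff[symmetric] by (rule norm_member_le)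
  ultimately have "(\<lambda>k. member (X k) a x - member u a x) \<longlonglongrightarrow> 0"
    using Lim_null_comparison[of "\<lambda>k. member (X k) a x - member u a x" "\<lambda>k. norm (X k - u)" sequentially]
    by simp
  then show ?thesis by (simp add: LIM_zero_iff)
qed

lemma closed_flat: "closed (flat d :: ('a \<Rightarrow>\<^sub>C 'n::finite bhol) set)"
  unfolding closed_sequential_limits
proof (intro allI impI, elim conjE)
  fix X :: "nat \<Rightarrow> 'a \<Rightarrow>\<^sub>C 'n bhol" and u
  assume X: "\<forall>n. X n \<in> flat d" "X \<longlonglongrightarrow> u"
  show "u \<in> flat d"
    unfolding flat_iff
  proof (intro allI ballI)
    fix a and x :: "complex ^ 'n" assume x: "x \<in> ball 0 1"
    show "norm (member u a x) \<le> norm u * norm x ^ d"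
    proof (rule tendsto_le[OF sequentially_bot])
      show "(\<lambda>n. norm (X n) * norm x ^ d) \<longlonglongrightarrow> norm u * norm x ^ d"
        by (intro tendsto_intros X)
      show "(\<lambda>n. norm (member (X n) a x)) \<longlonglongrightarrow> norm (member u a x)"
        by (intro tendsto_norm member_tendsto X)
      show "\<forall>\<^sub>F n in sequentially. norm (member (X n) a x) \<le> norm (X n) * norm x ^ d"
        using X(1) x by (simp add: flat_iff)
    qed
  qed
qed

lemma flat_diff:
  fixes u v :: "'a \<Rightarrow>\<^sub>C 'n::finite bhol"
  assumes "u \<in> flat d" "v \<in> flat d"
  shows "u - v \<in> flat d"
  unfolding flat_def
proof (intro CollectI allI)
  fix a
  have "vanishes d (\<lambda>x. member u a x - member v a x)"
    using assms by (intro vanishes_diff) (simp_all add: flat_def)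
  then show "vanishes d (member (u - v) a)"
    by (rule vanishes_cong[OF _ zero_less_one member_diff])
qed

lemma flat_add:
  fixes u v :: "'a \<Rightarrow>\<^sub>C 'n::finite bhol"
  assumes "u \<in> flat d" "v \<in> flat d"
  shows "u + v \<in> flat d"
  unfolding flat_def
proof (intro CollectI allI)
  fix a
  have "vanishes d (\<lambda>x. member u a x + member v a x)"
    using assms by (intro vanishes_add) (simp_all add: flat_def)
  then show "vanishes d (member (u + v) a)"
    by (rule vanishes_cong[OF _ zero_less_one member_add])
qed

lemma flat_0: "0 \<in> flat d"
  by (simp add: flat_iff member_0 zero_bhol.rep_eq)

lemma flat_Suc: "u \<in> flat (Suc d) \<Longrightarrow> u \<in> flat d"
  by (simp add: flat_def vanishes_Suc_imp)

lemma vanishes_linear: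
  assumes "bounded_linear L" "vanishes d u"
  shows "vanishes d (\<lambda>x. L (u x))"
proof -
  obtain C e where C: "0 < e" "\<And>x. norm x < e \<Longrightarrow> norm (u x) \<le> C * norm x ^ d"
    using assms(2) unfolding vanishes_def by (metis mem_ball_0)
  have "norm (L (u x)) \<le> (onorm L * C) * norm x ^ d" if "norm x < e" for x
  proof -
    have "norm (L (u x)) \<le> onorm L * norm (u x)" by (rule onorm[OF assms(1)])
    also have "\<dots> \<le> onorm L * (C * norm x ^ d)"
      by (intro mult_left_mono C(2) that onorm_pos_le assms(1))
    finally show ?thesis by (simp add: mult_ac)
  qed
  then show ?thesis by (rule vanishesI[OF C(1)])
qed

lemma transfer_flat:
  assumes w: "unif_within \<rho> g" and u: "u \<in> flat d"
  shows "transfer g u \<in> flat d"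
  unfolding flat_def
proof (intro CollectI allI)
  fix a
  have "vanishes d (\<lambda>x. member u (\<sigma> a) (member g a x))"
  proof (rule vanishesI[OF zero_less_one])
    fix x :: "complex ^ 'b" assume "norm x < 1"
    then have x: "x \<in> ball 0 1" by simp
    have g: "member g a x \<in> ball 0 1" "norm (member g a x) \<le> norm x"
      using maps_within_ball[OF withinD(1,2)[OF w] x] maps_within_le[OF withinD(1)[OF w] x, of a]
        withinD(2,3)[OF w] mult_left_le_one_le[of "norm x" \<rho>] by auto
    have "norm (member u (\<sigma> a) (member g a x)) \<le> norm u * norm (member g a x) ^ d"
      using u g(1) by (simp add: flat_iff)
    also have "\<dots> \<le> norm u * norm x ^ d"
      using g(2) by (intro mult_left_mono power_mono) auto
    finally show "norm (member u (\<sigma> a) (member g a x)) \<le> norm u * norm x ^ d" .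
  qed
  moreover have "vanishes d (\<lambda>x. diag_map (mult g a) (member u a x))"
    by (rule vanishes_linear[OF bounded_linear_diag_map]) (use u in \<open>simp add: flat_def\<close>)
  ultimately have "vanishes d (\<lambda>x. diag_map (mult g a) (member u a x)
      - member u (\<sigma> a) (member g a x))"
    by (rule vanishes_diff[rotated])
  then show "vanishes d (member (transfer g u) a)"
    by (rule vanishes_cong[OF _ zero_less_one member_transfer[OF w]])
qed

end

section \<open>Perturbation of invertible operators\<close>

text \<open>For additive M preserving X this says that M is invertible on X with inverse bounded by
  K. Solvability plus an a priori estimate can be proved separately degree by degree, without naming
  the inverse.\<close>

definition solvable :: "'b::real_normed_vector set \<Rightarrow> ('b \<Rightarrow> 'b) \<Rightarrow> real \<Rightarrow> bool" where
  "solvable X M K \<longleftrightarrow> 0 \<le> K \<and> (\<forall>v\<in>X. \<exists>u\<in>X. M u = v) \<and> (\<forall>u\<in>X. norm u \<le> K * norm (M u))"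

text \<open>The Neumann series argument, phrased as a fixed point problem because the inverse S is
  only a choice function. The perturbation may be small in the operator sense on X alone.\<close>

lemma solvable_perturb:
  fixes X :: "'b::{real_normed_vector, complete_space} set"
  assumes M: "solvable X M K" and X: "closed X" "0 \<in> X" "\<And>u v. u \<in> X \<Longrightarrow> v \<in> X \<Longrightarrow> u - v \<in> X"
    and MX: "\<And>u. u \<in> X \<Longrightarrow> M u \<in> X" "\<And>u. u \<in> X \<Longrightarrow> M' u \<in> X"
    and add: "\<And>u v. u \<in> X \<Longrightarrow> v \<in> X \<Longrightarrow> M (u - v) = M u - M v"
      "\<And>u v. u \<in> X \<Longrightarrow> v \<in> X \<Longrightarrow> M' (u - v) = M' u - M' v"
    and close: "\<And>u. u \<in> X \<Longrightarrow> norm (M' u - M u) \<le> \<delta> * norm u"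
    and q: "K * \<delta> \<le> q" "0 \<le> q" "q < 1"
  shows "solvable X M' (K / (1 - q))"
proof -
  have K: "0 \<le> K" and bd: "\<And>u. u \<in> X \<Longrightarrow> norm u \<le> K * norm (M u)"
    and "\<forall>v\<in>X. \<exists>u\<in>X. M u = v"
    using M by (auto simp: solvable_def)
  then obtain S where S: "\<And>v. v \<in> X \<Longrightarrow> S v \<in> X" "\<And>v. v \<in> X \<Longrightarrow> M (S v) = v"
    by metis
  have Kd: "K * norm (M' u - M u) \<le> q * norm u" if "u \<in> X" for u
  proof -
    have "K * norm (M' u - M u) \<le> K * (\<delta> * norm u)"
      by (intro mult_left_mono close that K)
    also have "\<dots> = (K * \<delta>) * norm u" by simp
    also have "\<dots> \<le> q * norm u" by (intro mult_right_mono q) simp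
    finally show ?thesis .
  qed
  have lower: "norm u \<le> K / (1 - q) * norm (M' u)" if u: "u \<in> X" for u
  proof -
    have "K * norm (M u) \<le> K * norm (M' u) + K * norm (M' u - M u)"
    unfolding distrib_left[symmetric]
    using norm_triangle_sub[of "M u" "M' u"] by (intro mult_left_mono K) (simp add: norm_minus_commute)
  with bd[OF u] Kd[OF u] have "(1 - q) * norm u \<le> K * norm (M' u)"
    by (simp add: left_diff_distrib)
    then show ?thesis using q by (simp add: field_simps)
  qed
  have exists: "\<exists>u\<in>X. M' u = v" if v: "v \<in> X" for v
  proof -
  \<comment> \<open>A fixed point satisfies M u = v - (M' u - M u), that is M' u = v.\<close>
  define T where "T u = S (v - (M' u - M u))" for u
  have dom: "v - (M' u - M u) \<in> X" if "u \<in> X" for u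
    by (intro X(3) v MX that)
  have "\<exists>!u\<in>X. T u = u"
  proof (rule Banach_fix[OF _ _ q(2,3)])
    show "complete X" using X(1) by (simp add: complete_eq_closed)
    show "X \<noteq> {}" using X(2) by blast
    show "T ` X \<subseteq> X" unfolding T_def by (intro image_subsetI S(1) dom)
    fix x y assume x: "x \<in> X" and y: "y \<in> X"
    have eq: "M (T x - T y) = (M' (y - x) - M (y - x))"
      using x y by (simp add: T_def add S dom)
    have "norm (T x - T y) \<le> K * norm (M (T x - T y))"
      by (intro bd X(3)) (simp_all add: T_def S dom x y)
    also have "\<dots> \<le> K * (\<delta> * norm (y - x))"
      unfolding eq by (intro mult_left_mono close X(3) x y K)
    also have "\<dots> = (K * \<delta>) * norm (x - y)" by (simp add: norm_minus_commute)
    also have "\<dots> \<le> q * norm (x - y)" by (intro mult_right_mono q) simp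
    finally show "dist (T x) (T y) \<le> q * dist x y" by (simp add: dist_norm)
  qed
  then obtain u where u: "u \<in> X" "T u = u" by blast
  have "M u = v - (M' u - M u)"
    using S(2)[OF dom[OF u(1)]] u(2) by (simp add: T_def)
  then have "M' u = v" by simp
  then show ?thesis using u(1) by blast
  qed
  show ?thesis unfolding solvable_def using lower exists K q by simp
qed

section \<open>Scalar cocycle equations\<close>

context skew_base
begin

lemma continuous_bounded:
  fixes s :: "'a \<Rightarrow> 'b::real_normed_vector"
  assumes "continuous_on UNIV s"
  shows "\<exists>B. \<forall>a. norm (s a) \<le> B"
  using compact_imp_bounded[OF compact_continuous_image[OF assms compact_base]]
  by (auto simp: bounded_iff)

text \<open>The supremum m of the moduli is finite by compactness and satisfies m \<le> B + q
  m.\<close>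

lemma contracting_cocycle_bound:
  fixes s :: "'a \<Rightarrow> complex"
  assumes s: "continuous_on UNIV s" and q: "\<And>a. cmod (\<gamma> a) \<le> q" "q < 1"
    and B: "\<And>a. cmod (s a - \<gamma> a * s (\<theta> a)) \<le> B"
  shows "cmod (s a) \<le> B / (1 - q)"
proof -
  obtain C where C: "\<And>a. cmod (s a) \<le> C" using continuous_bounded[OF s] by blast
  define m where "m = (SUP a. cmod (s a))"
  have m: "cmod (s a) \<le> m" for a
    unfolding m_def by (rule cSUP_upper) (auto intro: bdd_aboveI2[OF C])
  have q0: "0 \<le> q" using q(1) norm_ge_zero order_trans by blast
  have "cmod (s a) \<le> B + q * m" for a
  proof -
    have "cmod (\<gamma> a * s (\<theta> a)) \<le> q * m"
      unfolding norm_mult using q0 by (intro mult_mono q m) auto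
    then show ?thesis using B[of a] norm_triangle_sub[of "s a" "\<gamma> a * s (\<theta> a)"] by linarith
  qed
  then have "m \<le> B + q * m" unfolding m_def by (intro cSUP_least) auto
  then have "m \<le> B / (1 - q)" using q(2) by (simp add: field_simps)
  with m[of a] show ?thesis by linarith
qed

lemma contracting_cocycle_exists:
  fixes v :: "'a \<Rightarrow> complex"
  assumes v: "continuous_on UNIV v" and \<gamma>: "continuous_on UNIV \<gamma>" and \<theta>: "continuous_on UNIV \<theta>"
    and q: "\<And>a. cmod (\<gamma> a) \<le> q" "q < 1"
  shows "\<exists>s. continuous_on UNIV s \<and> (\<forall>a. s a - \<gamma> a * s (\<theta> a) = v a)"
proof -
  define T where "T s = Bcontfun (\<lambda>a. v a + \<gamma> a * apply_bcontfun s (\<theta> a))" for s :: "'a \<Rightarrow>\<^sub>C complex"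
  have T: "apply_bcontfun (T s) = (\<lambda>a. v a + \<gamma> a * apply_bcontfun s (\<theta> a))" for s
    unfolding T_def
    by (intro apply_Bcontfun continuous_intros v \<gamma>
        continuous_on_compose2[OF continuous_on_apply_bcontfun[of UNIV] \<theta>]) simp
  have q0: "0 \<le> q" using q(1) norm_ge_zero order_trans by blast
  have "\<exists>!s. T s = s"
  proof (rule banach_fix_type[OF q0 q(2)], intro allI)
    fix s t
    show "dist (T s) (T t) \<le> q * dist s t"
    proof (rule dist_bound)
      fix a
      have "dist (apply_bcontfun (T s) a) (apply_bcontfun (T t) a)
          = cmod (\<gamma> a) * dist (apply_bcontfun s (\<theta> a)) (apply_bcontfun t (\<theta> a))"
        by (simp add: T dist_norm norm_mult flip: right_diff_distrib)
      also have "\<dots> \<le> q * dist s t"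
        using q0 by (intro mult_mono q dist_bounded) auto
      finally show "dist (apply_bcontfun (T s) a) (apply_bcontfun (T t) a) \<le> q * dist s t" .
    qed
  qed
  then obtain s where s: "T s = s" by blast
  have "apply_bcontfun s a - \<gamma> a * apply_bcontfun s (\<theta> a) = v a" for a
    using fun_cong[OF T[of s], of a] by (simp add: s)
  then show ?thesis using continuous_on_apply_bcontfun by blast
qed

lemma compact_max:
  fixes g :: "'a \<Rightarrow> real"
  assumes "continuous_on UNIV g"
  obtains b where "\<And>a. g a \<le> g b"
  using continuous_attains_sup[OF compact_base _ assms] by auto

lemma compact_min:
  fixes g :: "'a \<Rightarrow> real"
  assumes "continuous_on UNIV g"
  obtains b where "\<And>a. g b \<le> g a"
  using continuous_attains_inf[OF compact_base _ assms] by auto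

text \<open>After division by \<beta> the equation is a contraction in the sup norm. Compactness
  supplies both uniform constants: the pointwise strict inequality becomes a ratio at most q < 1,
  and \<beta>, nonzero because it dominates, has modulus at least m > 0.\<close>

lemma dominated_cocycle:
  fixes \<alpha> \<beta> :: "'a \<Rightarrow> complex"
  assumes \<alpha>: "continuous_on UNIV \<alpha>" and \<beta>: "continuous_on UNIV \<beta>" and \<theta>: "continuous_on UNIV \<theta>"
    and lt: "\<And>a. cmod (\<alpha> a) < cmod (\<beta> a)"
  shows "\<exists>K\<ge>0.
    (\<forall>v. continuous_on UNIV v \<longrightarrow>
      (\<exists>s. continuous_on UNIV s \<and> (\<forall>a. \<beta> a * s a - \<alpha> a * s (\<theta> a) = v a))) \<and>
    (\<forall>s B. continuous_on UNIV s \<longrightarrow> (\<forall>a. cmod (\<beta> a * s a - \<alpha> a * s (\<theta> a)) \<le> B) \<longrightarrow>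
      (\<forall>a. cmod (s a) \<le> K * B))"
proof -
  have \<beta>0: "\<beta> a \<noteq> 0" for a using lt by (metis norm_ge_zero norm_zero not_less)
  define \<gamma> where "\<gamma> a = \<alpha> a / \<beta> a" for a
  have \<gamma>: "continuous_on UNIV \<gamma>" unfolding \<gamma>_def by (intro continuous_intros \<alpha> \<beta>) (simp add: \<beta>0)
  obtain b where b: "\<And>a. cmod (\<gamma> a) \<le> cmod (\<gamma> b)"
    using compact_max[OF continuous_on_norm[OF \<gamma>]] by blast
  obtain e where e: "\<And>a. cmod (\<beta> e) \<le> cmod (\<beta> a)"
    using compact_min[OF continuous_on_norm[OF \<beta>]] by blast
  define q where "q = cmod (\<gamma> b)"
  define m where "m = cmod (\<beta> e)"
  have q: "cmod (\<gamma> a) \<le> q" "q < 1" "0 < m" "m \<le> cmod (\<beta> a)" for a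
    using b lt \<beta>0 e by (auto simp: q_def m_def \<gamma>_def norm_divide divide_less_eq_1)
  have eq: "\<beta> a * s a - \<alpha> a * s (\<theta> a) = \<beta> a * (s a - \<gamma> a * s (\<theta> a))" for a and s :: "'a \<Rightarrow> complex"
    using \<beta>0[of a] by (simp add: \<gamma>_def field_simps)
  show ?thesis
  proof (intro exI[of _ "1 / (m * (1 - q))"] conjI allI impI)
    show "0 \<le> 1 / (m * (1 - q))" using q by simp
    fix v :: "'a \<Rightarrow> complex" assume v: "continuous_on UNIV v"
    have "continuous_on UNIV (\<lambda>a. v a / \<beta> a)" by (intro continuous_intros v \<beta>) (simp add: \<beta>0)
    from contracting_cocycle_exists[OF this \<gamma> \<theta> q(1,2)]
    obtain s where "continuous_on UNIV s" "\<forall>a. s a - \<gamma> a * s (\<theta> a) = v a / \<beta> a" by blast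
    then show "\<exists>s. continuous_on UNIV s \<and> (\<forall>a. \<beta> a * s a - \<alpha> a * s (\<theta> a) = v a)"
      unfolding eq using \<beta>0 by (intro exI[of _ s]) simp
  next
    fix s :: "'a \<Rightarrow> complex" and B a
    assume s: "continuous_on UNIV s" and B: "\<forall>a. cmod (\<beta> a * s a - \<alpha> a * s (\<theta> a)) \<le> B"
    have "cmod (s a - \<gamma> a * s (\<theta> a)) \<le> B / m" for a
    proof -
      have "m * cmod (s a - \<gamma> a * s (\<theta> a)) \<le> cmod (\<beta> a) * cmod (s a - \<gamma> a * s (\<theta> a))"
        by (intro mult_right_mono q) simp
      also have "\<dots> \<le> B" using B unfolding eq norm_mult by blast
      finally show ?thesis using q(3) by (simp add: field_simps)
    qed
    from contracting_cocycle_bound[OF s q(1,2) this, of a]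
    show "cmod (s a) \<le> 1 / (m * (1 - q)) * B" by simp
  qed
qed

text \<open>The expanding case is the contracting one over the inverse of \<open>\<sigma>\<close>.\<close>

lemma hyperbolic_cocycle:
  fixes \<alpha> \<beta> :: "'a \<Rightarrow> complex"
  assumes \<alpha>: "continuous_on UNIV \<alpha>" and \<beta>: "continuous_on UNIV \<beta>"
    and hyp: "(\<forall>a. cmod (\<alpha> a) < cmod (\<beta> a)) \<or> (\<forall>a. cmod (\<beta> a) < cmod (\<alpha> a))"
  shows "\<exists>K\<ge>0.
    (\<forall>v. continuous_on UNIV v \<longrightarrow>
      (\<exists>s. continuous_on UNIV s \<and> (\<forall>a. \<beta> a * s a - \<alpha> a * s (\<sigma> a) = v a))) \<and>
    (\<forall>s B. continuous_on UNIV s \<longrightarrow> (\<forall>a. cmod (\<beta> a * s a - \<alpha> a * s (\<sigma> a)) \<le> B) \<longrightarrow>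
      (\<forall>a. cmod (s a) \<le> K * B))"
  using hyp
proof
  assume "\<forall>a. cmod (\<alpha> a) < cmod (\<beta> a)"
  then show ?thesis by (intro dominated_cocycle[OF \<alpha> \<beta> continuous_sigma]) blast
next
  assume lt: "\<forall>a. cmod (\<beta> a) < cmod (\<alpha> a)"
  have ct: "continuous_on UNIV (\<lambda>a. g (\<tau> a))" if "continuous_on UNIV g" for g :: "'a \<Rightarrow> complex"
    by (rule continuous_on_compose2[OF that continuous_tau]) simp
  from lt obtain K where K: "0 \<le> K" and
    ex: "\<And>v. continuous_on UNIV v \<Longrightarrow> \<exists>s. continuous_on UNIV s \<and> (\<forall>a. \<alpha> (\<tau> a) * s a - \<beta> (\<tau> a) * s (\<tau> a) = v a)" and
    bd: "\<And>s B a. continuous_on UNIV s \<Longrightarrow> \<forall>a. cmod (\<alpha> (\<tau> a) * s a - \<beta> (\<tau> a) * s (\<tau> a)) \<le> B \<Longrightarrow> cmod (s a) \<le> K * B"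
    using dominated_cocycle[OF ct[OF \<beta>] ct[OF \<alpha>] continuous_tau] by metis
  show ?thesis
  proof (intro exI[of _ K] conjI allI impI K)
    fix v :: "'a \<Rightarrow> complex" assume v: "continuous_on UNIV v"
    \<comment> \<open>Read at \<tau> a, the equation has \<alpha> as its dominating coefficient and
      s (\<tau> a) as the lower-order term; the exchange of roles accounts for the sign of
      v.\<close>
    obtain s where s: "continuous_on UNIV s" "\<forall>a. \<alpha> (\<tau> a) * s a - \<beta> (\<tau> a) * s (\<tau> a) = - v (\<tau> a)"
      using ex[OF continuous_on_minus[OF ct[OF v]]] by blast
    have "\<alpha> a * s (\<sigma> a) - \<beta> a * s a = - v a" for a using s(2)[rule_format, of "\<sigma> a"] by simp
    then have "\<beta> a * s a - \<alpha> a * s (\<sigma> a) = v a" for a by (metis minus_diff_eq minus_minus)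
    then show "\<exists>s. continuous_on UNIV s \<and> (\<forall>a. \<beta> a * s a - \<alpha> a * s (\<sigma> a) = v a)"
      using s(1) by blast
  next
    fix s :: "'a \<Rightarrow> complex" and B a
    assume s: "continuous_on UNIV s" and B: "\<forall>a. cmod (\<beta> a * s a - \<alpha> a * s (\<sigma> a)) \<le> B"
    have "cmod (\<alpha> (\<tau> b) * s b - \<beta> (\<tau> b) * s (\<tau> b)) \<le> B" for b
      using B[rule_format, of "\<tau> b"] by (simp add: norm_minus_commute)
    then show "cmod (s a) \<le> K * B" using bd[OF s] by blast
  qed
qed

section \<open>Solving the linearized conjugacy equation\<close>

text \<open>The nonresonance condition in degrees at least 2, over words. Constancy of the sign in a
  appears as one alternative valid for all a, which is the form in which cocycle equations are
  solved.\<close>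

definition nonresonant :: "('a \<Rightarrow>\<^sub>C 'n::finite bhol) \<Rightarrow> bool" where
  "nonresonant f \<longleftrightarrow> (\<forall>(w :: 'n list) i. 2 \<le> length w \<longrightarrow>
    (\<forall>a. cmod (word_power (mult f a) w) < cmod (mult f a $ i)) \<or>
    (\<forall>a. cmod (mult f a $ i) < cmod (word_power (mult f a) w)))"

lemma continuous_lam_nth: "continuous_on S (\<lambda>a. mult f a $ i)"
  for f :: "'a \<Rightarrow>\<^sub>C 'n::finite bhol"
  by (intro bounded_linear.continuous_on[OF bounded_linear_vec_nth]
      continuous_on_compose2[OF continuous_on_lam[of UNIV]] continuous_on_apply_bcontfun) simp

lemma continuous_word_power_lam: "continuous_on S (\<lambda>a. word_power (mult f a) w)"
  for f :: "'a \<Rightarrow>\<^sub>C 'n::finite bhol"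
  by (induction w) (auto intro!: continuous_intros continuous_lam_nth)

lemma diag_lam_contracts:
  assumes "unif_within \<rho> f"
  shows "norm (diag_map (mult f a) x) \<le> norm x"
  using norm_diag_lam_le[of "apply_bcontfun f a" x] maps_within_norm_le[OF withinD(1)[OF assms], of a]
    withinD(2)[OF assms] mult_right_mono[of "norm (apply_bcontfun f a)" 1 "norm x"] by simp

text \<open>On leading coefficients the operator decouples into one cocycle equation for each word.
  Replacing f by its linear part changes the composite at order d + 1 only, which derivatives of
  length d do not see, and the linear part contributes the product of multipliers.\<close>

lemma word_deriv_transfer:
  fixes f :: "'a \<Rightarrow>\<^sub>C 'n::finite bhol"
  assumes f: "unif_within \<rho> f" and u: "u \<in> flat d" and w: "length w = d"
  shows "word_deriv w (member (transfer f u) a) = diag_map (mult f a) (word_deriv w (member u a))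
    - word_power (mult f a) w *\<^sub>C word_deriv w (member u (\<sigma> a))"
proof -
  let ?l = "mult f a" and ?v = "member u (\<sigma> a)" and ?f = "member f a"
  note fd = withinD(1,2)[OF f]
  have dom: "diag_map ?l x \<in> ball 0 1" if "x \<in> ball 0 1" for x
    using diag_lam_contracts[OF f, of a x] that by (auto intro: order_le_less_trans)
  have h1: "holomorphic_map_on (\<lambda>x. diag_map ?l (member u a x)) (ball 0 1)"
    by (rule hol_compose(1)[OF diag_map_holomorphic[OF open_UNIV] bhol_holomorphic UNIV_I])
  have h2: "holomorphic_map_on (\<lambda>x. ?v (?f x)) (ball 0 1)"
    by (rule hol_compose(1)[OF bhol_holomorphic bhol_holomorphic maps_within_ball[OF fd]])
  have h3: "holomorphic_map_on (\<lambda>x. ?v (diag_map ?l x)) (ball 0 1)"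
    by (rule hol_compose(1)[OF bhol_holomorphic diag_map_holomorphic[OF open_ball] dom])
  have "vanishes (Suc d) (\<lambda>x. ?v (?f x) - ?v (diag_map ?l x))"
  proof (rule vanishes_conjugate[OF bhol_holomorphic _ bhol_holomorphic _ bhol_zero
        bhol_frechet_derivative_0 diag_lam_contracts[OF f]])
    show "vanishes d ?v" using u by (simp add: flat_def)
    show "norm (?f x) \<le> 1" if "x \<in> ball 0 1" for x
      using maps_within_ball[OF fd that, of a] by simp
  qed
  then have "word_deriv w (\<lambda>x. ?v (?f x) - ?v (diag_map ?l x)) = 0"
    by (rule word_deriv_vanishes[OF hol_diff(1)[OF h2 h3] zero_less_one]) (simp add: w)
  then have "word_deriv w (\<lambda>x. ?v (?f x)) = word_deriv w (\<lambda>x. ?v (diag_map ?l x))"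
    by (simp add: word_deriv_diff[OF h2 h3 zero_less_one])
  also have "\<dots> = word_power ?l w *\<^sub>C word_deriv w ?v"
    by (rule word_deriv_diag[OF bhol_holomorphic zero_less_one diag_lam_contracts[OF f]])
  finally have 1: "word_deriv w (\<lambda>x. ?v (?f x)) = word_power ?l w *\<^sub>C word_deriv w ?v" .
  have "word_deriv w (member (transfer f u) a)
      = word_deriv w (\<lambda>x. diag_map ?l (member u a x) - ?v (?f x))"
    by (rule word_deriv_cong[OF hol_diff(1)[OF h1 h2] zero_less_one member_transfer[OF f]])
  also have "\<dots> = word_deriv w (\<lambda>x. diag_map ?l (member u a x)) - word_deriv w (\<lambda>x. ?v (?f x))"
    by (rule word_deriv_diff[OF h1 h2 zero_less_one])
  also have "word_deriv w (\<lambda>x. diag_map ?l (member u a x)) = diag_map ?l (word_deriv w (member u a))"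
    by (rule word_deriv_linear[OF bhol_holomorphic zero_less_one bounded_linear_diag_map diag_map_scaleC])
  finally show ?thesis unfolding 1 .
qed

lemma word_deriv_family_bound:
  "\<exists>C\<ge>0. \<forall>u :: 'n::finite bhol. norm (word_deriv w (apply_bhol u)) \<le> C * norm u"
proof -
  obtain C where "C \<ge> 0" and C: "\<And>(u :: complex ^ 'n \<Rightarrow> complex ^ 'n) M. holomorphic_map_on u (ball 0 1) \<Longrightarrow>
      (\<forall>x\<in>ball 0 1. norm (u x) \<le> M) \<Longrightarrow> norm (word_deriv w u) \<le> C * M"
    using word_deriv_bound[OF zero_less_one, of w] by blast
  then show ?thesis
    by (intro exI[of _ C] conjI allI C bhol_holomorphic ballI norm_apply_bhol_le)
qed

lemma continuous_word_deriv:
  fixes u :: "'a \<Rightarrow>\<^sub>C 'n::finite bhol"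
  shows "continuous_on UNIV (\<lambda>a. word_deriv w (member u a))"
proof -
  obtain C where C: "C \<ge> 0" "\<And>u :: 'n bhol. norm (word_deriv w (apply_bhol u)) \<le> C * norm u"
    using word_deriv_family_bound by blast
  have diff: "word_deriv w (apply_bhol (u - v)) = word_deriv w (apply_bhol u) - word_deriv w (apply_bhol v)"
    for u v :: "'n bhol"
    using word_deriv_diff[OF bhol_holomorphic bhol_holomorphic zero_less_one, of w u v]
    by (simp add: minus_bhol.rep_eq[abs_def])
  have "C-lipschitz_on UNIV (\<lambda>u :: 'n bhol. word_deriv w (apply_bhol u))"
    unfolding lipschitz_on_def dist_norm diff[symmetric] using C by blast
  then have "continuous_on UNIV (\<lambda>u :: 'n bhol. word_deriv w (apply_bhol u))"
    by (rule lipschitz_on_continuous_on)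
  then show ?thesis
    by (rule continuous_on_compose2) auto
qed

end

section \<open>Homogeneous polynomials as bounded holomorphic maps\<close>

lemma vanishes_mono:
  assumes "vanishes d u" "e \<le> d"
  shows "vanishes e u"
  using assms(2,1) by (induction rule: inc_induct) (auto intro: vanishes_Suc_imp)

text \<open>Cut off outside the ball to match the representatives of the space. Degree at least 2
  makes the value and the differential at 0 vanish, so the differential is diagonal.\<close>

definition bpoly :: "nat \<Rightarrow> ('n::finite list \<Rightarrow> complex ^ 'n) \<Rightarrow> 'n bhol" where
  "bpoly d s = Bhol (\<lambda>x. if x \<in> ball 0 1 then word_poly d s x else 0)"

lemma apply_bpoly:
  assumes d: "2 \<le> d"
  shows "apply_bhol (bpoly d s) = (\<lambda>x. if x \<in> ball 0 1 then word_poly d s x else 0)"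
proof -
  have h: "holomorphic_map_on (word_poly d s) (ball 0 1)"
    by (rule word_poly_holomorphic) simp
  let ?p = "\<lambda>x. if x \<in> ball 0 1 then word_poly d s x else 0"
  have eq: "?p x = word_poly d s x" if "x \<in> ball 0 1" for x using that by simp
  have "?p \<in> bounded_hol_maps"
  proof (rule bounded_hol_mapsI[OF hol_cong(1)[OF h eq]])
    fix x :: "complex ^ 'a" assume x: "x \<in> ball 0 1"
    have "norm (word_poly d s x) \<le> (\<Sum>w\<in>words d. norm (s w)) * norm x ^ d"
      by (rule norm_word_poly_le)
    also have "\<dots> \<le> (\<Sum>w\<in>words d. norm (s w)) * 1"
      using x by (intro mult_left_mono power_le_one sum_nonneg) auto
    finally show "norm (?p x) \<le> (\<Sum>w\<in>words d. norm (s w))" using x by simp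
  next
    have "norm (word_poly d s 0) \<le> (\<Sum>w\<in>words d. norm (s w)) * norm (0 :: complex ^ 'a) ^ d"
      by (rule norm_word_poly_le)
    then show "?p 0 = 0" using d by (simp add: power_0_left)
  next
    fix i j :: 'a
    have "fd ?p 0 = fd (word_poly d s) 0"
      by (rule hol_cong(2)[OF h eq]) simp_all
    then show "fd ?p 0 (axis j 1) $ i = 0"
      using frechet_derivative_vanishing[OF h zero_less_one vanishes_mono[OF vanishes_word_poly d]]
      by simp
  qed simp_all
  then show ?thesis by (simp add: bpoly_def Bhol_inverse)
qed

lemma word_poly_diff: "word_poly d s x - word_poly d t x = word_poly d (\<lambda>w. s w - t w) x"
  by (simp add: word_poly_def sum_subtractf scaleC_diff_right)

lemma word_poly_linear:
  assumes "bounded_linear L" "\<And>c v. L (c *\<^sub>C v) = c *\<^sub>C L v"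
  shows "L (word_poly d s x) = word_poly d (\<lambda>w. L (s w)) x"
  by (simp add: word_poly_def linear_sum[OF bounded_linear.linear[OF assms(1)]] assms(2))

lemma word_poly_scaleR: "r *\<^sub>R word_poly d s x = word_poly d (\<lambda>w. r *\<^sub>R s w) x"
  by (simp add: word_poly_def scaleR_right.sum
      scaleC_scaleR)

lemma word_poly_cong: "(\<And>w. w \<in> words d \<Longrightarrow> s w = t w) \<Longrightarrow> word_poly d s x = word_poly d t x"
  by (simp add: word_poly_def)

lemma taylor_part_eq_word_poly: "taylor_part d u = word_poly d (\<lambda>w. word_deriv w u)"
  by (simp add: fun_eq_iff taylor_part_def word_poly_def)

lemma norm_bpoly_diff:
  assumes "2 \<le> d"
  shows "norm (bpoly d s - bpoly d t) \<le> (\<Sum>w\<in>words d. norm (s w - t w))"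
proof (rule norm_bhol_le)
  fix x :: "complex ^ 'a" assume x: "x \<in> ball 0 1"
  have "norm (word_poly d (\<lambda>w. s w - t w) x) \<le> (\<Sum>w\<in>words d. norm (s w - t w)) * norm x ^ d"
    by (rule norm_word_poly_le)
  also have "\<dots> \<le> (\<Sum>w\<in>words d. norm (s w - t w)) * 1"
    using x by (intro mult_left_mono power_le_one sum_nonneg) auto
  finally show "norm (apply_bhol (bpoly d s - bpoly d t) x) \<le> (\<Sum>w\<in>words d. norm (s w - t w))"
    using x by (simp add: minus_bhol.rep_eq apply_bpoly[OF assms] word_poly_diff)
qed

lemma norm_bpoly_le: "2 \<le> d \<Longrightarrow> norm (bpoly d s) \<le> (\<Sum>w\<in>words d. norm (s w))"
proof -
  assume d: "2 \<le> d"
  have "bpoly d (\<lambda>w :: 'a list. 0) = 0"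
    by (rule bhol_eqI) (simp add: apply_bpoly[OF d] zero_bhol.rep_eq word_poly_def)
  with norm_bpoly_diff[OF d, of s "\<lambda>w. 0"] show ?thesis by simp
qed

context skew_base
begin

lemma continuous_dmul:
  fixes l :: "'a \<Rightarrow> complex ^ 'n::finite"
  assumes l: "continuous_on UNIV l" and u: "continuous_on UNIV u"
  shows "continuous_on UNIV (\<lambda>a. dmul (l a) (u a))"
proof (rule continuous_on_boundI)
  fix a b
  show "norm (dmul (l b) (u b) - dmul (l a) (u a)) \<le> norm (l b) * norm (u b - u a) + norm (l b - l a) * norm (u a)"
    unfolding dmul_diff_split by (rule order_trans[OF norm_triangle_ineq add_mono[OF norm_dmul_le norm_dmul_le]])
  have "(l \<longlongrightarrow> l a) (at a)" "(u \<longlongrightarrow> u a) (at a)"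
    using l u unfolding continuous_on_eq_continuous_at[OF open_UNIV] by (blast dest: isContD)+
  then have "((\<lambda>b. norm (l b) * norm (u b - u a) + norm (l b - l a) * norm (u a)) \<longlongrightarrow>
      norm (l a) * norm (u a - u a) + norm (l a - l a) * norm (u a)) (at a)"
    by (intro tendsto_intros)
  then show "((\<lambda>b. norm (l b) * norm (u b - u a) + norm (l b - l a) * norm (u a)) \<longlongrightarrow> 0) (at a)"
    by simp
qed

lemma diag_map_lower_bound:
  fixes l :: "complex ^ 'n::finite"
  assumes "\<And>i. c \<le> cmod (l $ i)" "0 \<le> c"
  shows "c * norm x \<le> norm (diag_map l x)"
proof -
  have "norm (c *\<^sub>R x) \<le> norm (diag_map l x)"
    by (rule norm_le_componentwise_cart)
      (simp add: diag_map_def norm_mult assms mult_right_mono)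
  then show ?thesis using assms(2) by simp
qed

text \<open>Multiplication by the multipliers is invertible with inverse bounded by 1 / c, and on
  \<open>flat N\<close> the composition term has norm at most \<rho>^N \<le> c / 2 by the Schwarz
  lemma. The perturbation factor is thus 1 / 2 and the new constant 2 / c.\<close>

lemma flat_solvable_top:
  fixes f :: "'a \<Rightarrow>\<^sub>C 'n::finite bhol"
  assumes f: "unif_within \<rho> f" and c: "0 < c" "\<And>a i. c \<le> cmod (mult f a $ i)"
    and N: "\<rho> ^ N \<le> c / 2"
  shows "solvable (flat N) (transfer f) (2 / c)"
proof -
  let ?l = "\<lambda>a. mult f a"
  define D where "D l u = Bcontfun (\<lambda>a. dmul (l a) (apply_bcontfun u a))"
    for l and u :: "'a \<Rightarrow>\<^sub>C 'n bhol"
  have D: "member (D l u) a x = diag_map (l a) (member u a x)" if "continuous_on UNIV l" for l u a x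
    using apply_Bcontfun[OF continuous_dmul[OF that continuous_on_apply_bcontfun]]
    by (simp add: D_def dmul.rep_eq)
  have D_flat: "D l u \<in> flat N" if "continuous_on UNIV l" "u \<in> flat N" for l u
    unfolding flat_def
  proof (intro CollectI allI)
    fix a
    have "vanishes N (\<lambda>x. diag_map (l a) (member u a x))"
      by (rule vanishes_linear[OF bounded_linear_diag_map]) (use that in \<open>simp add: flat_def\<close>)
    then show "vanishes N (member (D l u) a)"
      by (rule vanishes_cong[OF _ zero_less_one D[OF that(1)]])
  qed
  have l0: "?l a $ i \<noteq> 0" for a i using c(2)[of a i] c(1) by auto
  have lc: "continuous_on UNIV ?l"
    by (rule continuous_on_compose2[OF continuous_on_lam[of UNIV] continuous_on_apply_bcontfun]) simp
  have ic: "continuous_on UNIV (\<lambda>a. \<chi> i. inverse (?l a $ i))"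
    by (intro continuous_on_vec_lambda continuous_on_inverse continuous_lam_nth) (simp add: l0)
  have "solvable (flat N) (D ?l) (1 / c)"
    unfolding solvable_def
  proof (intro conjI ballI)
    show "0 \<le> 1 / c" using c by simp
    fix v :: "'a \<Rightarrow>\<^sub>C 'n bhol" assume v: "v \<in> flat N"
    show "\<exists>u\<in>flat N. D ?l u = v"
    proof (rule bexI[OF _ D_flat[OF ic v]], rule family_eqI)
      show "member (D ?l (D (\<lambda>a. \<chi> i. inverse (?l a $ i)) v)) a x = member v a x" for a x
        by (simp add: D[OF lc] D[OF ic]) (simp add: diag_map_def vec_eq_iff l0)
    qed
  next
    fix u :: "'a \<Rightarrow>\<^sub>C 'n bhol"
    show "norm u \<le> 1 / c * norm (D ?l u)"
    proof (rule norm_family_le)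
      fix a x
      have "c * norm (member u a x) \<le> norm (diag_map (?l a) (member u a x))"
        by (rule diag_map_lower_bound) (use c in auto)
      also have "\<dots> \<le> norm (D ?l u)" unfolding D[OF lc, symmetric] by (rule norm_member_le)
      finally show "norm (member u a x) \<le> 1 / c * norm (D ?l u)" using c by (simp add: field_simps)
    qed
  qed
  then have "solvable (flat N) (transfer f) (1 / c / (1 - 1 / 2))"
  proof (rule solvable_perturb[OF _ closed_flat flat_0 flat_diff])
    show "transfer f (u - v) = transfer f u - transfer f v" for u v by (rule transfer_diff[OF f])
    show "D ?l (u - v) = D ?l u - D ?l v" for u v
      by (rule family_eqI) (simp only: D[OF lc] member_diff diag_map_diff_right)
    show "1 / c * \<rho> ^ N \<le> 1 / 2" using N c by (simp add: field_simps)
    show "D ?l u \<in> flat N" if "u \<in> flat N" for u by (rule D_flat[OF lc that])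
    show "transfer f u \<in> flat N" if "u \<in> flat N" for u by (rule transfer_flat[OF f that])
    show "norm (transfer f u - D ?l u) \<le> \<rho> ^ N * norm u" if u: "u \<in> flat N" for u
    proof (rule norm_family_le)
      fix a and x :: "complex ^ 'n" assume x: "x \<in> ball 0 1"
      have fx: "member f a x \<in> ball 0 1" "norm (member f a x) \<le> \<rho>"
        using maps_within_ball[OF withinD(1,2)[OF f] x] withinD(1)[OF f, of a] x
        by (auto simp: maps_within_def)
      have "norm (member (transfer f u - D ?l u) a x) = norm (member u (\<sigma> a) (member f a x))"
        by (simp add: member_diff member_transfer[OF f] D[OF lc] del: minus_bcontfun.rep_eq)
      also have "\<dots> \<le> norm u * norm (member f a x) ^ N"
        using u fx(1) by (simp add: flat_iff)
      also have "\<dots> \<le> norm u * \<rho> ^ N"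
        using fx(2) by (intro mult_left_mono power_mono) auto
      finally show "norm (member (transfer f u - D ?l u) a x) \<le> \<rho> ^ N * norm u" by (simp add: mult.commute)
    qed
  qed simp_all
  then show ?thesis by simp
qed

text \<open>The differential is diagonal, so the components are independent scalar equations; each
  of them is hyperbolic by nonresonance.\<close>

lemma vector_cocycle:
  fixes f :: "'a \<Rightarrow>\<^sub>C 'n::finite bhol"
  assumes "nonresonant f" "2 \<le> length w"
  shows "\<exists>K\<ge>0.
    (\<forall>v :: 'a \<Rightarrow> complex ^ 'n. continuous_on UNIV v \<longrightarrow>
      (\<exists>s. continuous_on UNIV s \<and> (\<forall>a. diag_map (mult f a) (s a)
        - word_power (mult f a) w *\<^sub>C s (\<sigma> a) = v a))) \<and>
    (\<forall>(s :: 'a \<Rightarrow> complex ^ 'n) B. continuous_on UNIV s \<longrightarrow>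
      (\<forall>a. norm (diag_map (mult f a) (s a)
        - word_power (mult f a) w *\<^sub>C s (\<sigma> a)) \<le> B) \<longrightarrow>
      (\<forall>a. norm (s a) \<le> K * B))"
proof -
  let ?l = "\<lambda>a. mult f a"
  have "\<exists>K\<ge>0.
    (\<forall>v. continuous_on UNIV v \<longrightarrow>
      (\<exists>s. continuous_on UNIV s \<and> (\<forall>a. ?l a $ i * s a - word_power (?l a) w * s (\<sigma> a) = v a))) \<and>
    (\<forall>s B. continuous_on UNIV s \<longrightarrow> (\<forall>a. cmod (?l a $ i * s a - word_power (?l a) w * s (\<sigma> a)) \<le> B) \<longrightarrow>
      (\<forall>a. cmod (s a) \<le> K * B))" for i
    using assms by (intro hyperbolic_cocycle continuous_lam_nth continuous_word_power_lam)
      (auto simp: nonresonant_def)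
  then obtain K where K0: "\<And>i. K i \<ge> 0" and
    K1: "\<And>i v. continuous_on UNIV v \<Longrightarrow> \<exists>s. continuous_on UNIV s \<and>
      (\<forall>a. ?l a $ i * s a - word_power (?l a) w * s (\<sigma> a) = v a)" and
    K2: "\<And>i s B a. continuous_on UNIV s \<Longrightarrow>
      (\<And>a. cmod (?l a $ i * s a - word_power (?l a) w * s (\<sigma> a)) \<le> B) \<Longrightarrow> cmod (s a) \<le> K i * B"
    by metis
  have nth: "(diag_map (?l a) x - word_power (?l a) w *\<^sub>C y) $ i = ?l a $ i * x $ i - word_power (?l a) w * y $ i"
    for a x y i
    by (simp add: diag_map_def)
  show ?thesis
  proof (intro exI[of _ "\<Sum>i\<in>UNIV. K i"] conjI allI impI)
    show "0 \<le> (\<Sum>i\<in>UNIV. K i)" by (intro sum_nonneg K0)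
    fix v :: "'a \<Rightarrow> complex ^ 'n" assume v: "continuous_on UNIV v"
    have "\<exists>s. continuous_on UNIV s \<and> (\<forall>a. ?l a $ i * s a - word_power (?l a) w * s (\<sigma> a) = v a $ i)" for i
      by (intro K1 bounded_linear.continuous_on[OF bounded_linear_vec_nth] v)
    then obtain s where s: "\<And>i. continuous_on UNIV (s i)"
      "\<And>i a. ?l a $ i * s i a - word_power (?l a) w * s i (\<sigma> a) = v a $ i" by metis
    show "\<exists>s. continuous_on UNIV s \<and> (\<forall>a. diag_map (?l a) (s a) - word_power (?l a) w *\<^sub>C s (\<sigma> a) = v a)"
    proof (intro exI[of _ "\<lambda>a. \<chi> i. s i a"] conjI allI)
      show "continuous_on UNIV (\<lambda>a. \<chi> i. s i a)" by (intro continuous_on_vec_lambda s)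
      show "diag_map (?l a) (\<chi> i. s i a) - word_power (?l a) w *\<^sub>C (\<chi> i. s i (\<sigma> a)) = v a" for a
        unfolding vec_eq_iff nth by (simp add: s(2))
    qed
  next
    fix s :: "'a \<Rightarrow> complex ^ 'n" and B a
    assume s: "continuous_on UNIV s"
      and B: "\<forall>a. norm (diag_map (?l a) (s a) - word_power (?l a) w *\<^sub>C s (\<sigma> a)) \<le> B"
    have "norm (s a) \<le> (\<Sum>i\<in>UNIV. cmod (s a $ i))"
      unfolding norm_vec_def by (rule L2_set_le_sum) simp
    also have "\<dots> \<le> (\<Sum>i\<in>UNIV. K i * B)"
    proof (rule sum_mono, rule K2[of "\<lambda>a. s a $ _" _ B a])
      fix i
      show "continuous_on UNIV (\<lambda>a. s a $ i)"
        by (intro bounded_linear.continuous_on[OF bounded_linear_vec_nth] s)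
      show "cmod (?l a $ i * s a $ i - word_power (?l a) w * s (\<sigma> a) $ i) \<le> B" for a
        unfolding nth[symmetric] using B Finite_Cartesian_Product.norm_nth_le order_trans by blast
    qed
    finally show "norm (s a) \<le> (\<Sum>i\<in>UNIV. K i) * B" by (simp add: sum_distrib_right)
  qed
qed

definition poly_family :: "nat \<Rightarrow> ('n::finite list \<Rightarrow> 'a \<Rightarrow> complex ^ 'n) \<Rightarrow> ('a \<Rightarrow>\<^sub>C 'n bhol)" where
  "poly_family d s = Bcontfun (\<lambda>a. bpoly d (\<lambda>w. s w a))"

lemma apply_poly_family:
  fixes s :: "'n::finite list \<Rightarrow> 'a \<Rightarrow> complex ^ 'n"
  assumes d: "2 \<le> d" and s: "\<forall>w\<in>words d. continuous_on UNIV (s w)"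
  shows "apply_bcontfun (poly_family d s) a = bpoly d (\<lambda>w. s w a)"
proof -
  have "continuous_on UNIV (\<lambda>a. bpoly d (\<lambda>w. s w a))"
  proof (rule continuous_on_boundI)
    show "norm (bpoly d (\<lambda>w. s w b) - bpoly d (\<lambda>w. s w a)) \<le> (\<Sum>w\<in>words d. norm (s w b - s w a))" for a b
      by (rule norm_bpoly_diff[OF d])
    fix a
    have "((\<lambda>b. \<Sum>w\<in>words d. norm (s w b - s w a)) \<longlongrightarrow> (\<Sum>w\<in>(words d :: 'n list set). 0)) (at a)"
    proof (rule tendsto_sum)
      fix w :: "'n list" assume "w \<in> words d"
      then have "(s w \<longlongrightarrow> s w a) (at a)"
        using s unfolding continuous_on_eq_continuous_at[OF open_UNIV] by (blast dest: isContD)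
      then show "((\<lambda>b. norm (s w b - s w a)) \<longlongrightarrow> 0) (at a)"
        by (intro tendsto_norm_zero LIM_zero)
    qed
    then show "((\<lambda>b. \<Sum>w\<in>words d. norm (s w b - s w a)) \<longlongrightarrow> 0) (at a)" by simp
  qed
  then show ?thesis by (simp add: poly_family_def apply_Bcontfun)
qed

lemma poly_family_props:
  fixes s :: "'n::finite list \<Rightarrow> 'a \<Rightarrow> complex ^ 'n"
  assumes d: "2 \<le> d" and s: "\<forall>w\<in>words d. continuous_on UNIV (s w)"
  shows "x \<in> ball 0 1 \<Longrightarrow> member (poly_family d s) a x = word_poly d (\<lambda>w. s w a) x"
    and "poly_family d s \<in> flat d"
    and "(\<And>w a. w \<in> words d \<Longrightarrow> norm (s w a) \<le> B w) \<Longrightarrow> norm (poly_family d s) \<le> (\<Sum>w\<in>words d. B w)"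
proof -
  note ap = apply_poly_family[OF d s]
  show mem: "member (poly_family d s) a x = word_poly d (\<lambda>w. s w a) x" if "x \<in> ball 0 1" for a x
    using that by (simp add: ap apply_bpoly[OF d])
  show "poly_family d s \<in> flat d"
    unfolding flat_def
  proof (intro CollectI allI)
    fix a
    have eq: "member (poly_family d s) a x = word_poly d (\<lambda>w. s w a) x" if "norm x < 1" for x
      using that by (intro mem) simp
    show "vanishes d (member (poly_family d s) a)"
      by (rule vanishes_cong[OF vanishes_word_poly zero_less_one eq])
  qed
  show "norm (poly_family d s) \<le> (\<Sum>w\<in>words d. B w)" if "\<And>w a. w \<in> words d \<Longrightarrow> norm (s w a) \<le> B w"
  proof (rule norm_bound)
    fix a
    have "norm (bpoly d (\<lambda>w. s w a)) \<le> (\<Sum>w\<in>words d. norm (s w a))" by (rule norm_bpoly_le[OF d])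
    also have "\<dots> \<le> (\<Sum>w\<in>words d. B w)" by (intro sum_mono that)
    finally show "norm (apply_bcontfun (poly_family d s) a) \<le> (\<Sum>w\<in>words d. B w)" by (simp add: ap)
  qed
qed

lemma transfer_add: "unif_within \<rho> g \<Longrightarrow> transfer g (u + v) = transfer g u + transfer g v"
  by (rule family_eqI) (simp only: member_transfer member_add diag_map_add_right, simp)

text \<open>A polynomial family u0 built from cocycle solutions reproduces the leading part of v,
  and the rest of v lies one order higher, where the operator is already invertible. The a priori
  bound runs in the same way: the leading coefficients of u satisfy cocycle equations whose
  right-hand sides are coefficients of \<open>transfer f u\<close>.\<close>

lemma flat_solvable_step:
  fixes f :: "'a \<Rightarrow>\<^sub>C 'n::finite bhol"
  assumes f: "unif_within \<rho> f" and nr: "nonresonant f" and d: "2 \<le> d"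
    and K: "solvable (flat (Suc d)) (transfer f) K"
  shows "\<exists>K'. solvable (flat d) (transfer f) K'"
proof -
  let ?l = "\<lambda>a. mult f a"
  let ?eq = "\<lambda>w a (s :: 'a \<Rightarrow> complex ^ 'n). diag_map (?l a) (s a) - word_power (?l a) w *\<^sub>C s (\<sigma> a)"
  have K0: "0 \<le> K" and Ksol: "\<And>v. v \<in> flat (Suc d) \<Longrightarrow> \<exists>u\<in>flat (Suc d). transfer f u = v"
    and Kbd: "\<And>u. u \<in> flat (Suc d) \<Longrightarrow> norm u \<le> K * norm (transfer f u)"
    using K by (auto simp: solvable_def)
  have "\<exists>L\<ge>0.
    (\<forall>v :: 'a \<Rightarrow> complex ^ 'n. continuous_on UNIV v \<longrightarrow>
      (\<exists>s. continuous_on UNIV s \<and> (\<forall>a. ?eq w a s = v a))) \<and>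
    (\<forall>(s :: 'a \<Rightarrow> complex ^ 'n) B. continuous_on UNIV s \<longrightarrow>
      (\<forall>a. norm (?eq w a s) \<le> B) \<longrightarrow> (\<forall>a. norm (s a) \<le> L * B))" if "w \<in> words d" for w
    using that d by (intro vector_cocycle[OF nr]) (simp add: words_def)
  then obtain L where L0: "\<And>w. w \<in> words d \<Longrightarrow> 0 \<le> L w" and
    L1: "\<And>w v. w \<in> words d \<Longrightarrow> continuous_on UNIV v \<Longrightarrow>
      \<exists>s. continuous_on UNIV s \<and> (\<forall>a. ?eq w a s = v a)" and
    L2: "\<And>w s B a. w \<in> words d \<Longrightarrow> continuous_on UNIV s \<Longrightarrow> (\<And>a. norm (?eq w a s) \<le> B) \<Longrightarrow> norm (s a) \<le> L w * B"
    by metis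
  obtain C where C: "\<And>w. 0 \<le> C w"
    "\<And>w (u :: 'n bhol). norm (word_deriv w (apply_bhol u)) \<le> C w * norm u"
    using word_deriv_family_bound[where 'n = 'n] by metis
  \<comment> \<open>C w bounds a coefficient by the norm of the map and L w inverts its cocycle
    equation, so P bounds the leading part of u in terms of \<open>transfer f u\<close>.\<close>
  define P where "P = (\<Sum>w\<in>words d. L w * C w)"
  have P0: "0 \<le> P" unfolding P_def by (intro sum_nonneg mult_nonneg_nonneg L0 C)
  have fact1: "(1 / fact d :: real) \<le> 1" by (simp add: fact_ge_1)
  have scale: "(1 / fact d :: real) *\<^sub>R (y :: complex ^ 'n) = complex_of_real (1 / fact d) *\<^sub>C y" for y
    by (rule scaleC_of_real[symmetric])
  have remainder: "vanishes (Suc d) (\<lambda>x. member u a x - word_poly d (\<lambda>w. (1 / fact d) *\<^sub>R word_deriv w (member u a)) x)"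
    if u: "u \<in> flat d" for u a
  proof -
    have "vanishes (Suc d) (\<lambda>x. member u a x - (1 / fact d) *\<^sub>R taylor_part d (member u a) x)"
      using u by (intro vanishes_taylor_remainder[OF bhol_holomorphic zero_less_one]) (simp add: flat_def)
    then show ?thesis unfolding taylor_part_eq_word_poly word_poly_scaleR .
  qed
  have "solvable (flat d) (transfer f) (P + K * (1 + 2 * P))"
    unfolding solvable_def
  proof (intro conjI ballI)
    show "0 \<le> P + K * (1 + 2 * P)" using P0 K0 by simp
    fix v :: "'a \<Rightarrow>\<^sub>C 'n bhol" assume v: "v \<in> flat d"
    have "\<exists>s. continuous_on UNIV s \<and> (\<forall>a. ?eq w a s = word_deriv w (member v a))" if "w \<in> words d" for w
      by (rule L1[OF that continuous_word_deriv])
    then obtain s where s: "\<And>w. w \<in> words d \<Longrightarrow> continuous_on UNIV (s w)"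
      "\<And>w a. w \<in> words d \<Longrightarrow> ?eq w a (s w) = word_deriv w (member v a)" by metis
    \<comment> \<open>Summation over words counts each homogeneous part d! times, as in
      \<open>taylor_part\<close>.\<close>
    define t where "t w a = (1 / fact d) *\<^sub>R s w a" for w a
    have t: "\<forall>w\<in>words d. continuous_on UNIV (t w)"
      unfolding t_def using s(1) by (auto intro!: continuous_intros)
    have teq: "?eq w a (t w) = (1 / fact d) *\<^sub>R word_deriv w (member v a)" if "w \<in> words d" for w a
      unfolding t_def s(2)[OF that, symmetric] scale
      by (simp only: diag_map_scaleC scaleC_scaleC mult.commute
          scaleC_diff_right)
    define u0 where "u0 = poly_family d t"
    note u0 = poly_family_props[OF d t, folded u0_def]
    have "v - transfer f u0 \<in> flat (Suc d)"
      unfolding flat_def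
    proof (intro CollectI allI)
      fix a
      let ?r = "\<lambda>x. member v a x - word_poly d (\<lambda>w. (1 / fact d) *\<^sub>R word_deriv w (member v a)) x"
      \<comment> \<open>The defect v - transfer f u0 is the sum of the Taylor remainder ?r of v and
        the error ?c of replacing f by its linear part in u0; both vanish to order d + 1.\<close>
      let ?c = "\<lambda>x. member u0 (\<sigma> a) (member f a x) - member u0 (\<sigma> a) (diag_map (?l a) x)"
      have "vanishes (Suc d) ?c"
      proof (rule vanishes_conjugate[OF bhol_holomorphic _ bhol_holomorphic _ bhol_zero
            bhol_frechet_derivative_0 diag_lam_contracts[OF f]])
        show "vanishes d (member u0 (\<sigma> a))" using u0(2) by (simp add: flat_def)
        show "norm (member f a x) \<le> 1" if "x \<in> ball 0 1" for x
          using maps_within_ball[OF withinD(1,2)[OF f] that, of a] by simp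
      qed
      from vanishes_add[OF remainder[OF v, of a] this]
      show "vanishes (Suc d) (member (v - transfer f u0) a)"
      proof (rule vanishes_cong[OF _ zero_less_one])
        fix x :: "complex ^ 'n" assume "norm x < 1"
        then have x: "x \<in> ball 0 1" by simp
        have lx: "diag_map (?l a) x \<in> ball 0 1"
          using diag_lam_contracts[OF f, of a x] x by (auto intro: order_le_less_trans)
        have "diag_map (?l a) (member u0 a x) - member u0 (\<sigma> a) (diag_map (?l a) x)
            = word_poly d (\<lambda>w. ?eq w a (t w)) x"
          unfolding u0(1)[OF x] u0(1)[OF lx] word_poly_diag
            word_poly_linear[OF bounded_linear_diag_map diag_map_scaleC] word_poly_diff ..
        also have "\<dots> = word_poly d (\<lambda>w. (1 / fact d) *\<^sub>R word_deriv w (member v a)) x"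
          by (rule word_poly_cong) (rule teq)
        finally show "member (v - transfer f u0) a x = ?r x + ?c x"
          unfolding member_diff member_transfer[OF f] by (simp add: algebra_simps)
      qed
    qed
    then obtain u1 where u1: "u1 \<in> flat (Suc d)" "transfer f u1 = v - transfer f u0"
      using Ksol by blast
    show "\<exists>u\<in>flat d. transfer f u = v"
    proof
      show "u0 + u1 \<in> flat d" by (rule flat_add[OF u0(2) flat_Suc[OF u1(1)]])
      show "transfer f (u0 + u1) = v" by (simp add: transfer_add[OF f] u1(2))
    qed
  next
    fix u :: "'a \<Rightarrow>\<^sub>C 'n bhol" assume u: "u \<in> flat d"
    let ?m = "norm (transfer f u)"
    define t where "t w a = (1 / fact d) *\<^sub>R word_deriv w (member u a)" for w a
    have t: "\<forall>w\<in>words d. continuous_on UNIV (t w)"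
      unfolding t_def by (intro ballI continuous_intros continuous_word_deriv)
    define u0 where "u0 = poly_family d t"
    note u0 = poly_family_props[OF d t, folded u0_def]
    have "norm (word_deriv w (member u a)) \<le> L w * (C w * ?m)" if w: "w \<in> words d" for w a
    proof (rule L2[OF w continuous_word_deriv])
      fix a
      have "norm (word_deriv w (member (transfer f u) a)) \<le> C w * norm (apply_bcontfun (transfer f u) a)"
        by (rule C)
      also have "\<dots> \<le> C w * ?m" by (intro mult_left_mono norm_bounded C)
      finally show "norm (?eq w a (\<lambda>a. word_deriv w (member u a))) \<le> C w * ?m"
        using w by (subst (asm) word_deriv_transfer[OF f u]) (simp_all add: words_def)
    qed
    then have tb: "norm (t w a) \<le> L w * C w * ?m" if "w \<in> words d" for w a
      unfolding t_def norm_scaleR using fact1 that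
      by (intro order_trans[OF mult_left_le_one_le]) (auto simp: mult.assoc)
    have nu0: "norm u0 \<le> P * ?m"
      using u0(3)[OF tb] by (simp add: P_def sum_distrib_right)
    have "u - u0 \<in> flat (Suc d)"
      unfolding flat_def
    proof (intro CollectI allI)
      fix a
      show "vanishes (Suc d) (member (u - u0) a)"
        using remainder[OF u, of a]
      proof (rule vanishes_cong[OF _ zero_less_one])
        fix x :: "complex ^ 'n" assume "norm x < 1"
        then have x: "x \<in> ball 0 1" by simp
        show "member (u - u0) a x = member u a x - word_poly d (\<lambda>w. (1 / fact d) *\<^sub>R word_deriv w (member u a)) x"
          unfolding member_diff u0(1)[OF x] t_def ..
      qed
    qed
    then have "norm (u - u0) \<le> K * norm (transfer f (u - u0))" by (rule Kbd)
    \<comment> \<open>The transfer operator has norm at most 2. Together with \<open>norm u0\<close>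
      at most P ?m this explains the constant P + K (1 + 2 P).\<close>
    also have "norm (transfer f (u - u0)) \<le> ?m + 2 * (P * ?m)"
      unfolding transfer_diff[OF f] using norm_transfer_le[OF f, of u0] nu0
      by (intro order_trans[OF norm_triangle_ineq4]) simp
    finally have "norm (u - u0) \<le> K * (?m + 2 * (P * ?m))"
      using K0 by (simp add: mult_left_mono)
    then show "norm u \<le> (P + K * (1 + 2 * P)) * ?m"
      using nu0 norm_triangle_sub[of u u0] by (simp add: algebra_simps)
  qed
  then show ?thesis by blast
qed

lemma flat_solvable:
  fixes f :: "'a \<Rightarrow>\<^sub>C 'n::finite bhol"
  assumes f: "unif_within \<rho> f" and nr: "nonresonant f"
    and c: "0 < c" "\<And>a i. c \<le> cmod (mult f a $ i)"
  shows "\<exists>K. solvable (flat 2) (transfer f) K"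
proof -
  obtain N where "\<rho> ^ N < c / 2"
    using real_arch_pow_inv[of "c / 2" \<rho>] c withinD(2)[OF f] by auto
  \<comment> \<open>Raising the exponent by 2 ensures that the descent starts at an order not below
    2.\<close>
  moreover have "\<rho> ^ (N + 2) \<le> \<rho> ^ N"
    using withinD[OF f] by (intro power_decreasing) auto
  ultimately have "\<rho> ^ (N + 2) \<le> c / 2" by linarith
  from flat_solvable_top[OF f c this]
  have top: "\<exists>K. solvable (flat (N + 2)) (transfer f) K" by blast
  have "2 \<le> N + 2" by simp
  then show ?thesis
  proof (induction rule: inc_induct)
    case base
    show ?case by (rule top)
  next
    case (step d)
    then show ?case using flat_solvable_step[OF f nr] by blast
  qed
qed

end

section \<open>Biholomorphic maps\<close>

text \<open>Differentiating g (f x) = x gives a left inverse of the differential of f.\<close>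

lemma biholomorphic_into_injective:
  fixes f :: "complex ^ 'n::finite \<Rightarrow> complex ^ 'n"
  assumes "biholomorphic_into f S T"
  shows "inj_on f S" and "x \<in> S \<Longrightarrow> fd f x v = 0 \<Longrightarrow> v = 0"
proof -
  obtain g where f: "holomorphic_map_on f S" and g: "holomorphic_map_on g (f ` S)" "\<And>x. x \<in> S \<Longrightarrow> g (f x) = x"
    using assms by (auto simp: biholomorphic_into_def)
  show "inj_on f S" using g(2) by (metis inj_onI)
  assume x: "x \<in> S" and v: "fd f x v = 0"
  have S: "open S" using f by (simp add: holomorphic_map_on_def)
  have id: "holomorphic_map_on (\<lambda>x. x) S"
    by (rule hol_linear) (simp_all add: S bounded_linear_ident)
  have "fd (\<lambda>x. g (f x)) x = fd (\<lambda>x. x) x"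
    by (rule hol_cong(2)[OF id g(2) x])
  then have "fd g (f x) (fd f x v) = v"
    using hol_compose(2)[OF g(1) f _ x, of v] by (simp add: fd_eqI[OF has_derivative_ident])
  moreover have "linear (fd g (f x))"
    using hol_fd(1)[OF g(1)] x has_derivative_linear by blast
  ultimately show "v = 0" using v by (simp add: linear_0)
qed

text \<open>Domain and target have equal dimension: invariance of domain makes the image open, and
  an injective differential is invertible, so the inverse is differentiable. Its derivative is
  complex-linear because it inverts a complex-linear map.\<close>

lemma biholomorphic_intoI:
  fixes u :: "complex ^ 'n::finite \<Rightarrow> complex ^ 'n"
  assumes u: "holomorphic_map_on u S" and inj: "inj_on u S"
    and der: "\<And>x v. x \<in> S \<Longrightarrow> fd u x v = 0 \<Longrightarrow> v = 0"
  shows "biholomorphic_into u S UNIV"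
proof -
  define g where "g = inv_into S u"
  have g: "g (u x) = x" if "x \<in> S" for x
    using inj that by (simp add: g_def)
  have S: "open S" using u by (simp add: holomorphic_map_on_def)
  note cont = hol_continuous[OF u]
  have "holomorphic_map_on g (u ` S)"
    unfolding holomorphic_map_on_def
  proof (intro conjI ballI)
    show "open (u ` S)" by (rule invariance_of_domain[OF cont S inj])
    fix y assume "y \<in> u ` S"
    then obtain x where x: "x \<in> S" "y = u x" by blast
    let ?D = "fd u x"
    note D = hol_fd[OF u x(1)]
    have lin: "linear ?D" by (rule has_derivative_linear[OF D(1)])
    have injD: "inj ?D" using der[OF x(1)] lin by (simp add: linear_injective_0)
    obtain E where E: "linear E" "\<And>z. E (?D z) = z" "\<And>z. ?D (E z) = z"
      using linear_injective_isomorphism[OF lin injD] by blast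
    have "(g has_derivative E) (at (u x))"
      by (rule has_derivative_inverse_strong[OF S x(1) cont g D(1)]) (auto simp: fun_eq_iff E)
    moreover have "E (c *\<^sub>C v) = c *\<^sub>C E v" for c v
    proof -
      have "?D (c *\<^sub>C E v) = ?D (E (c *\<^sub>C v))" by (simp add: D(2) E)
      then show ?thesis using injD by (simp add: inj_eq)
    qed
    ultimately show "\<exists>E. (g has_derivative E) (at y) \<and> (\<forall>c v. E (c *\<^sub>C v) = c *\<^sub>C E v)"
      using x by blast
  qed
  then show ?thesis unfolding biholomorphic_into_def using u g by blast
qed

section \<open>Consequences of the hypotheses\<close>

text \<open>The mean value inequality along the ray from 0 evaluates the differential at a single
  intermediate point, where its norm is strictly below 1; strictness therefore survives without a
  uniform bound.\<close>

lemma contracting_norm_less: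
  fixes f :: "complex ^ 'n::finite \<Rightarrow> complex ^ 'n"
  assumes hol: "holomorphic_map_on f (ball 0 1)" and con: "contracting f" and 0: "f 0 = 0"
    and x: "x \<in> ball 0 1" "x \<noteq> 0"
  shows "norm (f x) < norm x"
proof -
  have dom: "t *\<^sub>R x \<in> ball 0 1" if "0 \<le> t" "t \<le> 1" for t
  proof -
    have "t * norm x \<le> 1 * norm x" using that by (intro mult_right_mono) auto
    then show ?thesis using x(1) that by simp
  qed
  let ?g' = "\<lambda>t s. s *\<^sub>R fd f (t *\<^sub>R x) x"
  note der = ray_has_derivative[OF hol dom]
  have "\<exists>t\<in>{0<..<1}. norm (f (1 *\<^sub>R x) - f (0 *\<^sub>R x)) \<le> norm (?g' t (1 - 0))"
  proof (rule mvt_general)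
    show "continuous_on {0..1} (\<lambda>t. f (t *\<^sub>R x))"
      by (intro continuous_at_imp_continuous_on ballI has_derivative_continuous[OF der]) auto
  qed (use der in auto)
  then obtain t where "t \<in> {0<..<1}" "norm (f x) \<le> norm (fd f (t *\<^sub>R x) x)"
    using 0 by auto
  then have t: "0 \<le> t" "t \<le> 1" "norm (f x) \<le> norm (fd f (t *\<^sub>R x) x)"
    by auto
  have "norm (fd f (t *\<^sub>R x) x) \<le> onorm (fd f (t *\<^sub>R x)) * norm x"
    by (intro onorm has_derivative_bounded_linear[OF hol_fd(1)[OF hol]] dom t)
  also have "\<dots> < 1 * norm x"
    using con dom[OF t(1,2)] x(2) by (intro mult_strict_right_mono) (auto simp: contracting_def)
  finally show ?thesis using t(3) by simp
qed

lemma contracting_lipschitz: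
  fixes f :: "complex ^ 'n::finite \<Rightarrow> complex ^ 'n"
  assumes hol: "holomorphic_map_on f (ball 0 1)" and con: "contracting f"
    and xy: "x \<in> ball 0 1" "y \<in> ball 0 1"
  shows "norm (f x - f y) \<le> norm (x - y)"
proof -
  have "norm (f x - f y) \<le> 1 * norm (x - y)"
  proof (rule differentiable_bound[OF convex_ball _ _ xy])
    fix z :: "complex ^ 'n" assume z: "z \<in> ball 0 1"
    show "(f has_derivative fd f z) (at z within ball 0 1)"
      by (rule has_derivative_at_withinI[OF hol_fd(1)[OF hol z]])
    show "onorm (fd f z) \<le> 1"
      using con z by (auto simp: contracting_def intro: less_imp_le)
  qed
  then show ?thesis by simp
qed

context skew_base
begin

text \<open>The sup norm controls the change in the base variable uniformly in x, which leaves the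
  continuity of one member.\<close>

lemma continuous_on_eval:
  fixes f :: "'a \<Rightarrow>\<^sub>C 'n::finite bhol"
  assumes S: "S \<subseteq> ball 0 1"
  shows "continuous_on (UNIV \<times> S) (\<lambda>p. member f (fst p) (snd p))"
  unfolding continuous_on
proof (intro ballI)
  fix p assume p: "p \<in> (UNIV :: 'a set) \<times> S"
  let ?F = "at p within UNIV \<times> S"
  let ?d = "\<lambda>q. member f (fst q) (snd q) - member f (fst p) (snd q)"
  have "continuous_on (UNIV \<times> S) (\<lambda>q. apply_bcontfun f (fst q))"
    by (rule continuous_on_compose2[OF continuous_on_apply_bcontfun[of UNIV f] continuous_on_fst])
      (auto intro: continuous_intros)
  then have "((\<lambda>q. apply_bcontfun f (fst q)) \<longlongrightarrow> apply_bcontfun f (fst p)) ?F"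
    using p unfolding continuous_on by blast
  then have A: "((\<lambda>q. norm (apply_bcontfun f (fst q) - apply_bcontfun f (fst p))) \<longlongrightarrow> 0) ?F"
    by (intro tendsto_norm_zero LIM_zero)
  have B: "norm (?d q) \<le> norm (apply_bcontfun f (fst q) - apply_bcontfun f (fst p))" for q
    using norm_apply_bhol_le'[of "apply_bcontfun f (fst q) - apply_bcontfun f (fst p)" "snd q"]
    by (simp add: minus_bhol.rep_eq)
  have 1: "(?d \<longlongrightarrow> 0) ?F"
    by (rule Lim_null_comparison[OF always_eventually A]) (use B in blast)
  have "continuous_on (UNIV \<times> S) (\<lambda>q. member f (fst p) (snd q))"
    using S by (intro continuous_on_compose2[OF hol_continuous[OF bhol_holomorphic]])
      (auto intro: continuous_intros)
  then have 2: "((\<lambda>q. member f (fst p) (snd q)) \<longlongrightarrow> member f (fst p) (snd p)) ?F"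
    using p unfolding continuous_on by blast
  from tendsto_add[OF 1 2]
  show "((\<lambda>q. member f (fst q) (snd q)) \<longlongrightarrow> member f (fst p) (snd p)) ?F" by simp
qed

text \<open>Contraction is only pointwise and may degenerate at the boundary of the ball.
  Compactness is applied on the sphere of radius 1 / 2 instead, giving a maximum m < 1 / 2 over all
  members; from there outwards every member is 1-Lipschitz and adds less than 1 / 2.\<close>

lemma H1_unif_within:
  fixes f :: "'a \<Rightarrow>\<^sub>C 'n::finite bhol"
  assumes "H1 f"
  shows "\<exists>\<rho>. unif_within \<rho> f"
proof -
  have con: "contracting (member f a)" for a using assms by (simp add: H1_def)
  note less = contracting_norm_less[OF bhol_holomorphic con bhol_zero]
  define S where "S = sphere (0 :: complex ^ 'n) (1 / 2)"
  obtain y :: "complex ^ 'n" where "norm y = 1 / 2" using vector_choose_size[of "1 / 2"] by auto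
  then have S: "S \<subseteq> ball 0 1" "compact S" "S \<noteq> {}" by (auto simp: S_def)
  have "compact ((UNIV :: 'a set) \<times> S)" "(UNIV :: 'a set) \<times> S \<noteq> {}"
    using compact_Times[OF compact_base S(2)] S(3) by auto
  from continuous_attains_sup[OF this continuous_on_norm[OF continuous_on_eval[OF S(1), of f]]]
  obtain p where p': "p \<in> UNIV \<times> S"
    "\<forall>q\<in>UNIV \<times> S. norm (member f (fst q) (snd q)) \<le> norm (member f (fst p) (snd p))"
    by blast
  have p: "snd p \<in> S" using p'(1) by auto
  have pmax: "norm (member f a x) \<le> norm (member f (fst p) (snd p))" if "x \<in> S" for a x
    using p'(2)[rule_format, of "(a, x)"] that by simp
  define m where "m = norm (member f (fst p) (snd p))"
  have "m < norm (snd p)"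
    unfolding m_def using p S(1) by (intro less) (auto simp: S_def)
  then have m: "0 \<le> m" "m < 1 / 2" using p by (auto simp: S_def m_def)
  have "norm (member f a x) \<le> 1 / 2 + m" if x: "x \<in> ball 0 1" for a x
  proof (cases "norm x \<le> 1 / 2")
    case True
    have "norm (member f a x) \<le> norm x"
      using less[OF x, of a] by (cases "x = 0") auto
    then show ?thesis using True m by linarith
  next
    case False
    \<comment> \<open>The radial projection of x to the sphere of radius 1 / 2, at distance norm x -
      1 / 2 from x.\<close>
    define y where "y = (1 / (2 * norm x)) *\<^sub>R x"
    have x0: "norm x > 0" using False by linarith
    have y: "y \<in> S" "norm (x - y) = norm x - 1 / 2"
    proof -
      show "y \<in> S" using x0 by (simp add: S_def y_def)
      have "x - y = (1 - 1 / (2 * norm x)) *\<^sub>R x" by (simp add: y_def algebra_simps)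
      moreover have "0 \<le> 1 - 1 / (2 * norm x)" using False x0 by (auto simp: divide_le_eq_1)
      ultimately have "norm (x - y) = (1 - 1 / (2 * norm x)) * norm x" by simp
      then show "norm (x - y) = norm x - 1 / 2" using x0 by (simp add: field_simps)
    qed
    have "norm (member f a x - member f a y) \<le> norm (x - y)"
      using y S(1) by (intro contracting_lipschitz[OF bhol_holomorphic con x]) auto
    moreover have "norm (member f a y) \<le> m" using pmax[OF y(1)] by (simp add: m_def)
    ultimately show ?thesis
      using norm_triangle_sub[of "member f a x" "member f a y"] y(2) x by simp
  qed
  then show ?thesis
    using m by (intro exI[of _ "1 / 2 + m"]) (simp add: unif_within_def maps_within_def)
qed

text \<open>A zero multiplier would put a coordinate axis into the kernel of the differential at 0,
  contrary to biholomorphy.\<close>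

lemma H1_lam_nonzero:
  fixes f :: "'a \<Rightarrow>\<^sub>C 'n::finite bhol"
  assumes "H1 f"
  shows "mult f a $ i \<noteq> 0"
proof
  assume 0: "mult f a $ i = 0"
  have "biholomorphic_into (member f a) (ball 0 1) (ball 0 1)"
    using assms by (simp add: H1_def)
  from biholomorphic_into_injective(2)[OF this, of 0 "axis i 1"]
  show False by (simp add: bhol_frechet_derivative_0 diag_map_axis 0)
qed

lemma H1_lam_lower_bound:
  fixes f :: "'a \<Rightarrow>\<^sub>C 'n::finite bhol"
  assumes "H1 f"
  shows "\<exists>c>0. \<forall>a i. c \<le> cmod (mult f a $ i)"
proof -
  have "\<exists>c>0. \<forall>a. c \<le> cmod (mult f a $ i)" for i
  proof -
    obtain b where "\<And>a. cmod (mult f b $ i) \<le> cmod (mult f a $ i)"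
      using compact_min[OF continuous_on_norm[OF continuous_lam_nth[of UNIV f i]]] by blast
    then show ?thesis using H1_lam_nonzero[OF assms, of b i]
      by (intro exI[of _ "cmod (mult f b $ i)"]) simp
  qed
  then obtain c where c: "\<And>i. 0 < c i" "\<And>a i. c i \<le> cmod (mult f a $ i)"
    by metis
  have "Min (range c) \<le> cmod (mult f a $ i)" for a i
    by (rule order_trans[OF _ c(2)]) simp
  then show ?thesis using c(1) by (intro exI[of _ "Min (range c)"]) simp
qed

lemma word_power_count: "word_power x w = (\<Prod>j\<in>UNIV. x $ j ^ count_list w j)"
proof (induction w)
  case (Cons i w)
  have "(\<Prod>j\<in>UNIV. x $ j ^ count_list (i # w) j)
      = (\<Prod>j\<in>UNIV. (if i = j then x $ j else 1) * x $ j ^ count_list w j)"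
    by (rule prod.cong) auto
  then show ?case by (simp add: prod.distrib Cons.IH)
qed simp

text \<open>The multi-index of a word counts its letters. Since the sign of the difference is
  constant, its value at one base point decides the alternative for all of them.\<close>

lemma H3_nonresonant:
  fixes f :: "'a \<Rightarrow>\<^sub>C 'n::finite bhol"
  assumes "H3 f"
  shows "nonresonant f"
  unfolding nonresonant_def
proof (intro allI impI)
  fix w :: "'n list" and i assume w: "2 \<le> length w"
  define \<delta> where "\<delta> a = cmod (mult f a $ i) - cmod (word_power (mult f a) w)" for a
  have "(\<Sum>j\<in>UNIV. count_list w j) = length w"
    using sum_count_set[of w UNIV] by simp
  then have "(\<Sum>j\<in>UNIV. count_list w j) \<noteq> 1" using w by simp
  then have \<delta>: "\<And>a. \<delta> a \<noteq> 0" "\<And>a b. sgn (\<delta> a) = sgn (\<delta> b)"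
    using assms unfolding H3_def Let_def \<delta>_def word_power_count by blast+
  obtain a0 :: 'a where True by blast
  show "(\<forall>a. cmod (word_power (mult f a) w) < cmod (mult f a $ i)) \<or>
    (\<forall>a. cmod (mult f a $ i) < cmod (word_power (mult f a) w))"
  proof (cases "\<delta> a0 > 0")
    case True
    have "\<delta> a > 0" for a using True \<delta>(2)[of a a0] by (simp add: sgn_1_pos)
    then show ?thesis by (simp add: \<delta>_def)
  next
    case False
    then have "\<delta> a0 < 0" using \<delta>(1)[of a0] by simp
    then have "\<delta> a < 0" for a using \<delta>(2)[of a a0] by (simp add: sgn_1_neg)
    then show ?thesis by (simp add: \<delta>_def)
  qed
qed

section \<open>The identity family and families tangent to it\<close>

definition ident_bhol :: "'n::finite bhol" where
  "ident_bhol = Bhol (\<lambda>x. if x \<in> ball 0 1 then x else 0)"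

lemma apply_ident_bhol: "apply_bhol (ident_bhol :: 'n::finite bhol) = (\<lambda>x. if x \<in> ball 0 1 then x else 0)"
  and lam_ident_bhol: "lam (ident_bhol :: 'n bhol) = 1"
proof -
  let ?p = "\<lambda>x :: complex ^ 'n. if x \<in> ball 0 1 then x else 0"
  have id: "holomorphic_map_on (\<lambda>x :: complex ^ 'n. x) (ball 0 1)"
    by (rule hol_linear) (simp_all add: bounded_linear_ident)
  have eq: "?p x = x" if "x \<in> ball 0 1" for x using that by simp
  have fd: "fd ?p 0 = (\<lambda>x. x)"
    using hol_cong(2)[OF id eq, of 0] fd_eqI[OF has_derivative_ident, of 0]
    by simp
  have "?p \<in> bounded_hol_maps"
  proof (rule bounded_hol_mapsI[OF hol_cong(1)[OF id eq], where B = 1])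
    show "fd ?p 0 (axis j 1) $ i = 0" if "i \<noteq> j" for i j
      unfolding fd using that by (simp add: axis_def)
  qed simp_all
  then show ap: "apply_bhol (ident_bhol :: 'n bhol) = ?p"
    by (simp add: ident_bhol_def Bhol_inverse)
  show "lam (ident_bhol :: 'n bhol) = 1"
    by (rule frechet_derivative_lam, unfold ap fd) (simp add: diag_map_def fun_eq_iff vec_eq_iff)
qed

definition ident_family :: "'a \<Rightarrow>\<^sub>C 'n::finite bhol" where
  "ident_family = const_bcontfun ident_bhol"

lemma member_ident_family: "x \<in> ball 0 1 \<Longrightarrow> member ident_family a x = x"
  by (simp add: ident_family_def const_bcontfun.rep_eq apply_ident_bhol)

lemma norm_ident_family_le: "norm (ident_family :: 'a \<Rightarrow>\<^sub>C 'n::finite bhol) \<le> 1"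
  by (rule norm_family_le) (simp add: member_ident_family)

lemma flat2_iff: "u \<in> flat 2 \<longleftrightarrow> (\<forall>a. mult u a = 0)"
  for u :: "'a \<Rightarrow>\<^sub>C 'n::finite bhol"
  using lam_vanishing vanishes_bhol by (auto simp: flat_def)

lemma tangent_identity_iff:
  fixes h :: "'a \<Rightarrow>\<^sub>C 'n::finite bhol"
  shows "h - ident_family \<in> flat 2 \<longleftrightarrow> (\<forall>a. fd (member h a) 0 = id)"
proof -
  have "diag_map (lam u) = id \<longleftrightarrow> lam u = 1" for u :: "'n bhol"
  proof
    assume "diag_map (lam u) = id"
    then have "diag_map (lam u) (axis i 1) $ i = id (axis i 1) $ i" for i by simp
    then show "lam u = 1" by (simp add: diag_map_axis vec_eq_iff)
  qed (simp add: diag_map_def fun_eq_iff vec_eq_iff)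
  then show ?thesis
    by (simp add: flat2_iff bhol_frechet_derivative_0 ident_family_def const_bcontfun.rep_eq lam_diff
        lam_ident_bhol)
qed

text \<open>The image of the identity is \<Lambda>_a x - f_a(x), a second-order quantity. Hence the
  right-hand side of the equation for h - id lies in the space where the operator is
  inverted.\<close>

lemma transfer_ident_flat:
  fixes g :: "'a \<Rightarrow>\<^sub>C 'n::finite bhol"
  assumes g: "unif_within \<rho> g"
  shows "transfer g ident_family \<in> flat 2"
  unfolding flat_def
proof (intro CollectI allI)
  fix a
  show "vanishes 2 (member (transfer g ident_family) a)"
  proof (rule vanishesI[OF zero_less_one])
    fix x :: "complex ^ 'n" assume "norm x < 1"
    then have x: "x \<in> ball 0 1" by simp
    have "member (transfer g ident_family) a x = diag_map (mult g a) x - member g a x"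
      using maps_within_ball[OF withinD(1,2)[OF g] x, of a] x
      by (simp add: member_transfer[OF g] member_ident_family)
    then show "norm (member (transfer g ident_family) a x) \<le> 3 * norm (apply_bcontfun g a) * norm x ^ 2"
      using second_order_contact[OF bhol_holomorphic norm_apply_bhol_le _ bhol_frechet_derivative_0 x, of "apply_bcontfun g a"]
      by (simp add: norm_minus_commute)
  qed
qed

lemma transfer_tangent_flat:
  fixes g h :: "'a \<Rightarrow>\<^sub>C 'n::finite bhol"
  assumes g: "unif_within \<rho> g" and h: "h - ident_family \<in> flat 2"
  shows "transfer g h \<in> flat 2"
  using flat_add[OF transfer_flat[OF g h] transfer_ident_flat[OF g]] by (simp add: transfer_diff[OF g])

lemma transfer_eq_0_iff:
  fixes g h :: "'a \<Rightarrow>\<^sub>C 'n::finite bhol"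
  assumes g: "unif_within \<rho> g"
  shows "transfer g h = 0 \<longleftrightarrow> (\<forall>a. \<forall>x\<in>ball 0 1. member h (\<sigma> a) (member g a x)
    = fd (member g a) 0 (member h a x))"
proof
  assume 0: "transfer g h = 0"
  show "\<forall>a. \<forall>x\<in>ball 0 1. member h (\<sigma> a) (member g a x)
    = fd (member g a) 0 (member h a x)"
  proof (intro allI ballI)
    fix a x
    have "member (transfer g h) a x = 0" unfolding 0 by (rule member_0)
    then show "member h (\<sigma> a) (member g a x) = fd (member g a) 0 (member h a x)"
      by (simp add: member_transfer[OF g] bhol_frechet_derivative_0)
  qed
next
  assume "\<forall>a. \<forall>x\<in>ball 0 1. member h (\<sigma> a) (member g a x)
    = fd (member g a) 0 (member h a x)"
  then show "transfer g h = 0"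
    by (intro family_eqI) (simp add: member_transfer[OF g] bhol_frechet_derivative_0 zero_bhol.rep_eq)
qed

text \<open>Near the origin \<open>h\<close> is a Lipschitz perturbation of the identity; the conjugacy carries injectivity
  from \<open>h\<close> near the origin to the whole ball.\<close>

lemma conjugacy_biholomorphic:
  fixes g h :: "'a \<Rightarrow>\<^sub>C 'n::finite bhol"
  assumes g: "unif_within \<rho> g" and h: "h - ident_family \<in> flat 2" and conj: "transfer g h = 0"
    and gi: "\<And>a. inj_on (member g a) (ball 0 1)"
    and gd: "\<And>a x v. x \<in> ball 0 1 \<Longrightarrow> fd (member g a) x v = 0 \<Longrightarrow> v = 0"
  shows "biholomorphic_into (member h a) (ball 0 1) UNIV"
proof -
  define u where "u = h - ident_family"
  define M where "M = norm u"
  \<comment> \<open>Chosen so that 2 s < 1 and M (2 s)^2 / s = 4 M s \<le> 1 / 2: on the ball of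
    radius s the map h - id then has Lipschitz constant at most 1 / 2.\<close>
  define s where "s = 1 / (8 * (M + 1))"
  have M0: "0 \<le> M" by (simp add: M_def)
  have s0: "0 < s" using M0 by (simp add: s_def)
  have s1: "2 * s < 1" using M0 by (simp add: s_def field_simps)
  have Ms: "M * (2 * s)\<^sup>2 / s \<le> 1 / 2"
  proof -
    have "M * (2 * s)\<^sup>2 / s = 4 * M * s" using s0 by (simp add: power2_eq_square)
    also have "\<dots> \<le> 1 / 2" using M0 by (simp add: s_def field_simps)
    finally show ?thesis .
  qed
  have ub: "norm (member u a x) \<le> M * (2 * s)\<^sup>2" if "x \<in> ball 0 (2 * s)" for a x
  proof -
    have "norm (member u a x) \<le> M * norm x ^ 2"
      using h that s1 by (simp add: u_def M_def flat_iff)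
    also have "\<dots> \<le> M * (2 * s)\<^sup>2"
      using that M0 by (intro mult_left_mono power_mono) auto
    finally show ?thesis .
  qed
  have uhol: "holomorphic_map_on (member u a) (ball 0 (2 * s))" for a
    using s1 by (intro hol_subset[OF bhol_holomorphic]) auto
  have hu: "member h a x = x + member u a x" if "x \<in> ball 0 1" for a x
    unfolding u_def member_diff member_ident_family[OF that] by simp
  note fd = hol_fd[OF bhol_holomorphic]
  have eqn: "member h (\<sigma> a) (member g a x) = diag_map (mult g a) (member h a x)"
    if "x \<in> ball 0 1" for a x
    using conj that unfolding transfer_eq_0_iff[OF g] by (simp add: bhol_frechet_derivative_0)
  note gball = maps_within_ball[OF withinD(1,2)[OF g]]
  have gs: "\<rho> ^ m * norm (member g a x) < s" if "x \<in> ball 0 1" "\<rho> ^ Suc m * norm x < s" for m a x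
  proof -
    have "\<rho> ^ m * norm (member g a x) \<le> \<rho> ^ m * (\<rho> * norm x)"
      using withinD(3)[OF g] by (intro mult_left_mono maps_within_le[OF withinD(1)[OF g] that(1)]) simp
    with that(2) show ?thesis by (simp add: mult_ac)
  qed
  \<comment> \<open>Here m is a number of iterates that brings the points into the ball of radius s.
    The claim is made for all a at once because each iterate moves the base point to \<sigma>
    a.\<close>
  have inj: "x = y" if "x \<in> ball 0 1" "y \<in> ball 0 1" "\<rho> ^ m * norm x < s" "\<rho> ^ m * norm y < s"
    "member h a x = member h a y" for m a x y
    using that
  proof (induction m arbitrary: a x y)
    case 0
    then have xy: "x \<in> ball 0 s" "y \<in> ball 0 s" by auto
    have "norm (member u a x - member u a y) \<le> M * (2 * s)\<^sup>2 / (2 * s - s) * norm (x - y)"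
      using s0 by (intro lipschitz_on_smaller_ball[OF uhol ub _ xy]) auto
    also have "\<dots> \<le> 1 / 2 * norm (x - y)" using Ms by (intro mult_right_mono) auto
    finally have "norm (member u a x - member u a y) \<le> 1 / 2 * norm (x - y)" .
    moreover have "x - y = - (member u a x - member u a y)"
      using 0 by (simp add: hu algebra_simps)
    ultimately have "norm (x - y) \<le> 1 / 2 * norm (x - y)" by (metis norm_minus_cancel)
    then show ?case by simp
  next
    case (Suc m)
    have "member g a x = member g a y"
    \<comment> \<open>Both values of h over \<sigma> a equal \<Lambda>_a applied to the common value
      h_a(x) = h_a(y). Injectivity of g over a then pulls the equality back.\<close>
    proof (rule Suc.IH[of _ _ "\<sigma> a"])
      show "member h (\<sigma> a) (member g a x) = member h (\<sigma> a) (member g a y)"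
        using Suc.prems by (simp only: eqn)
    qed (use Suc.prems gball gs in blast)+
    then show ?case using inj_onD[OF gi] Suc.prems by blast
  qed
  have der: "v = 0" if "x \<in> ball 0 1" "\<rho> ^ m * norm x < s" "fd (member h a) x v = 0" for m a x v
    using that
  proof (induction m arbitrary: a x v)
    case 0
    then have x: "x \<in> ball 0 s" by simp
    have sub: "ball x s \<subseteq> ball 0 (2 * s)" by (rule ball_subset_larger_ball[OF x]) simp
    have ux: "norm (fd (member u a) x v) \<le> M * (2 * s)\<^sup>2 / s * norm v"
      using sub by (intro cauchy_estimate hol_subset[OF uhol sub] s0 ub) auto
    have id: "holomorphic_map_on (\<lambda>x :: complex ^ 'n. x) (ball 0 1)"
      by (rule hol_linear) (simp_all add: bounded_linear_ident)
    have "fd (member h a) x = fd (\<lambda>x. x + member u a x) x"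
      using hu by (intro hol_cong(2)[OF hol_add(1)[OF id bhol_holomorphic] _ 0(1)])
    then have "fd (member h a) x v = v + fd (member u a) x v"
      using hol_add(2)[OF id bhol_holomorphic 0(1), of "apply_bcontfun u a" v]
      by (simp add: fd_eqI[OF has_derivative_ident])
    then have "v = - fd (member u a) x v"
      using 0(3) by (simp add: add_eq_0_iff2)
    then have "norm v \<le> M * (2 * s)\<^sup>2 / s * norm v" using ux by (metis norm_minus_cancel)
    also have "\<dots> \<le> 1 / 2 * norm v" by (intro mult_right_mono Ms) simp
    finally show ?case by simp
  next
    case (Suc m)
    note x = Suc.prems(1)
    let ?l = "diag_map (mult g a)"
    \<comment> \<open>The differentiated conjugacy: a kernel vector of the differential of h at x is
      carried by that of g to a kernel vector at g x, closer to the origin.\<close>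
    have "fd (\<lambda>x. member h (\<sigma> a) (member g a x)) x = fd (\<lambda>x. ?l (member h a x)) x"
      using eqn by (intro hol_cong(2)[OF hol_compose(1)
          [OF diag_map_holomorphic[OF open_UNIV] bhol_holomorphic UNIV_I] _ x])
    then have "fd (member h (\<sigma> a)) (member g a x) (fd (member g a) x v)
        = ?l (fd (member h a) x v)"
      using hol_compose(2)[OF bhol_holomorphic bhol_holomorphic gball x, of "apply_bcontfun h (\<sigma> a)" a v]
        hol_compose(2)[OF diag_map_holomorphic[OF open_UNIV] bhol_holomorphic UNIV_I x,
          of "mult g a" "apply_bcontfun h a" v]
      by (simp add: frechet_derivative_diag_map)
    also have "\<dots> = 0"
      using Suc.prems(3) diag_map_zero_right by simp
    finally have "fd (member g a) x v = 0"
      using Suc.IH[OF gball[OF x] gs[OF x Suc.prems(2)]] by blast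
    then show ?case by (rule gd[OF x])
  qed
  \<comment> \<open>One m serves the whole ball, so the local statement becomes global.\<close>
  obtain m where m: "\<rho> ^ m < s"
    using real_arch_pow_inv[OF s0 withinD(2)[OF g]] by blast
  have ms: "\<rho> ^ m * norm x < s" if "x \<in> ball 0 1" for x :: "complex ^ 'n"
  proof -
    have "\<rho> ^ m * norm x \<le> \<rho> ^ m * 1"
      using that withinD(3)[OF g] by (intro mult_left_mono) auto
    then show ?thesis using m by simp
  qed
  show ?thesis
  proof (rule biholomorphic_intoI[OF bhol_holomorphic])
    show "inj_on (member h a) (ball 0 1)" using inj ms by (intro inj_onI) blast
    show "v = 0" if "x \<in> ball 0 1" "fd (member h a) x v = 0" for x v
      using der[OF that(1) ms[OF that(1)] that(2)] .
  qed
qed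

text \<open>Under (H1) biholomorphy of h follows from tangency and conjugacy, so existence and
  uniqueness become statements about a linear operator on an affine space.\<close>

lemma linearizing_family_iff:
  fixes g h :: "'a \<Rightarrow>\<^sub>C 'n::finite bhol"
  assumes g: "unif_within \<rho> g" and H: "H1 g"
  shows "linearizing_family \<sigma> g h \<longleftrightarrow> h - ident_family \<in> flat 2 \<and> transfer g h = 0"
proof
  assume "linearizing_family \<sigma> g h"
  then show "h - ident_family \<in> flat 2 \<and> transfer g h = 0"
    unfolding tangent_identity_iff transfer_eq_0_iff[OF g] linearizing_family_def by blast
next
  assume R: "h - ident_family \<in> flat 2 \<and> transfer g h = 0"
  have bi: "biholomorphic_into (member g a) (ball 0 1) (ball 0 1)" for a
    using H by (simp add: H1_def)
  have "biholomorphic_into (member h a) (ball 0 1) UNIV" for a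
    using R by (intro conjugacy_biholomorphic[OF g _ _ biholomorphic_into_injective[OF bi]]) auto
  then show "linearizing_family \<sigma> g h"
    using R unfolding tangent_identity_iff transfer_eq_0_iff[OF g] linearizing_family_def by simp
qed

end

section \<open>Holomorphic dependence\<close>

text \<open>All remainders below are quadratic, coming from Cauchy estimates, so differentiability
  reduces to inequalities on a small ball.\<close>

lemma has_derivative_quadratic:
  fixes F :: "'b::real_normed_vector \<Rightarrow> 'c::real_normed_vector"
  assumes D: "bounded_linear D" and e: "0 < e"
    and q: "\<And>y. norm (y - x) < e \<Longrightarrow> norm (F y - F x - D (y - x)) \<le> C * (norm (y - x))\<^sup>2"
  shows "(F has_derivative D) (at x)"
  unfolding has_derivative_at2
proof (intro conjI D)
  show "((\<lambda>y. (1 / norm (y - x)) *\<^sub>R (F y - (F x + D (y - x)))) \<longlongrightarrow> 0) (at x)"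
  proof (rule Lim_null_comparison)
    have "((\<lambda>y. C * norm (y - x)) \<longlongrightarrow> C * norm (x - x)) (at x)"
      by (intro tendsto_intros)
    then show "((\<lambda>y. C * norm (y - x)) \<longlongrightarrow> 0) (at x)" by simp
    show "\<forall>\<^sub>F y in at x. norm ((1 / norm (y - x)) *\<^sub>R (F y - (F x + D (y - x)))) \<le> C * norm (y - x)"
      unfolding eventually_at
    proof (intro exI[of _ e] conjI ballI impI e)
      fix y assume y: "y \<noteq> x \<and> dist y x < e"
      then have "norm (F y - F x - D (y - x)) / norm (y - x) \<le> C * (norm (y - x))\<^sup>2 / norm (y - x)"
        by (intro divide_right_mono q) (auto simp: dist_norm)
      also have "\<dots> = C * norm (y - x)" using y by (simp add: power2_eq_square)
      finally show "norm ((1 / norm (y - x)) *\<^sub>R (F y - (F x + D (y - x)))) \<le> C * norm (y - x)"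
        by (simp add: diff_diff_eq)
    qed
  qed
qed

context skew_base
begin

section \<open>Differentiating the transfer operator with respect to the family\<close>

lemma flat2_scaleC: "u \<in> flat 2 \<Longrightarrow> c *\<^sub>C u \<in> flat 2"
  for u :: "'a \<Rightarrow>\<^sub>C 'n::finite bhol"
  unfolding flat2_iff apply_bcontfun_scaleC lam_scaleC by simp

text \<open>The derivative of g \<mapsto> transfer g h in direction \<delta>, evaluated at a and x.
  It is a bare function at this stage: that it forms a continuous family of bounded holomorphic maps
  is shown separately.\<close>

definition transfer_deriv :: "('a \<Rightarrow>\<^sub>C 'n::finite bhol) \<Rightarrow> ('a \<Rightarrow>\<^sub>C 'n bhol) \<Rightarrow> ('a \<Rightarrow>\<^sub>C 'n bhol) \<Rightarrow>
    'a \<Rightarrow> complex ^ 'n \<Rightarrow> complex ^ 'n" where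
  "transfer_deriv g h \<delta> a x = diag_map (mult \<delta> a) (member h a x)
    - fd (member h (\<sigma> a)) (member g a x) (member \<delta> a x)"

lemma subball:
  assumes g: "unif_within r g" and x: "x \<in> ball 0 1"
  shows "ball (member g a x) (1 - r) \<subseteq> ball 0 1"
proof
  fix y assume "y \<in> ball (member g a x) (1 - r)"
  moreover have "norm (member g a x) \<le> r" using withinD(1)[OF g, of a] x by (simp add: maps_within_def)
  ultimately show "y \<in> ball 0 1"
    using norm_triangle_sub[of y "member g a x"] by (simp add: dist_norm norm_minus_commute)
qed

text \<open>The multiplier term is linear in g and leaves no remainder. What remains is the Taylor
  remainder of h at g_a(x), about which a ball of radius 1 - r is available.\<close>

lemma transfer_second_order:
  fixes g g' h :: "'a \<Rightarrow>\<^sub>C 'n::finite bhol"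
  assumes g: "unif_within r g" "unif_within r g'" and d: "norm (g' - g) < 1 - r" and x: "x \<in> ball 0 1"
  shows "norm (member (transfer g' h - transfer g h) a x - transfer_deriv g h (g' - g) a x)
    \<le> 3 * norm h / (1 - r)\<^sup>2 * (norm (g' - g))\<^sup>2"
proof -
  let ?y = "member g a x" and ?d = "member (g' - g) a x" and ?h = "member h (\<sigma> a)"
  have sub: "ball ?y (1 - r) \<subseteq> ball 0 1" by (rule subball[OF g(1) x])
  have dn: "norm ?d \<le> norm (g' - g)" by (rule norm_member_le)
  have g': "member g' a x = ?y + ?d" unfolding member_diff by simp
  have "diag_map (lam (apply_bcontfun (g' - g) a)) v
      = diag_map (mult g' a) v - diag_map (mult g a) v" for v
    by (simp add: lam_diff diag_map_diff_left)
  then have "member (transfer g' h - transfer g h) a x - transfer_deriv g h (g' - g) a x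
      = - (?h (?y + ?d) - ?h ?y - fd ?h ?y ?d)"
    unfolding member_diff[of "transfer g' h"] member_transfer[OF g(1)] member_transfer[OF g(2)] g' transfer_deriv_def
    by (simp add: algebra_simps)
  also have "norm \<dots> = norm (?h (?y + ?d) - ?h ?y - fd ?h ?y ?d)"
    by (rule norm_minus_cancel)
  also have "\<dots> \<le> 3 * norm h * (norm ?d / (1 - r))\<^sup>2"
  proof (rule taylor_order2)
    show "holomorphic_map_on ?h (ball ?y (1 - r))"
      by (rule hol_subset[OF bhol_holomorphic sub open_ball])
    show "norm ?d < 1 - r" using dn d by linarith
  qed (rule norm_member_le)
  also have "\<dots> \<le> 3 * norm h * (norm (g' - g) / (1 - r))\<^sup>2"
    using dn withinD(2)[OF g(1)] by (intro mult_left_mono power_mono divide_right_mono) auto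
  also have "\<dots> = 3 * norm h / (1 - r)\<^sup>2 * (norm (g' - g))\<^sup>2"
    by (simp add: power_divide)
  finally show ?thesis .
qed

lemma transfer_deriv_bound:
  fixes g h :: "'a \<Rightarrow>\<^sub>C 'n::finite bhol"
  assumes g: "unif_within r g" and x: "x \<in> ball 0 1"
  shows "norm (transfer_deriv g h \<delta> a x) \<le> (1 + 1 / (1 - r)) * norm h * norm \<delta>"
proof -
  have r: "r < 1" by (rule withinD(2)[OF g])
  have sub: "ball (member g a x) (1 - r) \<subseteq> ball 0 1" by (rule subball[OF g x])
  have "norm (diag_map (mult \<delta> a) (member h a x)) \<le> norm (apply_bcontfun \<delta> a) * norm (member h a x)"
    by (rule norm_diag_lam_le)
  also have "\<dots> \<le> norm \<delta> * norm h" by (intro mult_mono norm_bounded norm_member_le) auto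
  finally have 1: "norm (diag_map (mult \<delta> a) (member h a x)) \<le> norm \<delta> * norm h" .
  have "norm (fd (member h (\<sigma> a)) (member g a x) (member \<delta> a x))
      \<le> norm h / (1 - r) * norm (member \<delta> a x)"
    using r by (intro cauchy_estimate hol_subset[OF bhol_holomorphic sub] norm_member_le) auto
  also have "\<dots> \<le> norm h / (1 - r) * norm \<delta>"
    using r by (intro mult_left_mono norm_member_le) auto
  finally have 2: "norm (fd (member h (\<sigma> a)) (member g a x) (member \<delta> a x))
      \<le> norm h / (1 - r) * norm \<delta>" .
  have "norm (transfer_deriv g h \<delta> a x) \<le> norm \<delta> * norm h + norm h / (1 - r) * norm \<delta>"
    unfolding transfer_deriv_def by (rule order_trans[OF norm_triangle_ineq4 add_mono[OF 1 2]])
  also have "\<dots> = (1 + 1 / (1 - r)) * norm h * norm \<delta>"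
  proof -
    have "d * m + m / s * d = (1 + 1 / s) * m * d" for d m s :: real
      by (simp add: algebra_simps)
    then show ?thesis .
  qed
  finally show ?thesis .
qed

lemma transfer_deriv_linear:
  fixes g h :: "'a \<Rightarrow>\<^sub>C 'n::finite bhol"
  assumes g: "unif_within r g" and x: "x \<in> ball 0 1"
  shows "transfer_deriv g h (\<delta> + \<epsilon>) a x = transfer_deriv g h \<delta> a x + transfer_deriv g h \<epsilon> a x"
    and "transfer_deriv g h (c *\<^sub>C \<delta>) a x = c *\<^sub>C transfer_deriv g h \<delta> a x"
proof -
  note D = hol_fd[OF bhol_holomorphic maps_within_ball[OF withinD(1,2)[OF g] x], of "apply_bcontfun h (\<sigma> a)" a]
  note lin = linear_add[OF has_derivative_linear[OF D(1)]]
  have "lam (apply_bcontfun (\<delta> + \<epsilon>) a) = mult \<delta> a + mult \<epsilon> a"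
    using lam_diff[of "apply_bcontfun (\<delta> + \<epsilon>) a" "apply_bcontfun \<epsilon> a"] by simp
  moreover have "diag_map (l + m) y = diag_map l y + diag_map m y" for l m y :: "complex ^ 'n"
    by (simp add: diag_map_def vec_eq_iff algebra_simps)
  ultimately show "transfer_deriv g h (\<delta> + \<epsilon>) a x = transfer_deriv g h \<delta> a x + transfer_deriv g h \<epsilon> a x"
    unfolding transfer_deriv_def member_add lin by (simp add: algebra_simps)
  have "lam (apply_bcontfun (c *\<^sub>C \<delta>) a) = c *\<^sub>C mult \<delta> a"
    unfolding apply_bcontfun_scaleC by (rule lam_scaleC)
  moreover have "diag_map (c *\<^sub>C l) y = c *\<^sub>C diag_map l y" for l y :: "complex ^ 'n"
    by (simp add: diag_map_def vec_eq_iff)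
  moreover have "member (c *\<^sub>C \<delta>) a x = c *\<^sub>C member \<delta> a x" by (rule member_scaleC)
  ultimately show "transfer_deriv g h (c *\<^sub>C \<delta>) a x = c *\<^sub>C transfer_deriv g h \<delta> a x"
    by (simp only: transfer_deriv_def D(2)
        scaleC_diff_right)
qed

text \<open>The pointwise derivative is a continuous family of bounded holomorphic maps because it is a
  uniform limit of difference quotients.\<close>

lemma transfer_deriv_family:
  fixes g h :: "'a \<Rightarrow>\<^sub>C 'n::finite bhol"
  assumes e: "0 < e" and w: "\<And>g'. norm (g' - g) < e \<Longrightarrow> unif_within r g'"
    and h: "h - ident_family \<in> flat 2"
  shows "\<exists>T\<in>flat 2. \<forall>a. \<forall>x\<in>ball 0 1. member T a x = transfer_deriv g h \<delta> a x"
proof -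
  have g: "unif_within r g" using w[of g] e by simp
  have r: "r < 1" by (rule withinD(2)[OF g])
  \<comment> \<open>The largest step length: every g + t \<delta> with 0 < t \<le> b is close enough
    to g for the hypotheses and for the second-order estimate. Adding 1 covers \<delta> = 0.\<close>
  define b where "b = min e (1 - r) / (norm \<delta> + 1)"
  have n1: "0 < norm \<delta> + 1" by (smt (verit) norm_ge_zero)
  have b0: "0 < b" using e r n1 by (simp add: b_def)
  have bd: "b * norm \<delta> < min e (1 - r)"
  proof -
    have "b * norm \<delta> < b * (norm \<delta> + 1)" using b0 by simp
    also have "\<dots> = min e (1 - r)" using n1 by (simp add: b_def)
    finally show ?thesis .
  qed
  define t where "t k = b * inverse (real (Suc k))" for k
  have t: "0 < t k" "t k \<le> b" for k
    using b0 by (simp_all add: t_def mult_le_cancel_left1 inverse_le_1_iff)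
  have t0: "t \<longlonglongrightarrow> 0"
    unfolding t_def[abs_def] using tendsto_mult_right_zero[OF LIMSEQ_inverse_real_of_nat] by blast
  define gk where "gk k = g + t k *\<^sub>R \<delta>" for k
  define Q where "Q k = inverse (t k) *\<^sub>R (transfer (gk k) h - transfer g h)" for k
  define C where "C = 3 * norm h / (1 - r)\<^sup>2 * (norm \<delta>)\<^sup>2"
  have C0: "0 \<le> C" by (simp add: C_def)
  have small: "norm (gk k - g) < min e (1 - r)" for k
  proof -
    have "t k * norm \<delta> \<le> b * norm \<delta>" using t by (intro mult_right_mono) auto
    then show ?thesis using bd t(1)[of k] by (simp add: gk_def)
  qed
  have wk: "unif_within r (gk k)" for k by (rule w) (use small[of k] in simp)
  \<comment> \<open>The rate C t_k is uniform in a and x, so the quotients Q k are Cauchy in the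
    space of families and their limit must be the pointwise derivative.\<close>
  have est: "norm (member (Q k) a x - transfer_deriv g h \<delta> a x) \<le> C * t k" if x: "x \<in> ball 0 1" for k a x
  proof -
    have tk: "t k \<noteq> 0" using t(1)[of k] by simp
    have eq: "gk k - g = of_real (t k) *\<^sub>C \<delta>" by (simp add: gk_def scaleC_of_real)
    have "transfer_deriv g h (gk k - g) a x = t k *\<^sub>R transfer_deriv g h \<delta> a x"
      unfolding eq transfer_deriv_linear(2)[OF g x] by (rule scaleC_of_real)
    moreover have "member (transfer (gk k) h - transfer g h) a x = t k *\<^sub>R member (Q k) a x"
      unfolding Q_def member_scaleR using tk by simp
    ultimately have "t k *\<^sub>R (member (Q k) a x - transfer_deriv g h \<delta> a x)
        = member (transfer (gk k) h - transfer g h) a x - transfer_deriv g h (gk k - g) a x"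
      by (simp only: scaleR_diff_right)
    then have "t k * norm (member (Q k) a x - transfer_deriv g h \<delta> a x)
        = norm (member (transfer (gk k) h - transfer g h) a x - transfer_deriv g h (gk k - g) a x)"
      using t(1)[of k] by (metis abs_of_pos norm_scaleR)
    also have "\<dots> \<le> 3 * norm h / (1 - r)\<^sup>2 * (norm (gk k - g))\<^sup>2"
      by (rule transfer_second_order[OF g wk _ x]) (use small[of k] in simp)
    also have "\<dots> = t k * (C * t k)"
      using t(1)[of k] by (simp add: gk_def C_def power2_eq_square)
    finally show ?thesis using t(1)[of k] by simp
  qed
  have Qd: "norm (Q k - Q m) \<le> C * t k + C * t m" for k m
  proof (rule norm_family_le)
    fix a and x :: "complex ^ 'n" assume x: "x \<in> ball 0 1"
    have "member (Q k - Q m) a x = (member (Q k) a x - transfer_deriv g h \<delta> a x)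
        - (member (Q m) a x - transfer_deriv g h \<delta> a x)"
      unfolding member_diff by simp
    also have "norm \<dots> \<le> C * t k + C * t m"
      by (rule order_trans[OF norm_triangle_ineq4 add_mono[OF est[OF x] est[OF x]]])
    finally show "norm (member (Q k - Q m) a x) \<le> C * t k + C * t m" .
  qed
  have Ct: "(\<lambda>k. C * t k) \<longlonglongrightarrow> 0" by (rule tendsto_mult_right_zero[OF t0])
  have "Cauchy Q"
  proof (rule metric_CauchyI)
    fix \<epsilon> :: real assume "0 < \<epsilon>"
    then obtain N where N: "\<And>k. k \<ge> N \<Longrightarrow> C * t k < \<epsilon> / 2"
      using order_tendstoD(2)[OF Ct, of "\<epsilon> / 2"] by (auto simp: eventually_sequentially)
    have "dist (Q m) (Q n) < \<epsilon>" if "m \<ge> N" "n \<ge> N" for m n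
      using Qd[of m n] N[OF that(1)] N[OF that(2)] unfolding dist_norm by linarith
    then show "\<exists>N. \<forall>m\<ge>N. \<forall>n\<ge>N. dist (Q m) (Q n) < \<epsilon>" by blast
  qed
  then obtain T where T: "Q \<longlonglongrightarrow> T" by (auto simp: Cauchy_convergent_iff convergent_def)
  have scale_flat: "c *\<^sub>R u \<in> flat 2" if "u \<in> flat 2" for c and u :: "'a \<Rightarrow>\<^sub>C 'n bhol"
    using flat2_scaleC[OF that, of "complex_of_real c"] unfolding scaleC_of_real .
  \<comment> \<open>For every nearby family the transfer of h vanishes to second order, because h is
    tangent to the identity; the quotients inherit this and the limit does by closedness.\<close>
  have "Q k \<in> flat 2" for k
    unfolding Q_def by (intro scale_flat flat_diff transfer_tangent_flat[OF wk h] transfer_tangent_flat[OF g h])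
  then have "T \<in> flat 2"
    using closed_flat T unfolding closed_sequential_limits by blast
  moreover have "member T a x = transfer_deriv g h \<delta> a x" if x: "x \<in> ball 0 1" for a x
  proof (rule LIMSEQ_unique[OF member_tendsto[OF T]])
    have "(\<lambda>k. member (Q k) a x - transfer_deriv g h \<delta> a x) \<longlonglongrightarrow> 0"
      by (rule Lim_null_comparison[OF always_eventually Ct]) (use est[OF x] in blast)
    then show "(\<lambda>k. member (Q k) a x) \<longlonglongrightarrow> transfer_deriv g h \<delta> a x"
      by (simp add: LIM_zero_iff)
  qed
  ultimately show ?thesis by blast
qed

text \<open>Implicit differentiation of transfer g (\<Phi> g) = 0. Writing T for the derivative of
  the operator in g at h = \<Phi> g, the candidate D solves transfer g (D \<delta>) = - T \<delta>.
  No continuity of \<Phi> is presupposed: the inverse bound K, common to the whole ball, gives a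
  Lipschitz estimate, which makes the remainder quadratic.\<close>

lemma linearization_holomorphic:
  fixes f :: "'a \<Rightarrow>\<^sub>C 'n::finite bhol" and \<Phi> :: "('a \<Rightarrow>\<^sub>C 'n bhol) \<Rightarrow> ('a \<Rightarrow>\<^sub>C 'n bhol)"
  assumes w: "\<And>g. g \<in> ball f e \<Longrightarrow> unif_within r g"
    and sol: "\<And>g. g \<in> ball f e \<Longrightarrow> solvable (flat 2) (transfer g) K"
    and \<Phi>: "\<And>g. g \<in> ball f e \<Longrightarrow> \<Phi> g - ident_family \<in> flat 2" "\<And>g. g \<in> ball f e \<Longrightarrow> transfer g (\<Phi> g) = 0"
  shows "holomorphic_map_on \<Phi> (ball f e)"
  unfolding holomorphic_map_on_def
proof (intro conjI ballI)
  fix g assume g: "g \<in> ball f e"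
  note wg = w[OF g]
  have r: "r < 1" by (rule withinD(2)[OF wg])
  have K0: "0 \<le> K" and bd: "\<And>g' u. g' \<in> ball f e \<Longrightarrow> u \<in> flat 2 \<Longrightarrow> norm u \<le> K * norm (transfer g' u)"
    using sol g by (auto simp: solvable_def)
  obtain e0 where e0: "0 < e0" "ball g e0 \<subseteq> ball f e" using openE[OF open_ball g] by blast
  define \<eta> where "\<eta> = min e0 (1 - r)"
  have \<eta>: "0 < \<eta>" using e0 r by (simp add: \<eta>_def)
  have near: "g' \<in> ball f e" if "norm (g' - g) < \<eta>" for g'
  proof -
    have "g' \<in> ball g e0" using that by (simp add: \<eta>_def dist_norm norm_minus_commute)
    then show ?thesis using e0(2) by blast
  qed
  define h where "h = \<Phi> g"
  \<comment> \<open>The values of T lie in \<open>flat 2\<close>, which is exactly where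
    \<open>transfer g\<close> can be inverted to form D.\<close>
  have "\<exists>T. \<forall>\<delta>. T \<delta> \<in> flat 2 \<and> (\<forall>a. \<forall>x\<in>ball 0 1. member (T \<delta>) a x = transfer_deriv g h \<delta> a x)"
    by (rule choice, rule allI)
      (use transfer_deriv_family[OF \<eta> w[OF near] \<Phi>(1)[OF g, folded h_def]] in blast)
  then obtain T where T: "\<And>\<delta>. T \<delta> \<in> flat 2"
    "\<And>\<delta> a x. x \<in> ball 0 1 \<Longrightarrow> member (T \<delta>) a x = transfer_deriv g h \<delta> a x" by blast
  have T_add: "T (\<delta> + \<epsilon>) = T \<delta> + T \<epsilon>" for \<delta> \<epsilon>
    by (rule family_eqI) (simp only: T(2) member_add transfer_deriv_linear(1)[OF wg])
  have T_scale: "T (c *\<^sub>C \<delta>) = c *\<^sub>C T \<delta>" for c \<delta>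
    by (rule family_eqI) (simp only: T(2) member_scaleC transfer_deriv_linear(2)[OF wg])
  have T_bd: "norm (T \<delta>) \<le> (1 + 1 / (1 - r)) * norm h * norm \<delta>" for \<delta>
    by (rule norm_family_le) (simp only: T(2) transfer_deriv_bound[OF wg])
  have "\<exists>D. \<forall>\<delta>. D \<delta> \<in> flat 2 \<and> transfer g (D \<delta>) = - T \<delta>"
  proof (rule choice, rule allI)
    fix \<delta>
    have "- T \<delta> \<in> flat 2" using flat_diff[OF flat_0 T(1), of \<delta>] by simp
    then show "\<exists>y. y \<in> flat 2 \<and> transfer g y = - T \<delta>"
      using sol[OF g] unfolding solvable_def by blast
  qed
  then obtain D where D: "\<And>\<delta>. D \<delta> \<in> flat 2" "\<And>\<delta>. transfer g (D \<delta>) = - T \<delta>" by blast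
  \<comment> \<open>Both T and D are obtained by choice. Uniqueness of solutions is what makes D
    complex-linear.\<close>
  have uniq: "u = v" if "u \<in> flat 2" "v \<in> flat 2" "transfer g u = transfer g v" for u v
    using bd[OF g flat_diff[OF that(1,2)]] that(3) by (simp add: transfer_diff[OF wg])
  have D_add: "D (\<delta> + \<epsilon>) = D \<delta> + D \<epsilon>" for \<delta> \<epsilon>
    by (rule uniq[OF D(1) flat_add[OF D(1) D(1)]]) (simp add: transfer_add[OF wg] D(2) T_add)
  have D_scale: "D (c *\<^sub>C \<delta>) = c *\<^sub>C D \<delta>" for c \<delta>
    by (rule uniq[OF D(1) flat2_scaleC[OF D(1)]])
      (simp add: transfer_scaleC[OF wg] D(2) T_scale scaleC_minus_right)
  have "bounded_linear D"
  proof (rule bounded_linear_intro[where K = "K * ((1 + 1 / (1 - r)) * norm h)"])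
    show "D (\<delta> + \<epsilon>) = D \<delta> + D \<epsilon>" for \<delta> \<epsilon> by (rule D_add)
    show "D (c *\<^sub>R \<delta>) = c *\<^sub>R D \<delta>" for c \<delta>
      using D_scale[of "complex_of_real c" \<delta>] by (simp only: scaleC_of_real)
    fix \<delta>
    have "norm (D \<delta>) \<le> K * norm (T \<delta>)" using bd[OF g D(1)[of \<delta>]] by (simp add: D(2))
    also have "\<dots> \<le> K * ((1 + 1 / (1 - r)) * norm h * norm \<delta>)" by (intro mult_left_mono T_bd K0)
    finally show "norm (D \<delta>) \<le> norm \<delta> * (K * ((1 + 1 / (1 - r)) * norm h))" by (simp add: mult_ac)
  qed
  \<comment> \<open>The identity family has norm at most 1 and its transfer at most 2, so \<Phi> g'
    - id has norm at most 2 K.\<close>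
  define B where "B = 1 + K * 2"
  have \<Phi>_bd: "norm (\<Phi> g') \<le> B" if g': "g' \<in> ball f e" for g'
  proof -
    have "transfer g' (\<Phi> g' - ident_family) = - transfer g' ident_family"
      by (simp add: transfer_diff[OF w[OF g']] \<Phi>(2)[OF g'])
    then have "norm (\<Phi> g' - ident_family) \<le> K * norm (transfer g' ident_family)"
      using bd[OF g' \<Phi>(1)[OF g']] by simp
    also have "norm (transfer g' ident_family) \<le> 2 * norm (ident_family :: 'a \<Rightarrow>\<^sub>C 'n bhol)"
      by (rule norm_transfer_le[OF w[OF g']])
    also have "\<dots> \<le> 2" using norm_ident_family_le[where 'n = 'n] by simp
    finally have "norm (\<Phi> g' - ident_family) \<le> K * 2" using K0 by (simp add: mult_left_mono)
    then show ?thesis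
      using norm_triangle_sub[of "\<Phi> g'" ident_family] norm_ident_family_le[where 'n = 'n] by (simp add: B_def)
  qed
  define L where "L = 1 + 2 / (1 - r)"
  have L0: "0 \<le> L" using r by (simp add: L_def)
  have "(\<Phi> has_derivative D) (at g)"
  proof (rule has_derivative_quadratic[OF \<open>bounded_linear D\<close> \<eta>])
    fix g' assume near_g: "norm (g' - g) < \<eta>"
    let ?d = "norm (g' - g)"
    note g' = near[OF near_g]
    have wg': "unif_within r g'" by (rule w[OF g'])
    have fl: "\<Phi> g' - h \<in> flat 2"
      using flat_diff[OF \<Phi>(1)[OF g'] \<Phi>(1)[OF g]] by (simp add: h_def)
    have tr: "norm (transfer g' u - transfer g u) \<le> L * ?d * norm u" for u
      unfolding L_def by (rule norm_transfer_diff_le[OF wg wg'])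
    have h0: "transfer g h = 0" using \<Phi>(2)[OF g] by (simp add: h_def)
    have "norm (\<Phi> g' - h) \<le> K * norm (transfer g (\<Phi> g' - h))" by (rule bd[OF g fl])
    also have "transfer g (\<Phi> g' - h) = - (transfer g' (\<Phi> g') - transfer g (\<Phi> g'))"
      by (simp add: transfer_diff[OF wg] h0 \<Phi>(2)[OF g'])
    also have "norm \<dots> \<le> L * ?d * norm (\<Phi> g')" unfolding norm_minus_cancel by (rule tr)
    also have "\<dots> \<le> L * ?d * B" using L0 by (intro mult_left_mono \<Phi>_bd g') auto
    finally have lip: "norm (\<Phi> g' - h) \<le> K * (L * ?d * B)" using K0 by (simp add: mult_left_mono)
    let ?e = "\<Phi> g' - h - D (g' - g)"
    have T2: "norm (transfer g' h - transfer g h - T (g' - g)) \<le> 3 * norm h / (1 - r)\<^sup>2 * ?d\<^sup>2"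
    proof (rule norm_family_le)
      fix a and x :: "complex ^ 'n" assume x: "x \<in> ball 0 1"
      show "norm (member (transfer g' h - transfer g h - T (g' - g)) a x) \<le> 3 * norm h / (1 - r)\<^sup>2 * ?d\<^sup>2"
        unfolding member_diff[of "transfer g' h - transfer g h"] T(2)[OF x]
        by (rule transfer_second_order[OF wg wg' _ x]) (use near_g in \<open>simp add: \<eta>_def\<close>)
    qed
    \<comment> \<open>The error is split into the second-order remainder of the operator at h and
      the change of the operator applied to \<Phi> g' - h. The latter is a product of two factors of
      size \<open>?d\<close>, by the Lipschitz estimate.\<close>
    have "transfer g ?e = - (transfer g' h - transfer g h - T (g' - g))
        - (transfer g' (\<Phi> g' - h) - transfer g (\<Phi> g' - h))"
      by (simp add: transfer_diff[OF wg] transfer_diff[OF wg'] D(2) h0 \<Phi>(2)[OF g'])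
    also have "norm \<dots> \<le> 3 * norm h / (1 - r)\<^sup>2 * ?d\<^sup>2 + L * ?d * (K * (L * ?d * B))"
    proof (rule order_trans[OF norm_triangle_ineq4 add_mono])
      show "norm (- (transfer g' h - transfer g h - T (g' - g))) \<le> 3 * norm h / (1 - r)\<^sup>2 * ?d\<^sup>2"
        unfolding norm_minus_cancel by (rule T2)
      show "norm (transfer g' (\<Phi> g' - h) - transfer g (\<Phi> g' - h)) \<le> L * ?d * (K * (L * ?d * B))"
        using L0 by (intro order_trans[OF tr] mult_left_mono lip) auto
    qed
    also have "\<dots> = (3 * norm h / (1 - r)\<^sup>2 + L * K * L * B) * ?d\<^sup>2"
    proof -
      have "m * d\<^sup>2 + L * d * (K * (L * d * B)) = (m + L * K * L * B) * d\<^sup>2" for m d :: real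
        by (simp add: algebra_simps power2_eq_square)
      then show ?thesis .
    qed
    finally have "norm (transfer g ?e) \<le> (3 * norm h / (1 - r)\<^sup>2 + L * K * L * B) * ?d\<^sup>2" .
    moreover have "norm ?e \<le> K * norm (transfer g ?e)" by (intro bd g flat_diff fl D(1))
    ultimately have "norm ?e \<le> K * ((3 * norm h / (1 - r)\<^sup>2 + L * K * L * B) * ?d\<^sup>2)"
      using K0 by (meson mult_left_mono order_trans)
    then show "norm (\<Phi> g' - \<Phi> g - D (g' - g)) \<le> (K * (3 * norm h / (1 - r)\<^sup>2 + L * K * L * B)) * ?d\<^sup>2"
      by (simp add: h_def mult.assoc)
  qed
  then show "\<exists>D. (\<Phi> has_derivative D) (at g) \<and> (\<forall>c v. D (c *\<^sub>C v) = c *\<^sub>C D v)"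
    using D_scale by blast
qed simp

lemma linearization_neighbourhood:
  fixes f :: "'a \<Rightarrow>\<^sub>C 'n::finite bhol"
  assumes f: "unif_within \<rho> f" and sol: "solvable (flat 2) (transfer f) K"
  obtains e r K' where "0 < e" "\<And>g. g \<in> ball f e \<Longrightarrow> unif_within r g"
    "\<And>g. g \<in> ball f e \<Longrightarrow> solvable (flat 2) (transfer g) K'"
proof -
  note \<rho> = withinD(2,3)[OF f]
  have K0: "0 \<le> K" using sol by (simp add: solvable_def)
  define r where "r = (1 + \<rho>) / 2"
  have r: "r < 1" "\<rho> \<le> r" "r - \<rho> = (1 - \<rho>) / 2" using \<rho> by (auto simp: r_def field_simps)
  define L where "L = 1 + 2 / (1 - r)"
  have L0: "0 < L" using r by (simp add: L_def add_pos_nonneg)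
  \<comment> \<open>The first bound keeps the members of g within radius r, the midpoint of \<rho>
    and 1; the second gives K L e \<le> 1 / 2, the factor for the perturbation of the inverse. K + 1
    keeps the denominator positive.\<close>
  define e where "e = min ((1 - \<rho>) / 2) (1 / (2 * (L * (K + 1))))"
  have e0: "0 < e" using \<rho> L0 K0 by (simp add: e_def)
  have fr: "unif_within r f"
    using f r unfolding unif_within_def maps_within_def by (meson order_trans)
  have w: "unif_within r g" if g: "g \<in> ball f e" for g
    unfolding unif_within_def maps_within_def
  proof (intro conjI allI ballI r)
    fix a and x :: "complex ^ 'n" assume x: "x \<in> ball 0 1"
    have "norm (member (g - f) a x) \<le> norm (g - f)" by (rule norm_member_le)
    also have "\<dots> \<le> r - \<rho>"
      using g by (simp add: e_def dist_norm norm_minus_commute r(3))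
    finally have "norm (member g a x - member f a x) \<le> r - \<rho>" unfolding member_diff .
    moreover have "norm (member f a x) \<le> \<rho>"
      using withinD(1)[OF f, of a] x by (simp add: maps_within_def)
    ultimately show "norm (member g a x) \<le> r"
      using norm_triangle_sub[of "member g a x" "member f a x"] by linarith
  qed
  have "solvable (flat 2) (transfer g) (K / (1 - 1 / 2))" if g: "g \<in> ball f e" for g
  proof (rule solvable_perturb[OF sol closed_flat flat_0 flat_diff])
    note wg = w[OF g]
    show "transfer f (u - v) = transfer f u - transfer f v" for u v by (rule transfer_diff[OF f])
    show "transfer g (u - v) = transfer g u - transfer g v" for u v by (rule transfer_diff[OF wg])
    show "transfer f u \<in> flat 2" if "u \<in> flat 2" for u by (rule transfer_flat[OF f that])
    show "transfer g u \<in> flat 2" if "u \<in> flat 2" for u by (rule transfer_flat[OF wg that])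
    have ge: "norm (g - f) \<le> e" using g by (simp add: dist_norm norm_minus_commute)
    show "norm (transfer g u - transfer f u) \<le> (L * e) * norm u" for u
    proof -
      have "norm (transfer g u - transfer f u) \<le> L * norm (g - f) * norm u"
        unfolding L_def by (rule norm_transfer_diff_le[OF fr wg])
      also have "\<dots> \<le> (L * e) * norm u"
        using ge L0 by (intro mult_right_mono mult_left_mono) auto
      finally show ?thesis .
    qed
    have "L * e \<le> L * (1 / (2 * (L * (K + 1))))" using L0 by (intro mult_left_mono) (auto simp: e_def)
    also have "\<dots> = 1 / (2 * (K + 1))" using L0 by simp
    finally have "K * (L * e) \<le> K * (1 / (2 * (K + 1)))" by (intro mult_left_mono K0)
    also have "\<dots> \<le> 1 / 2" using K0 by (simp add: field_simps)
    finally show "K * (L * e) \<le> 1 / 2" .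
  qed simp_all
  with that e0 w show thesis by blast
qed

end

theorem theorem3:
  fixes \<sigma> :: "'a::metric_space \<Rightarrow> 'a"
    and f :: "'a \<Rightarrow>\<^sub>C 'n::finite bhol"
  assumes "compact (UNIV :: 'a set)"
    and "\<exists>\<tau>. homeomorphism UNIV UNIV \<sigma> \<tau>"
    and "H1 f" and "H2 f" and "H3 f"
  shows "(\<exists>!h. linearizing_family \<sigma> f h) \<and>
    (\<exists>(U :: ('a \<Rightarrow>\<^sub>C 'n bhol) set) (\<Phi> :: ('a \<Rightarrow>\<^sub>C 'n bhol) \<Rightarrow> ('a \<Rightarrow>\<^sub>C 'n bhol)).
        open U \<and> f \<in> U \<and> holomorphic_map_on \<Phi> U \<and>
        (\<forall>g\<in>U. H1 g \<and> H2 g \<and> H3 g \<longrightarrow> linearizing_family \<sigma> g (\<Phi> g)))"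
proof -
  obtain \<tau> where "homeomorphism UNIV UNIV \<sigma> \<tau>" using assms(2) by blast
  then interpret skew_base \<sigma> \<tau> using assms(1) by unfold_locales
  obtain \<rho> where f: "unif_within \<rho> f" using H1_unif_within[OF assms(3)] by blast
  obtain c where "0 < c" "\<And>a i. c \<le> cmod (mult f a $ i)"
    using H1_lam_lower_bound[OF assms(3)] by blast
  from flat_solvable[OF f H3_nonresonant[OF assms(5)] this]
  obtain K where K: "solvable (flat 2) (transfer f) K" by blast
  obtain e r K' where e: "0 < e" and w: "\<And>g. g \<in> ball f e \<Longrightarrow> unif_within r g"
    and sol: "\<And>g. g \<in> ball f e \<Longrightarrow> solvable (flat 2) (transfer g) K'"
    using linearization_neighbourhood[OF f K] by blast
  \<comment> \<open>The equation is solved for every g in the ball, not only under (H1) to (H3),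
    since \<Phi> has to be holomorphic on an open set. At those g that satisfy (H1) the solution is
    a linearizing family.\<close>
  have "\<exists>h. h - ident_family \<in> flat 2 \<and> transfer g h = 0" if g: "g \<in> ball f e" for g
  proof -
    have "- transfer g ident_family \<in> flat 2"
      using flat_diff[OF flat_0 transfer_ident_flat[OF w[OF g]]] by simp
    then obtain u where "u \<in> flat 2" "transfer g u = - transfer g ident_family"
      using sol[OF g] unfolding solvable_def by blast
    then show ?thesis
      by (intro exI[of _ "u + ident_family"]) (simp add: transfer_add[OF w[OF g]])
  qed
  then obtain \<Phi> where \<Phi>: "\<And>g. g \<in> ball f e \<Longrightarrow> \<Phi> g - ident_family \<in> flat 2"
    "\<And>g. g \<in> ball f e \<Longrightarrow> transfer g (\<Phi> g) = 0" by metis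
  have lin: "linearizing_family \<sigma> g (\<Phi> g)" if "g \<in> ball f e" "H1 g" for g
    using \<Phi> that linearizing_family_iff[OF w[OF that(1)] that(2)] by blast
  have uniq: "h = h'" if "linearizing_family \<sigma> f h" "linearizing_family \<sigma> f h'" for h h'
  proof -
    note H = that[unfolded linearizing_family_iff[OF f assms(3)]]
    \<comment> \<open>Both solutions are tangent to the identity, so their difference lies where the
      a priori bound forces the kernel to be trivial.\<close>
    have "h - h' \<in> flat 2"
      using flat_diff[of "h - ident_family" 2 "h' - ident_family"] H by simp
    then have "norm (h - h') \<le> K * norm (transfer f (h - h'))"
      using K unfolding solvable_def by blast
    then show ?thesis using H by (simp add: transfer_diff[OF f])
  qed
  have "holomorphic_map_on \<Phi> (ball f e)"
    by (rule linearization_holomorphic[OF w sol \<Phi>])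
  then have "\<exists>U \<Phi>. open U \<and> f \<in> U \<and> holomorphic_map_on \<Phi> U \<and>
      (\<forall>g\<in>U. H1 g \<and> H2 g \<and> H3 g \<longrightarrow> linearizing_family \<sigma> g (\<Phi> g))"
    using lin e by (intro exI[of _ "ball f e"] exI[of _ \<Phi>]) auto
  moreover have "\<exists>!h. linearizing_family \<sigma> f h"
    using lin[of f] uniq e assms(3) by (metis centre_in_ball)
  ultimately show ?thesis by blast
qed

end
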